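(* Let $M$ be a Riemannian manifold, let $X_1,X_2$ be z-KROK random fields on $M$ with values in $\mathbb{R}^k$, and let $Z_i=X_i^{-1}(0)$ for $i=1,2$. Let $\Omega\subset C^1(M,\mathbb{R}^k)$ be the subset of functions for which $0$ is a regular value. Assume that $$\mathbb{P}\{Z_1\in W\}=\mathbb{P}\{Z_2\in W\}$$ for every family $W$ of submanifolds of $M$ such that the set $\{f\in\Omega: f^{-1}(0)\in W\}$ is Borel in $C^1(M,\mathbb{R}^k)$. Then $\underline{\zeta_{X_1}}=\underline{\zeta_{X_2}}$, i.e. $\underline{\zeta_{X_1}(p)}=\underline{\zeta_{X_2}(p)}$ for all $p\in M$.
   Context: Random fields. $M$ is a smooth manifold, possibly non-compact, with Riemannian metric $g$. $C^1(M,\mathbb{R}^k)$ carries the weak Whitney topology; a random field $X$ is a measurable map from a probability space into it; $[Y]$ denotes the law of a random element $Y$. For $f\in C^1(M,\mathbb{R}^k)$ let $J_pf:=\|d_pf^1\wedge\cdots\wedge d_pf^k\|$, with the norm on $\Lambda^kT^*_pM$ induced by $g$ through $\langle v_1\wedge\dots\wedge v_k,w_1\wedge\dots\wedge w_k\rangle=\det(\langle v_i,w_j\rangle)_{i,j}$. A regular conditional probability of $X$ given $X(p)$ is a map $(x,B)\mapsto\mu(p,x)(B)$ ($x\in\mathbb{R}^k$, $B\subset C^1(M,\mathbb{R}^k)$ Borel) such that each $\mu(p,x)$ is a Borel probability measure, $x\mapsto\mu(p,x)(B)$ is Borel, and $\mathbb{P}\{X\in B,\,X(p)\in V\}=\int_V\mu(p,x)(B)\,d[X(p)](x)$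 for all Borel $B$ and $V\subset\mathbb{R}^k$. $X$ is z-KROK if: (i) $X$ is a random element of $C^1(M,\mathbb{R}^k)$; (ii) almost surely $0$ is a regular value of $X$; (iii) for every $p\in M$ the law of $X(p)$ is absolutely continuous with density $\rho_{X(p)}:\mathbb{R}^k\to[0,+\infty)$; (iv) $(p,x)\mapsto\rho_{X(p)}(x)$ on $M\times\mathbb{R}^k$ is continuous at $(p,0)$ for all $p\in M$; (v) there are regular conditional probabilities $\mu(p,\cdot)$ of $X$ given $X(p)$, $p\in M$, such that the measures $J_p\cdot\mu(p,x)$, $B\mapsto\int_BJ_pf\,d\mu(p,x)(f)$, are finite and $(p,x)\mapsto J_p\cdot\mu(p,x)$, with values in the finite positive Borel measures on $C^1(M,\mathbb{R}^k)$ with the weak topology (tested on bounded continuous functions), is continuous at $(p,0)$ for all $p\in M$. With this $\mu$, write $\mathbb{E}\{\Phi(X)\,|\,X(p)=0\}:=\int\Phi\,d\mu(p,0)$. Zonoid section. $\zeta_X(p):=\mathbb{E}\{[0,d_pX^1\wedge\cdots\wedge d_pX^k]\,|\,X(p)=0\}\,\rho_{X(p)}(0)$ is the zonoid (Hausdorff limit of finite Minkowski sums of segments) in $\Lambda^kT_p^*M$ with support function $u\mapsto\rho_{X(p)}(0)\,\mathbb{E}\{\max\{0,\langle d_pX^1\wedge\cdots\wedge d_pX^k,u\rangle\}\,|\,X(p)=0\}$, $u\in\Lambda^kT_pM$. $\underline{\zeta_X(p)}$ is its translate centered at the origin; its support function is $u\mapsto\frac12\rho_{X(p)}(0)\,\mathbb{E}\{|\langle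 d_pX^1\wedge\cdots\wedge d_pX^k,u\rangle|\,|\,X(p)=0\}$. *)

theory Defs
  imports "HOL-Probability.Probability"
begin

section \<open>Differentiability classes and smooth manifolds\<close>

text \<open>Being of class \<open>C\<^sup>r\<close> on a set \<open>S\<close>, which is open in all uses below.\<close>

primrec C_on :: "nat \<Rightarrow> 'a::euclidean_space set \<Rightarrow> ('a \<Rightarrow> 'b::real_normed_vector) \<Rightarrow> bool" where
  "C_on 0 S f \<longleftrightarrow> continuous_on S f"
| "C_on (Suc r) S f \<longleftrightarrow>
     (\<forall>x\<in>S. f differentiable (at x)) \<and>
     (\<forall>v. C_on r S (\<lambda>x. frechet_derivative f (at x) v))"

definition smooth_on :: "'a::euclidean_space set \<Rightarrow> ('a \<Rightarrow> 'b::real_normed_vector) \<Rightarrow> bool" where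
  "smooth_on S f \<longleftrightarrow> (\<forall>r. C_on r S f)"

text \<open>A chart is a pair of a domain and a coordinate map; the values of the map outside the domain
  are irrelevant.\<close>

type_synonym ('m, 'n) chart = "'m set \<times> ('m \<Rightarrow> real^'n)"

definition chart_inv :: "('m, 'n::finite) chart \<Rightarrow> real^'n \<Rightarrow> 'm" where
  "chart_inv c = inv_into (fst c) (snd c)"

definition top_chart :: "('m::topological_space, 'n::finite) chart \<Rightarrow> bool" where
  "top_chart c \<longleftrightarrow> open (fst c) \<and> open (snd c ` fst c) \<and>
     homeomorphism (fst c) (snd c ` fst c) (snd c) (chart_inv c)"

text \<open>The manifold is the whole (Hausdorff, second countable) type \<open>'m\<close>; the atlas need not be
  maximal.\<close>

definition smooth_atlas :: "('m::{t2_space,second_countable_topology}, 'n::finite) chart set \<Rightarrow> bool" where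
  "smooth_atlas A \<longleftrightarrow>
     (\<forall>c\<in>A. top_chart c) \<and> (\<Union>c\<in>A. fst c) = UNIV \<and>
     (\<forall>c\<in>A. \<forall>c'\<in>A. smooth_on (snd c ` (fst c \<inter> fst c')) (snd c' \<circ> chart_inv c))"

text \<open>As usual for manifolds over a fixed model space, the tangent space at \<open>p\<close> is identified with
  \<open>real^'n\<close> through a preferred chart around \<open>p\<close>.  Covectors at \<open>p\<close> are represented by
  their components in the same chart, so that the evaluation pairing is the inner product of
  \<open>real^'n\<close>.\<close>

definition chart_at :: "('m, 'n::finite) chart set \<Rightarrow> 'm \<Rightarrow> ('m, 'n) chart" where
  "chart_at A p = (SOME c. c \<in> A \<and> p \<in> fst c)"

text \<open>Row \<open>i\<close> of this matrix is the covector \<open>d\<^sub>pf\<^sup>i\<close>.\<close>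

definition differential ::
    "('m, 'n::finite) chart set \<Rightarrow> ('m \<Rightarrow> real^'k::finite) \<Rightarrow> 'm \<Rightarrow> real^'n^'k" where
  "differential A f p =
     (let c = chart_at A p in matrix (frechet_derivative (f \<circ> chart_inv c) (at (snd c p))))"

text \<open>\<open>g p\<close> is the Gram matrix of the metric on the tangent space at \<open>p\<close>.  Smoothness refers to
  the coefficients in each chart \<open>c\<close> of the atlas, which are obtained from \<open>g\<close> by the Jacobian
  \<open>D\<close> of the transition from \<open>c\<close> to the preferred chart.\<close>

definition metric_coeffs ::
    "('m, 'n::finite) chart set \<Rightarrow> ('m \<Rightarrow> real^'n^'n) \<Rightarrow> ('m, 'n) chart \<Rightarrow> real^'n \<Rightarrow> real^'n^'n" where
  "metric_coeffs A g c x =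
     (let q = chart_inv c x;
          D = matrix (frechet_derivative (snd (chart_at A q) \<circ> chart_inv c) (at x))
      in transpose D ** g q ** D)"

definition riemannian_metric ::
    "('m, 'n::finite) chart set \<Rightarrow> ('m \<Rightarrow> real^'n^'n) \<Rightarrow> bool" where
  "riemannian_metric A g \<longleftrightarrow>
     (\<forall>p. transpose (g p) = g p \<and> (\<forall>v. v \<noteq> 0 \<longrightarrow> 0 < v \<bullet> (g p *v v))) \<and>
     (\<forall>c\<in>A. smooth_on (snd c ` fst c) (metric_coeffs A g c))"

text \<open>The induced inner product of covectors.\<close>

definition covector_inner :: "real^'n^'n \<Rightarrow> real^'n \<Rightarrow> real^'n::finite \<Rightarrow> real" where
  "covector_inner G a b = a \<bullet> (matrix_inv G *v b)"

section \<open>The space of \<open>C\<^sup>1\<close> maps\<close>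

definition C1_maps :: "('m, 'n::finite) chart set \<Rightarrow> ('m \<Rightarrow> real^'k::finite) set" where
  "C1_maps A = {f. \<forall>c\<in>A. C_on 1 (snd c ` fst c) (f \<circ> chart_inv c)}"

definition whitney_nbhd ::
    "('m, 'n::finite) chart set \<Rightarrow> ('m \<Rightarrow> real^'k::finite) \<Rightarrow> ('m, 'n) chart \<Rightarrow> 'm set \<Rightarrow> real
      \<Rightarrow> ('m \<Rightarrow> real^'k) set" where
  "whitney_nbhd A f c K e =
     {h \<in> C1_maps A. \<forall>x\<in>K. norm (h x - f x) < e \<and>
        onorm (\<lambda>v. frechet_derivative (h \<circ> chart_inv c) (at (snd c x)) v
                 - frechet_derivative (f \<circ> chart_inv c) (at (snd c x)) v) < e}"

definition weak_whitney ::
    "('m::topological_space, 'n::finite) chart set \<Rightarrow> ('m \<Rightarrow> real^'k::finite) topology" where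
  "weak_whitney A = topology_generated_by
     {whitney_nbhd A f c K e | f c K e.
        f \<in> C1_maps A \<and> c \<in> A \<and> compact K \<and> K \<subseteq> fst c \<and> e > 0}"

definition borel_C1 ::
    "('m::topological_space, 'n::finite) chart set \<Rightarrow> ('m \<Rightarrow> real^'k::finite) measure" where
  "borel_C1 A = sigma (topspace (weak_whitney A)) {U. openin (weak_whitney A) U}"

definition zero_set :: "('m \<Rightarrow> real^'k::finite) \<Rightarrow> 'm set" where
  "zero_set f = {p. f p = 0}"

text \<open>The set \<open>\<Omega>\<close> of maps having \<open>0\<close> as a regular value.\<close>

definition regular_maps :: "('m, 'n::finite) chart set \<Rightarrow> ('m \<Rightarrow> real^'k::finite) set" where
  "regular_maps A = {f \<in> C1_maps A. \<forall>p\<in>zero_set f. surj (\<lambda>v. differential A f p *v v)}"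

text \<open>Embedded submanifolds of class \<open>C\<^sup>1\<close> (the zero sets of the fields are not smoother than
  that): locally slices in charts of the underlying \<open>C\<^sup>1\<close> structure.\<close>

definition C1_chart :: "('m::topological_space, 'n::finite) chart set \<Rightarrow> ('m, 'n) chart \<Rightarrow> bool" where
  "C1_chart A c \<longleftrightarrow> top_chart c \<and>
     (\<forall>c'\<in>A. C_on 1 (snd c ` (fst c \<inter> fst c')) (snd c' \<circ> chart_inv c) \<and>
             C_on 1 (snd c' ` (fst c \<inter> fst c')) (snd c \<circ> chart_inv c'))"

definition C1_submanifold :: "('m::topological_space, 'n::finite) chart set \<Rightarrow> 'm set \<Rightarrow> bool" where
  "C1_submanifold A S \<longleftrightarrow>
     (\<exists>d. \<forall>p\<in>S. \<exists>c L. C1_chart A c \<and> p \<in> fst c \<and> subspace L \<and> dim L = d \<and>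
        snd c ` (S \<inter> fst c) = snd c ` fst c \<inter> L)"

section \<open>Exterior powers\<close>

text \<open>An alternating \<open>k\<close>-form \<open>\<omega>\<close> on \<open>real^'n\<close>, with \<open>k = CARD('k)\<close>, is represented by
  all its components \<open>\<omega> $ s = \<omega>(e\<^bsub>s(1)\<^esub>,\<dots>,e\<^bsub>s(k)\<^esub>)\<close>, indexed by \<open>s :: 'k \<Rightarrow> 'n\<close>; likewise for
  \<open>k\<close>-vectors.\<close>

definition alt_tensors :: "(real^('k::finite \<Rightarrow> 'n::finite)) set" where
  "alt_tensors = {w. (\<forall>s. \<not> inj s \<longrightarrow> w $ s = 0) \<and>
     (\<forall>s \<pi>. \<pi> permutes UNIV \<longrightarrow> w $ (s \<circ> \<pi>) = of_int (sign \<pi>) * w $ s)}"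

text \<open>The wedge product of the rows of a matrix.\<close>

definition wedge :: "real^'n^'k \<Rightarrow> real^('k::finite \<Rightarrow> 'n::finite)" where
  "wedge a = (\<chi> s. det (\<chi> i j. a $ i $ s j))"

text \<open>The duality of \<open>k\<close>-forms and \<open>k\<close>-vectors.  The sum over all \<open>s\<close> counts each \<open>k\<close>-subset of
  coordinates \<open>k!\<close> times, whence the factor: this is the pairing whose value on a wedge of covectors
  \<open>a\<^sub>i\<close> and a wedge of vectors \<open>b\<^sub>j\<close> is \<open>det (a\<^sub>i(b\<^sub>j))\<close>.\<close>

definition pairing :: "real^('k::finite \<Rightarrow> 'n::finite) \<Rightarrow> real^('k \<Rightarrow> 'n) \<Rightarrow> real" where
  "pairing w u = (w \<bullet> u) / fact CARD('k)"

text \<open>\<open>J\<^sub>pf\<close>, the norm of \<open>d\<^sub>pf\<^sup>1 \<and> \<dots> \<and> d\<^sub>pf\<^sup>k\<close> for the inner product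
  \<open>\<langle>v\<^sub>1 \<and> \<dots> \<and> v\<^sub>k, w\<^sub>1 \<and> \<dots> \<and> w\<^sub>k\<rangle> = det (\<langle>v\<^sub>i, w\<^sub>j\<rangle>)\<close>.\<close>

definition jac :: "('m, 'n::finite) chart set \<Rightarrow> ('m \<Rightarrow> real^'n^'n) \<Rightarrow> 'm \<Rightarrow> ('m \<Rightarrow> real^'k::finite) \<Rightarrow> real" where
  "jac A g p f =
     (let D = differential A f p
      in sqrt (det (\<chi> i j. covector_inner (g p) (D $ i) (D $ j) :: real^'k^'k)))"

section \<open>z-KROK fields\<close>

text \<open>\<open>\<rho> p\<close> is the density of \<open>X(p)\<close> and \<open>\<mu> p\<close> the regular conditional probability given
  \<open>X(p)\<close>.  Both are exposed as parameters, because the zonoid section is formed with them.\<close>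

definition regular_conditional_prob ::
    "('m::topological_space, 'n::finite) chart set \<Rightarrow> 'a measure \<Rightarrow> ('a \<Rightarrow> 'm \<Rightarrow> real^'k::finite) \<Rightarrow> 'm
      \<Rightarrow> (real^'k \<Rightarrow> ('m \<Rightarrow> real^'k) measure) \<Rightarrow> bool" where
  "regular_conditional_prob A P X p \<kappa> \<longleftrightarrow>
     (\<forall>x. prob_space (\<kappa> x) \<and> sets (\<kappa> x) = sets (borel_C1 A)) \<and>
     (\<forall>B\<in>sets (borel_C1 A). (\<lambda>x. measure (\<kappa> x) B) \<in> borel_measurable borel) \<and>
     (\<forall>B\<in>sets (borel_C1 A). \<forall>V\<in>sets borel.
        measure P {\<omega> \<in> space P. X \<omega> \<in> B \<and> X \<omega> p \<in> V} =
        (LINT x:V|distr P borel (\<lambda>\<omega>. X \<omega> p). measure (\<kappa> x) B))"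

definition jac_measure ::
    "('m, 'n::finite) chart set \<Rightarrow> ('m \<Rightarrow> real^'n^'n) \<Rightarrow> 'm \<Rightarrow> ('m \<Rightarrow> real^'k::finite) measure
      \<Rightarrow> ('m \<Rightarrow> real^'k) measure" where
  "jac_measure A g p \<nu> = density \<nu> (\<lambda>f. ennreal (jac A g p f))"

definition z_KROK ::
    "('m::{t2_space,second_countable_topology}, 'n::finite) chart set \<Rightarrow> ('m \<Rightarrow> real^'n^'n)
      \<Rightarrow> 'a measure \<Rightarrow> ('a \<Rightarrow> 'm \<Rightarrow> real^'k::finite)
      \<Rightarrow> ('m \<Rightarrow> real^'k \<Rightarrow> real) \<Rightarrow> ('m \<Rightarrow> real^'k \<Rightarrow> ('m \<Rightarrow> real^'k) measure) \<Rightarrow> bool" where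
  "z_KROK A g P X \<rho> \<mu> \<longleftrightarrow>
     prob_space P \<and>
     X \<in> measurable P (borel_C1 A) \<and>
     (AE \<omega> in P. X \<omega> \<in> regular_maps A) \<and>
     (\<forall>p x. 0 \<le> \<rho> p x) \<and>
     (\<forall>p. distributed P lborel (\<lambda>\<omega>. X \<omega> p) (\<lambda>x. ennreal (\<rho> p x))) \<and>
     (\<forall>p. isCont (\<lambda>(q, x). \<rho> q x) (p, 0)) \<and>
     (\<forall>p. regular_conditional_prob A P X p (\<mu> p)) \<and>
     (\<forall>p x. finite_measure (jac_measure A g p (\<mu> p x))) \<and>
     (\<forall>p. \<forall>\<Phi>. continuous_map (weak_whitney A) euclideanreal \<Phi> \<and>
             bounded (\<Phi> ` topspace (weak_whitney A)) \<longrightarrow>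
             isCont (\<lambda>(q, x). \<integral>f. \<Phi> f \<partial>(jac_measure A g q (\<mu> q x))) (p, 0))"

section \<open>Zonoids\<close>

definition zonotope :: "nat \<Rightarrow> (nat \<Rightarrow> 'a::euclidean_space) \<Rightarrow> (nat \<Rightarrow> 'a) \<Rightarrow> 'a set" where
  "zonotope n a b = {(\<Sum>i<n. x i) | x. \<forall>i<n. x i \<in> closed_segment (a i) (b i)}"

definition hausdorff_limit :: "(nat \<Rightarrow> 'a::metric_space set) \<Rightarrow> 'a set \<Rightarrow> bool" where
  "hausdorff_limit S K \<longleftrightarrow>
     (\<forall>e>0. \<forall>\<^sub>F n in sequentially.
        (\<forall>x\<in>K. \<exists>y\<in>S n. dist x y < e) \<and> (\<forall>y\<in>S n. \<exists>x\<in>K. dist x y < e))"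

definition zonoid :: "'a::euclidean_space set \<Rightarrow> bool" where
  "zonoid K \<longleftrightarrow> compact K \<and> convex K \<and> K \<noteq> {} \<and>
     (\<exists>N a b. hausdorff_limit (\<lambda>n. zonotope (N n) (a n) (b n)) K)"

definition support_fun :: "(real^('k::finite \<Rightarrow> 'n::finite)) set \<Rightarrow> real^('k \<Rightarrow> 'n) \<Rightarrow> real" where
  "support_fun K u = (SUP w\<in>K. pairing w u)"

text \<open>\<open>zonoid_section A \<rho> \<mu> p\<close> is \<open>\<zeta>\<^sub>X(p)\<close>.\<close>

definition zonoid_section ::
    "('m, 'n::finite) chart set \<Rightarrow> ('m \<Rightarrow> real^'k::finite \<Rightarrow> real)
      \<Rightarrow> ('m \<Rightarrow> real^'k \<Rightarrow> ('m \<Rightarrow> real^'k) measure) \<Rightarrow> 'm \<Rightarrow> (real^('k \<Rightarrow> 'n)) set" where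
  "zonoid_section A \<rho> \<mu> p =
     (THE K. zonoid K \<and> K \<subseteq> alt_tensors \<and>
        (\<forall>u\<in>alt_tensors. support_fun K u =
           \<rho> p 0 * (\<integral>f. max 0 (pairing (wedge (differential A f p)) u) \<partial>(\<mu> p 0))))"

definition centered :: "'a::real_vector set \<Rightarrow> 'a set" where
  "centered K = (THE L. (\<exists>c. L = (\<lambda>x. c + x) ` K) \<and> uminus ` L = L)"

end

theory Submission
  imports Defs
begin

text \<open>Fix a point, a chart around it and a coordinate \<open>k\<close>-disc of radius \<open>\<delta>\<close> through it.  The functional
  that assigns to a regular map the largest value, over its zeros on the disc, of a bounded even
  \<open>0\<close>-homogeneous weight of \<open>df\<^sup>1 \<and> \<dots> \<and> df\<^sup>k\<close> depends on the zero set only and is Borel, so both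
  fields give it the same expectation.  Divided by the volume of the disc, this expectation tends to
  \<open>\<rho>(p,0)\<close> times the conditional expectation of the weight multiplied by one coordinate minor of
  the differential.  This is a local Kac-Rice argument: by the area formula the functional is the limit
  of the integral over the disc of the weighted Jacobian on \<open>|f| < \<epsilon>\<close> divided by the volume of the
  \<open>\<epsilon>\<close>-ball, and the expectation of such an integral is controlled by the continuity of
  \<open>\<rho>\<close> and of \<open>J\<^sub>p \<cdot> \<mu>(p,x)\<close> at \<open>(p,0)\<close>, tested on bounded continuous functionals that squeeze the
  discontinuous integrand from both sides.

  With the weight \<open>|\<langle>w,u\<rangle>| |w\<^sub>s| / |w|\<^sup>2\<close>, summation over all coordinate directions \<open>s\<close> recovers
  \<open>\<rho>(p,0) E{|\<langle>w,u\<rangle>| | X(p) = 0}\<close> for every \<open>u\<close>.  The support functions of the two zonoid sections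
  therefore differ by a linear function, i.e. the sections are translates of each other.\<close>

section \<open>The area formula for an arbitrary finite index type\<close>

text \<open>Condition (v) tests the Jacobian-weighted measures on bounded continuous functionals
  only, while the quotient of the wanted integrand by the Jacobian is discontinuous where the
  Jacobian vanishes, and a sum over zeros is unbounded. Both obstacles shape the proof. A maximum
  over the zeros stays below \<open>norm u\<close>, so moments of the number of zeros never enter;
  nothing is lost in the limit, because the minorants live on maps that are injective on the disc
  and so have at most one zero there. The lower bound for the expectation comes from the reverse
  Fatou lemma with a constant dominating function, the upper bound from Fatou's lemma. In the upper
  bound a zero must have room around it, so the integral runs over a larger disc, of radius (1 + t)
  times the first; the volume ratio (1 + t)^k disappears as t tends to 0. Evenness and 0-homogeneity
  of the weight are what dependence on the zero set demands: two regular maps with the same zeros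
  have, at each zero, differentials related by an invertible matrix, which multiplies the wedge by
  its determinant.\<close>

text \<open>The library states the area formula for well-ordered index types only.\<close>

typedef ('k::finite) ix = "{i::nat. i < CARD('k)}"
  by (rule exI[of _ 0]) simp

instantiation ix :: (finite) linorder
begin
definition less_eq_ix :: "'a ix \<Rightarrow> 'a ix \<Rightarrow> bool" where "less_eq_ix a b \<longleftrightarrow> Rep_ix a \<le> Rep_ix b"
definition less_ix :: "'a ix \<Rightarrow> 'a ix \<Rightarrow> bool" where "less_ix a b \<longleftrightarrow> Rep_ix a < Rep_ix b"
instance
  by intro_classes (auto simp: less_eq_ix_def less_ix_def Rep_ix_inject)
end

instance ix :: (finite) wellorder
proof -
  have "{(x, y :: 'a ix). x < y} = inv_image less_than Rep_ix"
    by (auto simp: inv_image_def less_ix_def)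
  then have "wf {(x, y :: 'a ix). x < y}" by (simp add: wf_inv_image)
  then show "OFCLASS('a ix, wellorder_class)"
    by (rule wf_wellorderI) intro_classes
qed

lemma bij_betw_Rep_ix: "bij_betw (Rep_ix :: 'k::finite ix \<Rightarrow> nat) UNIV {i. i < CARD('k)}"
  by (auto simp: bij_betw_def inj_on_def Rep_ix_inject type_definition.Rep_range[OF type_definition_ix])

instance ix :: (finite) finite
proof
  show "finite (UNIV :: 'a ix set)"
    using bij_betw_finite[OF bij_betw_Rep_ix[where 'k='a]] by simp
qed

lemma ex_bij_ix: "\<exists>e :: 'k::finite ix \<Rightarrow> 'k. bij e"
proof -
  have "card (UNIV :: 'k ix set) = CARD('k)"
    using bij_betw_same_card[OF bij_betw_Rep_ix[where 'k='k]] by simp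
  then show ?thesis
    using finite_same_card_bij[of "UNIV :: 'k ix set" "UNIV :: 'k set"] by auto
qed

text \<open>Conjugating the transposition of \<open>a\<close> and \<open>b\<close> by
  \<open>e\<close> gives the transposition of their preimages, so both signs flip together when one
  transposition is peeled off.\<close>

lemma sign_conj_bij:
  fixes e :: "'a::finite \<Rightarrow> 'b::finite"
  assumes e: "bij e" and p: "p permutes (UNIV :: 'b set)"
  shows "sign (inv e \<circ> p \<circ> e) = sign p"
  using p finite[of "UNIV :: 'b set"]
proof (induction rule: permutes_induct)
  case id
  have "inv e \<circ> id \<circ> e = id" using e by (auto simp: fun_eq_iff bij_is_inj)
  then show ?case by simp
next
  case (swap a b p)
  have inj: "inj (inv e)" using e by (simp add: bij_imp_bij_inv bij_is_inj)
  have eq: "inv e \<circ> (Transposition.transpose a b \<circ> p) \<circ> e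
     = Transposition.transpose (inv e a) (inv e b) \<circ> (inv e \<circ> p \<circ> e)"
    by (rule ext) (simp add: Transposition.transpose_def inj_eq[OF inj])
  have perm: "permutation (inv e \<circ> p \<circ> e)"
  proof -
    have "bij (inv e \<circ> p \<circ> e)"
      using e swap.hyps by (intro bij_comp bij_imp_bij_inv permutes_bij)
    then show ?thesis by (simp add: permutation)
  qed
  have perm': "permutation p" using swap.hyps by (auto simp: permutation_permutes)
  have ne: "inv e a \<noteq> inv e b" using swap.hyps inj by (simp add: inj_eq)
  have "sign (inv e \<circ> (Transposition.transpose a b \<circ> p) \<circ> e)
      = sign (Transposition.transpose (inv e a) (inv e b)) * sign (inv e \<circ> p \<circ> e)"
    unfolding eq by (rule sign_compose[OF permutation_swap_id perm])
  also have "\<dots> = sign (Transposition.transpose a b) * sign p"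
    unfolding swap.IH using ne swap.hyps by (simp add: sign_swap_id)
  also have "\<dots> = sign (Transposition.transpose a b \<circ> p)"
    by (rule sign_compose[OF permutation_swap_id perm', symmetric])
  finally show ?case .
qed

text \<open>Conjugation by \<open>e\<close> matches the terms of the two Leibniz sums: signs are
  kept by \<open>sign_conj_bij\<close>, and each product is only relabelled.\<close>

lemma det_reindex:
  fixes e :: "'a::finite \<Rightarrow> 'b::finite" and A :: "real^'b^'b"
  assumes e: "bij e"
  shows "det (\<chi> i j. A $ e i $ e j :: real^'a^'a) = det A"
proof -
  let ?h = "\<lambda>p. inv e \<circ> p \<circ> e"
  have bij: "bij_betw ?h {p. p permutes (UNIV :: 'b set)} {p. p permutes (UNIV :: 'a set)}"
  proof (rule bij_betw_byWitness[where f' = "\<lambda>q. e \<circ> q \<circ> inv e"])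
    show "\<forall>p\<in>{p. p permutes UNIV}. e \<circ> (inv e \<circ> p \<circ> e) \<circ> inv e = p"
      using e by (auto simp: fun_eq_iff bij_is_surj surj_f_inv_f)
    show "\<forall>q\<in>{q. q permutes UNIV}. inv e \<circ> (e \<circ> q \<circ> inv e) \<circ> e = q"
      using e by (auto simp: fun_eq_iff bij_is_inj)
    show "?h ` {p. p permutes UNIV} \<subseteq> {p. p permutes UNIV}"
      using e by (auto intro!: bij_imp_permutes bij_comp bij_imp_bij_inv permutes_bij)
    show "(\<lambda>q. e \<circ> q \<circ> inv e) ` {p. p permutes UNIV} \<subseteq> {p. p permutes UNIV}"
      using e by (auto intro!: bij_imp_permutes bij_comp bij_imp_bij_inv permutes_bij)
  qed
  have prod: "(\<Prod>i\<in>UNIV. A $ e i $ e (?h p i)) = (\<Prod>i\<in>UNIV. A $ i $ p i)" for p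
  proof -
    have "(\<Prod>i\<in>UNIV. A $ e i $ e (?h p i)) = (\<Prod>i\<in>UNIV. A $ e i $ p (e i))"
      using e by (simp add: bij_is_surj surj_f_inv_f)
    also have "\<dots> = (\<Prod>i\<in>UNIV. A $ i $ p i)"
      by (rule prod.reindex_bij_betw[OF e, of "\<lambda>i. A $ i $ p i"])
    finally show ?thesis .
  qed
  have "det (\<chi> i j. A $ e i $ e j :: real^'a^'a)
      = (\<Sum>q | q permutes UNIV. of_int (sign q) * (\<Prod>i\<in>UNIV. A $ e i $ e (q i)))"
    by (simp add: det_def)
  also have "\<dots> = (\<Sum>p | p permutes UNIV. of_int (sign (?h p)) * (\<Prod>i\<in>UNIV. A $ e i $ e (?h p i)))"
    by (rule sum.reindex_bij_betw[OF bij, symmetric])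
  also have "\<dots> = (\<Sum>p | p permutes UNIV. of_int (sign p) * (\<Prod>i\<in>UNIV. A $ i $ p i))"
    unfolding prod by (intro sum.cong refl) (simp add: sign_conj_bij[OF e])
  also have "\<dots> = det A" by (simp add: det_def)
  finally show ?thesis .
qed

definition reindex :: "('a \<Rightarrow> 'b) \<Rightarrow> real^'b \<Rightarrow> real^'a" where
  "reindex e x = (\<chi> i. x $ e i)"

lemma reindex_nth [simp]: "reindex e x $ i = x $ e i"
  by (simp add: reindex_def)

lemma linear_reindex: "linear (reindex e :: real^'b::finite \<Rightarrow> real^'a::finite)"
  by (rule linearI) (simp_all add: vec_eq_iff)

lemma reindex_inv:
  assumes "bij e"
  shows "reindex (inv e) (reindex e x) = x" "reindex e (reindex (inv e) y) = y"
  using assms by (simp_all add: vec_eq_iff bij_is_surj surj_f_inv_f bij_is_inj)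

lemma bij_reindex: "bij e \<Longrightarrow> bij (reindex e)"
  by (rule o_bij[where g="reindex (inv e)"]) (auto simp: fun_eq_iff reindex_inv)

lemma prod_Basis_cart: "(\<Prod>b\<in>Basis. (v :: real^'n::finite) \<bullet> b) = (\<Prod>i\<in>UNIV. v $ i)"
proof -
  have B: "(Basis :: (real^'n) set) = range (\<lambda>i. axis i 1)"
    by (auto simp: Basis_vec_def)
  have inj: "inj (\<lambda>i::'n. axis i (1::real))"
    by (auto simp: inj_on_def axis_eq_axis)
  show ?thesis
    unfolding B by (subst prod.reindex[OF inj]) (simp add: inner_axis)
qed

text \<open>Lebesgue measure is determined by its values on boxes, and relabelling coordinates
  merely permutes the sides of a box.\<close>

lemma lborel_reindex:
  fixes e :: "'a::finite \<Rightarrow> 'b::finite"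
  assumes e: "bij e"
  shows "distr lborel borel (reindex e) = (lborel :: (real^'a) measure)"
proof (rule lborel_eqI[symmetric])
  have m: "reindex e \<in> borel_measurable borel"
    by (intro borel_measurable_continuous_onI linear_continuous_on linear_linear[THEN iffD2] linear_reindex)
  fix l u :: "real^'a"
  assume le: "\<And>b. b \<in> Basis \<Longrightarrow> l \<bullet> b \<le> u \<bullet> b"
  have le': "l $ i \<le> u $ i" for i
    using le[of "axis i 1"] by (auto simp: inner_axis)
  let ?l = "reindex (inv e) l" and ?u = "reindex (inv e) u"
  have pre: "reindex e -` box l u = box ?l ?u"
  proof (rule set_eqI)
    fix x :: "real^'b"
    have "x \<in> reindex e -` box l u \<longleftrightarrow> (\<forall>i. l $ i < x $ e i \<and> x $ e i < u $ i)"
      by (simp add: mem_box_cart)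
    also have "\<dots> \<longleftrightarrow> (\<forall>j. l $ inv e j < x $ j \<and> x $ j < u $ inv e j)"
      using e by (metis bij_inv_eq_iff)
    finally show "x \<in> reindex e -` box l u \<longleftrightarrow> x \<in> box ?l ?u"
      by (simp add: mem_box_cart)
  qed
  have "emeasure (distr lborel borel (reindex e)) (box l u) = emeasure lborel (box ?l ?u)"
    using m by (subst emeasure_distr) (auto simp: pre)
  also have "\<dots> = ennreal (\<Prod>b\<in>Basis. (?u - ?l) \<bullet> b)"
  proof (rule emeasure_lborel_box)
    fix b :: "real^'b" assume "b \<in> Basis"
    then obtain i where "b = axis i 1" by (auto simp: Basis_vec_def)
    then show "?l \<bullet> b \<le> ?u \<bullet> b" using le' by (simp add: inner_axis)
  qed
  also have "(\<Prod>b\<in>Basis. (?u - ?l) \<bullet> b) = (\<Prod>j\<in>UNIV. (u - l) $ inv e j)"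
    by (simp add: prod_Basis_cart)
  also have "\<dots> = (\<Prod>i\<in>UNIV. (u - l) $ i)"
    by (rule prod.reindex_bij_betw[OF bij_imp_bij_inv[OF e], of "\<lambda>i. (u - l) $ i"])
  finally show "emeasure (distr lborel borel (reindex e)) (box l u) = ennreal (\<Prod>b\<in>Basis. (u - l) \<bullet> b)"
    by (simp add: prod_Basis_cart)
qed simp

text \<open>Finite volume of the image yields integrability of the Jacobian, so that the gauge
  integral in the area formula can be read as an integral of a nonnegative function over
  \<open>lborel\<close>.\<close>

lemma nn_integral_det_image_wellorder:
  fixes F :: "real^'k::{finite,wellorder} \<Rightarrow> real^'k::_"
  assumes S: "S \<in> sets borel" and FS: "F ` S \<in> sets borel" "emeasure lborel (F ` S) < \<infinity>"
    and der: "\<And>y. y \<in> S \<Longrightarrow> (F has_derivative F' y) (at y within S)"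
    and inj: "inj_on F S"
  shows "(\<integral>\<^sup>+y. indicator S y * ennreal \<bar>det (matrix (F' y))\<bar> \<partial>lborel) = emeasure lborel (F ` S)"
proof -
  have S': "S \<in> sets lebesgue" using S by auto
  have lm: "F ` S \<in> lmeasurable"
    using FS by (auto intro!: fmeasurableI simp: emeasure_completion)
  then have int: "(\<lambda>x. \<bar>det (matrix (F' x))\<bar>) integrable_on S"
    using measurable_differentiable_image_eq[OF S' der inj] by blast
  then have "((\<lambda>x. \<bar>det (matrix (F' x))\<bar>) has_integral measure lebesgue (F ` S)) S"
    using measure_differentiable_image_eq[OF S' der inj] by (simp add: has_integral_integral)
  then have "(\<integral>\<^sup>+y. indicator S y * ennreal \<bar>det (matrix (F' y))\<bar> \<partial>lborel)
      = ennreal (measure lebesgue (F ` S))"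
    by (subst mult.commute) (intro nn_integral_has_integral_lebesgue', auto)
  also have "\<dots> = emeasure lborel (F ` S)"
    using FS by (simp add: emeasure_eq_ennreal_measure measure_completion)
  finally show ?thesis .
qed

lemma matrix_reindex_conj:
  fixes e :: "'a::finite \<Rightarrow> 'b::finite" and L :: "real^'b \<Rightarrow> real^'b"
  assumes e: "bij e" and L: "linear L"
  shows "matrix (reindex e \<circ> L \<circ> reindex (inv e)) = (\<chi> i j. matrix L $ e i $ e j :: real^'a^'a)"
proof -
  have "reindex (inv e) (axis j (1::real)) = axis (e j) 1" for j
    using e by (auto simp: vec_eq_iff axis_def bij_is_inj bij_is_surj surj_f_inv_f)
  then show ?thesis by (simp add: matrix_def vec_eq_iff del: reindex_nth) (simp add: reindex_def)
qed

text \<open>\<open>F\<close> is conjugated by a relabelling of coordinates, which changes neither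
  volumes nor Jacobian determinants. Continuity of the determinant makes the integrand Borel, as the
  change of variables along \<open>reindex\<close> requires.\<close>

lemma nn_integral_det_image:
  fixes F :: "real^'k::finite \<Rightarrow> real^'k"
  assumes S: "S \<in> sets borel" and FS: "F ` S \<in> sets borel" "emeasure lborel (F ` S) < \<infinity>"
    and der: "\<And>y. y \<in> S \<Longrightarrow> (F has_derivative F' y) (at y within S)"
    and cont: "continuous_on S (\<lambda>y. det (matrix (F' y)))"
    and inj: "inj_on F S"
  shows "(\<integral>\<^sup>+y. indicator S y * ennreal \<bar>det (matrix (F' y))\<bar> \<partial>lborel) = emeasure lborel (F ` S)"
proof -
  obtain e :: "'k ix \<Rightarrow> 'k" where e: "bij e" using ex_bij_ix by blast
  let ?T = "reindex e" and ?U = "reindex (inv e)"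
  note TU [simp] = reindex_inv[OF e]
  have Tm [measurable]: "?T \<in> borel_measurable borel" and Um [measurable]: "?U \<in> borel_measurable borel"
    by (intro borel_measurable_continuous_onI linear_continuous_on linear_linear[THEN iffD2] linear_reindex)+
  have T_img: "?T ` B = ?U -` B" for B
    by (auto simp: image_iff) (metis TU(2))
  have T_sets: "B \<in> sets borel \<Longrightarrow> ?T ` B \<in> sets borel" for B
    unfolding T_img using measurable_sets[OF Um, of B] by simp
  have em: "emeasure lborel (?T ` B) = emeasure lborel B" if B: "B \<in> sets borel" for B
  proof -
    have "?T -` ?T ` B = B" using bij_reindex[OF e] by (simp add: bij_is_inj inj_vimage_image_eq)
    then show ?thesis
      using T_sets[OF B] by (subst lborel_reindex[OF e, symmetric], subst emeasure_distr) auto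
  qed
  define G where "G = ?T \<circ> F \<circ> ?U"
  define G' where "G' y = ?T \<circ> F' (?U y) \<circ> ?U" for y
  have GS: "G ` (?T ` S) = ?T ` F ` S" by (auto simp: G_def image_iff)
  have blT: "bounded_linear ?T" and blU: "bounded_linear ?U"
    using linear_reindex linear_conv_bounded_linear by blast+
  have detG: "det (matrix (G' (?T y))) = det (matrix (F' y))" if "y \<in> S" for y
  proof -
    have "linear (F' y)" using der[OF that] has_derivative_linear by blast
    then show ?thesis
      by (simp add: G'_def matrix_reindex_conj[OF e] det_reindex[OF e])
  qed
  have "(\<integral>\<^sup>+y. indicator (?T ` S) y * ennreal \<bar>det (matrix (G' y))\<bar> \<partial>lborel) = emeasure lborel (G ` (?T ` S))"
  proof (rule nn_integral_det_image_wellorder)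
    show "?T ` S \<in> sets borel" using T_sets[OF S] .
    show "G ` ?T ` S \<in> sets borel" unfolding GS using T_sets[OF FS(1)] .
    show "emeasure lborel (G ` ?T ` S) < \<infinity>" unfolding GS using em FS by simp
    show "inj_on G (?T ` S)"
      using inj bij_reindex[OF e] by (auto simp: G_def inj_on_def bij_def)
    fix y assume "y \<in> ?T ` S"
    then have yS: "?U y \<in> S" by auto
    have US: "?U ` ?T ` S = S" by (auto simp: image_iff)
    have 1: "(F has_derivative F' (?U y)) (at (?U y) within ?U ` ?T ` S)"
      unfolding US by (rule der[OF yS])
    have 2: "(?U has_derivative ?U) (at y within ?T ` S)"
      by (rule bounded_linear_imp_has_derivative[OF blU])
    have "(F \<circ> ?U has_derivative F' (?U y) \<circ> ?U) (at y within ?T ` S)"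
      by (rule diff_chain_within[OF 2 1])
    then have "(?T \<circ> (F \<circ> ?U) has_derivative ?T \<circ> (F' (?U y) \<circ> ?U)) (at y within ?T ` S)"
      by (rule diff_chain_within) (rule bounded_linear_imp_has_derivative[OF blT])
    then show "(G has_derivative G' y) (at y within ?T ` S)"
      by (simp add: G_def G'_def comp_assoc)
  qed
  also have "\<dots> = emeasure lborel (F ` S)" unfolding GS using em FS by simp
  also have "(\<integral>\<^sup>+y. indicator (?T ` S) y * ennreal \<bar>det (matrix (G' y))\<bar> \<partial>lborel)
     = (\<integral>\<^sup>+y. indicator S (?U y) * ennreal \<bar>det (matrix (F' (?U y)))\<bar> \<partial>lborel)"
  proof (rule nn_integral_cong)
    fix y
    show "indicator (?T ` S) y * ennreal \<bar>det (matrix (G' y))\<bar>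
        = indicator S (?U y) * ennreal \<bar>det (matrix (F' (?U y)))\<bar>"
      using detG[of "?U y"] by (auto simp: T_img indicator_def)
  qed
  also have "\<dots> = (\<integral>\<^sup>+y. indicator S y * ennreal \<bar>det (matrix (F' y))\<bar> \<partial>lborel)"
  proof -
    have "(\<lambda>y. indicator S y *\<^sub>R \<bar>det (matrix (F' y))\<bar>) \<in> borel_measurable borel"
      using cont S by (intro borel_measurable_continuous_on_indicator) (auto intro: continuous_intros)
    then have [measurable]: "(\<lambda>y. indicator S y * \<bar>det (matrix (F' y))\<bar>) \<in> borel_measurable borel"
      by simp
    have eq: "indicator S y * ennreal \<bar>det (matrix (F' y))\<bar> = ennreal (indicator S y * \<bar>det (matrix (F' y))\<bar>)" for y
      by (auto simp: indicator_def)
    show ?thesis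
      unfolding eq
      by (subst lborel_reindex[OF bij_imp_bij_inv[OF e], symmetric], subst nn_integral_distr) auto
  qed
  finally show ?thesis by simp
qed

section \<open>Gram determinants and wedge products\<close>

lemma continuous_on_det [continuous_intros]:
  fixes f :: "'a::topological_space \<Rightarrow> real^'n::finite^'n"
  assumes "continuous_on S f"
  shows "continuous_on S (\<lambda>x. det (f x))"
  unfolding det_def by (intro continuous_intros assms)

lemma continuous_on_vec_lambda2:
  assumes "\<And>i j. continuous_on S (\<lambda>x. f x i j)"
  shows "continuous_on S (\<lambda>x. (\<chi> i j. f x i j) :: real^'n::finite^'m::finite)"
  by (intro continuous_on_vec_lambda assms)

section \<open>Positive definite matrices\<close>

definition pos_def_matrix :: "real^'n::finite^'n \<Rightarrow> bool" where
  "pos_def_matrix G \<longleftrightarrow> (\<forall>v. v \<noteq> 0 \<longrightarrow> 0 < v \<bullet> (G *v v))"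

lemma pos_def_matrix_det_nz:
  assumes "pos_def_matrix G" shows "det G \<noteq> 0"
proof -
  have "\<forall>x. G *v x = 0 \<longrightarrow> x = 0"
    using assms by (metis inner_zero_right less_irrefl pos_def_matrix_def)
  then have "invertible G"
    unfolding invertible_left_inverse matrix_left_invertible_ker by blast
  then show ?thesis by (simp add: invertible_det_nz)
qed

text \<open>The segment from the identity to \<open>G\<close> consists of positive definite
  matrices, none of which is singular; the determinant cannot change sign along it.\<close>

lemma pos_def_matrix_det_pos:
  fixes G :: "real^'n::finite^'n"
  assumes G: "pos_def_matrix G" shows "0 < det G"
proof (rule ccontr)
  assume "\<not> 0 < det G"
  then have le: "det G \<le> 0" by simp
  define P where "P t = (1 - t) *\<^sub>R (mat 1 :: real^'n^'n) + t *\<^sub>R G" for t :: real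
  have cont: "continuous_on {0..1} (\<lambda>t. det (P t))"
    unfolding P_def by (intro continuous_intros)
  obtain t where t: "0 \<le> t" "t \<le> 1" "det (P t) = 0"
    using IVT2'[of "\<lambda>t. det (P t)" 1 0 0] le cont by (auto simp: P_def)
  have "pos_def_matrix (P t)"
    unfolding pos_def_matrix_def
  proof (intro allI impI)
    fix v :: "real^'n" assume v: "v \<noteq> 0"
    have eq: "v \<bullet> (P t *v v) = (1 - t) * (v \<bullet> v) + t * (v \<bullet> (G *v v))"
      by (simp add: P_def matrix_vector_mult_add_rdistrib scaleR_matrix_vector_assoc[symmetric]
        inner_add_right)
    have "0 < v \<bullet> v" "0 < v \<bullet> (G *v v)" using v G by (auto simp: pos_def_matrix_def)
    then show "0 < v \<bullet> (P t *v v)"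
      unfolding eq using t
      by (cases "t = 0") (auto intro!: add_nonneg_pos)
  qed
  then show False using pos_def_matrix_det_nz t by blast
qed

lemma matrix_inv_mult:
  fixes G :: "real^'n::finite^'n"
  assumes "det G \<noteq> 0"
  shows "G ** matrix_inv G = mat 1" "matrix_inv G ** G = mat 1"
proof -
  have "\<exists>B. G ** B = mat 1 \<and> B ** G = mat 1"
    using assms invertible_det_nz[of G] unfolding invertible_def by blast
  then have "G ** matrix_inv G = mat 1 \<and> matrix_inv G ** G = mat 1"
    unfolding matrix_inv_def by (rule someI_ex)
  then show "G ** matrix_inv G = mat 1" "matrix_inv G ** G = mat 1" by auto
qed

lemma matrix_inv_unique:
  fixes X Y :: "real^'n::finite^'n"
  assumes "X ** Y = mat 1"
  shows "matrix_inv X = Y"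
proof -
  have YX: "Y ** X = mat 1" using assms by (simp add: matrix_left_right_inverse)
  have "det X * det Y = 1" using assms by (metis det_I det_mul)
  then have "X ** matrix_inv X = mat 1" by (intro matrix_inv_mult) auto
  then have "Y ** (X ** matrix_inv X) = Y" by simp
  then show ?thesis by (simp add: matrix_mul_assoc YX)
qed

lemma pos_def_matrix_inv:
  fixes G :: "real^'n::finite^'n"
  assumes G: "pos_def_matrix G"
  shows "pos_def_matrix (matrix_inv G)"
  unfolding pos_def_matrix_def
proof (intro allI impI)
  fix v :: "real^'n" assume v: "v \<noteq> 0"
  note inv = matrix_inv_mult[OF pos_def_matrix_det_nz[OF G]]
  define w where "w = matrix_inv G *v v"
  have Gw: "G *v w = v" by (simp add: w_def matrix_vector_mul_assoc inv)
  then have "w \<noteq> 0" using v by auto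
  then have "0 < w \<bullet> (G *v w)" using G by (auto simp: pos_def_matrix_def)
  then show "0 < v \<bullet> (matrix_inv G *v v)"
    unfolding Gw by (simp add: w_def inner_commute)
qed

section \<open>The Jacobian as a Gram determinant\<close>

definition gram_jac :: "real^'n::finite^'n \<Rightarrow> real^'n^'k::finite \<Rightarrow> real" where
  "gram_jac G D = sqrt (det (\<chi> i j. covector_inner G (D $ i) (D $ j) :: real^'k^'k))"

lemma jac_eq_gram_jac: "jac A g p f = gram_jac (g p) (differential A f p)"
  by (simp add: jac_def gram_jac_def Let_def)

text \<open>In product form the determinant and the rank of the Gram matrix can be read off factor
  by factor.\<close>

lemma gram_matrix_eq:
  "(\<chi> i j. covector_inner G (D $ i) (D $ j)) = D ** matrix_inv G ** transpose D"
proof -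
  have "covector_inner G (D $ i) (D $ j) = (D ** matrix_inv G ** transpose D) $ i $ j" for i j
  proof -
    have "(D ** matrix_inv G ** transpose D) $ i $ j
       = ((D ** matrix_inv G ** transpose D) *v axis j 1) $ i"
      by (simp add: matrix_vector_mult_basis column_def)
    also have "\<dots> = (D *v (matrix_inv G *v (transpose D *v axis j 1))) $ i"
      by (simp only: matrix_vector_mul_assoc matrix_mul_assoc)
    also have "transpose D *v axis j 1 = D $ j"
      by (simp add: matrix_vector_mult_basis vec_eq_iff column_def transpose_def)
    finally show ?thesis
      by (simp add: covector_inner_def matrix_vector_mul_component)
  qed
  then show ?thesis by (simp add: vec_eq_iff)
qed

lemma gram_jac_mult:
  "gram_jac G (M ** D) = \<bar>det M\<bar> * gram_jac G D" for M :: "real^'k::finite^'k"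
proof -
  have "(M ** D) ** matrix_inv G ** transpose (M ** D)
     = M ** (D ** matrix_inv G ** transpose D) ** transpose M"
    by (simp add: matrix_transpose_mul matrix_mul_assoc)
  then have "det (M ** D ** matrix_inv G ** transpose (M ** D))
     = (det M)\<^sup>2 * det (D ** matrix_inv G ** transpose D)"
    by (simp add: det_mul power2_eq_square)
  then show ?thesis
    unfolding gram_jac_def gram_matrix_eq by (simp add: real_sqrt_mult)
qed

lemma surj_transpose_ker:
  fixes D :: "real^'n::finite^'k::finite"
  assumes "surj ((*v) D)" and "transpose D *v v = 0"
  shows "v = 0"
proof -
  obtain x where x: "v = D *v x" using assms(1) by (metis surjD)
  have "v \<bullet> v = (D *v x) \<bullet> v" using x by simp
  also have "\<dots> = x \<bullet> (transpose D *v v)"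
    by (metis dot_lmul_matrix inner_commute transpose_matrix_vector)
  finally show ?thesis using assms(2) by simp
qed

text \<open>The Gram matrix is the form of \<open>matrix_inv G\<close> pulled back along
  \<open>transpose D\<close>, which is injective because \<open>D\<close> is onto.\<close>

lemma gram_pos_def:
  fixes D :: "real^'n::finite^'k::finite"
  assumes G: "pos_def_matrix G" and D: "surj ((*v) D)"
  shows "pos_def_matrix (D ** matrix_inv G ** transpose D)"
  unfolding pos_def_matrix_def
proof (intro allI impI)
  fix v :: "real^'k" assume "v \<noteq> 0"
  then have nz: "transpose D *v v \<noteq> 0" using surj_transpose_ker[OF D] by blast
  have "v \<bullet> ((D ** matrix_inv G ** transpose D) *v v)
     = v \<bullet> (D *v (matrix_inv G *v (transpose D *v v)))"
    by (simp only: matrix_vector_mul_assoc matrix_mul_assoc)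
  also have "\<dots> = (transpose D *v v) \<bullet> (matrix_inv G *v (transpose D *v v))"
    by (metis dot_lmul_matrix transpose_matrix_vector)
  finally show "0 < v \<bullet> ((D ** matrix_inv G ** transpose D) *v v)"
    using pos_def_matrix_inv[OF G] nz by (simp add: pos_def_matrix_def)
qed

lemma gram_jac_pos:
  assumes "pos_def_matrix G" and "surj ((*v) D)"
  shows "0 < gram_jac G D"
  using pos_def_matrix_det_pos[OF gram_pos_def[OF assms]]
  by (simp add: gram_jac_def gram_matrix_eq)

text \<open>The Gram matrix factors through \<open>D\<close>; a vector missed by \<open>D\<close> is
  missed by it too, so it is singular.\<close>

lemma gram_jac_not_surj:
  fixes D :: "real^'n::finite^'k::finite"
  assumes D: "\<not> surj ((*v) D)"
  shows "gram_jac G D = 0"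
proof -
  have "\<not> surj ((*v) (D ** matrix_inv G ** transpose D))"
  proof
    assume s: "surj ((*v) (D ** matrix_inv G ** transpose D))"
    have "surj ((*v) D)"
      unfolding surj_def
    proof
      fix y
      obtain x where "y = (D ** matrix_inv G ** transpose D) *v x" using s by (metis surjD)
      then have "y = D *v (matrix_inv G *v (transpose D *v x))"
        by (simp only: matrix_vector_mul_assoc matrix_mul_assoc)
      then show "\<exists>x. y = D *v x" by blast
    qed
    with D show False by blast
  qed
  then have "\<not> invertible (D ** matrix_inv G ** transpose D)"
    by (simp add: invertible_right_inverse matrix_right_invertible_surjective)
  then show ?thesis
    by (simp add: gram_jac_def gram_matrix_eq invertible_det_nz)
qed

lemma gram_jac_nonneg: "pos_def_matrix G \<Longrightarrow> 0 \<le> gram_jac G D"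
  using gram_jac_pos gram_jac_not_surj by (metis less_eq_real_def)

section \<open>Coordinate minors of a differential\<close>

lemma wedge_nth: "wedge D $ s = det (\<chi> i j. D $ i $ s j)"
  by (simp add: wedge_def)

lemma wedge_mult:
  fixes M :: "real^'k::finite^'k" and D :: "real^'n::finite^'k"
  shows "wedge (M ** D) = det M *\<^sub>R wedge D"
proof -
  have "(\<chi> i j. (M ** D) $ i $ s j) = M ** (\<chi> i j. D $ i $ s j)" for s :: "'k \<Rightarrow> 'n"
    by (simp add: vec_eq_iff matrix_matrix_mult_def)
  then show ?thesis by (simp add: vec_eq_iff wedge_nth det_mul)
qed

text \<open>A nonzero minor means that the columns selected by \<open>s\<close> already span, and
  then \<open>D\<close> would be onto.\<close>

lemma wedge_not_surj:
  fixes D :: "real^'n::finite^'k::finite"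
  assumes "\<not> surj ((*v) D)"
  shows "wedge D = 0"
proof -
  have "wedge D $ s = 0" for s
  proof (rule ccontr)
    assume "wedge D $ s \<noteq> 0"
    then have "invertible (\<chi> i j. D $ i $ s j)"
      by (simp add: wedge_nth invertible_det_nz)
    then have s: "surj ((*v) (\<chi> i j. D $ i $ s j))"
      by (simp add: invertible_right_inverse matrix_right_invertible_surjective)
    have "surj ((*v) D)"
      unfolding surj_def
    proof
      fix y
      obtain x where x: "y = (\<chi> i j. D $ i $ s j) *v x" using s by (metis surjD)
      have "y = D *v (\<Sum>j\<in>UNIV. x $ j *\<^sub>R axis (s j) 1)"
        unfolding x
        by (simp add: vec.linear_sum[OF matrix_vector_mul_linear_gen] matrix_vector_mult_scaleR
            linear_sum[OF matrix_vector_mul_linear] matrix_vector_mult_basis vec_eq_iff column_def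
            matrix_vector_mult_def[of "\<chi> i j. D $ i $ s j"] mult.commute)
      then show "\<exists>x. y = D *v x" by blast
    qed
    with assms show False by blast
  qed
  then show ?thesis by (simp add: vec_eq_iff)
qed

lemma continuous_on_wedge: "continuous_on UNIV (wedge :: real^'n::finite^'k::finite \<Rightarrow> _)"
  unfolding wedge_def
  by (intro continuous_on_vec_lambda continuous_on_det continuous_on_vec_lambda2 continuous_intros)

text \<open>Cramer's rule writes the inverse applied to a vector as a quotient of determinants, with
  nonvanishing denominator.\<close>

lemma continuous_on_covector_inner:
  fixes G :: "'x::topological_space \<Rightarrow> real^'n::finite^'n"
  assumes "\<And>x. x \<in> S \<Longrightarrow> det (G x) \<noteq> 0" and "continuous_on S G" "continuous_on S a" "continuous_on S b"
  shows "continuous_on S (\<lambda>x. covector_inner (G x) (a x) (b x))"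
proof -
  have eq: "covector_inner (G x) (a x) (b x)
     = (\<Sum>k\<in>UNIV. a x $ k * (det (\<chi> i j. if j = k then b x $ i else G x $ i $ j) / det (G x)))"
    if "x \<in> S" for x
  proof -
    have "G x *v (matrix_inv (G x) *v b x) = b x"
      by (simp add: matrix_vector_mul_assoc matrix_inv_mult[OF assms(1)[OF that]])
    then have "matrix_inv (G x) *v b x = (\<chi> k. det (\<chi> i j. if j = k then b x $ i else G x $ i $ j) / det (G x))"
      using cramer[OF assms(1)[OF that]] by blast
    then show ?thesis by (simp add: covector_inner_def inner_vec_def)
  qed
  have c: "continuous_on S (\<lambda>x. if j = k then b x $ i else G x $ i $ j)" for i j k
    by (cases "j = k") (auto intro!: continuous_intros assms)
  have "continuous_on S (\<lambda>x. \<Sum>k\<in>UNIV. a x $ k * (det (\<chi> i j. if j = k then b x $ i else G x $ i $ j) / det (G x)))"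
    by (intro continuous_intros continuous_on_vec_lambda2 assms c) (use assms in auto)
  then show ?thesis using eq by (simp cong: continuous_on_cong)
qed

lemma continuous_on_gram_jac:
  fixes G :: "'x::topological_space \<Rightarrow> real^'n::finite^'n" and D :: "'x \<Rightarrow> real^'n^'k::finite"
  assumes "\<And>x. x \<in> S \<Longrightarrow> pos_def_matrix (G x)" and "continuous_on S G" "continuous_on S D"
  shows "continuous_on S (\<lambda>x. gram_jac (G x) (D x))"
  unfolding gram_jac_def
  by (intro continuous_intros continuous_on_vec_lambda2 continuous_on_covector_inner assms
      pos_def_matrix_det_nz)

text \<open>The rows are independent, so an orthonormal basis of their span has one vector per row
  index; \<open>M\<close> holds the coordinates of the rows in it. The point is that
  \<open>Q\<close> ranges over a compact set, while \<open>M\<close> will enter only through its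
  determinant.\<close>

lemma orthonormal_rows_decomp:
  fixes D :: "real^'n::finite^'k::finite"
  assumes D: "surj ((*v) D)"
  obtains M :: "real^'k^'k" and Q :: "real^'n^'k" where "D = M ** Q" "Q ** transpose Q = mat 1"
proof -
  have li: "(\<Sum>i\<in>UNIV. v $ i *\<^sub>R D $ i) = transpose D *v v" for v
    by (simp add: vec_eq_iff matrix_vector_mult_def transpose_def mult.commute)
  have inj: "inj (\<lambda>i. D $ i)"
  proof (rule injI)
    fix i j assume eq: "D $ i = D $ j"
    have "transpose D *v (axis i 1 - axis j 1) = 0"
      using eq by (simp add: matrix_vector_mult_diff_distrib matrix_vector_mult_basis vec_eq_iff column_def transpose_def)
    then have "axis i 1 - axis j (1::real) = 0" by (rule surj_transpose_ker[OF D])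
    then show "i = j" by (simp add: axis_eq_axis)
  qed
  let ?R = "range (\<lambda>i. D $ i)"
  have ind: "independent ?R"
  proof (subst independent_explicit_finite_subsets, intro allI impI ballI)
    fix A :: "(real^'n) set" and u v assume A: "A \<subseteq> ?R" "finite A" "(\<Sum>v\<in>A. u v *\<^sub>R v) = 0" "v \<in> A"
    define w where "w = (\<chi> i. if D $ i \<in> A then u (D $ i) else 0)"
    have "transpose D *v w = (\<Sum>i\<in>UNIV. if D $ i \<in> A then u (D $ i) *\<^sub>R D $ i else 0)"
      unfolding li[symmetric] w_def by (intro sum.cong) auto
    also have "\<dots> = (\<Sum>i\<in>{i. D $ i \<in> A}. u (D $ i) *\<^sub>R D $ i)"
      by (simp add: sum.If_cases)
    also have "\<dots> = (\<Sum>v\<in>A. u v *\<^sub>R v)"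
    proof (rule sum.reindex_bij_betw)
      show "bij_betw (\<lambda>i. D $ i) {i. D $ i \<in> A} A"
        using inj A(1) by (auto simp: bij_betw_def inj_on_def)
    qed
    finally have "w = 0" using A surj_transpose_ker[OF D] by simp
    obtain i where i: "v = D $ i" using A by auto
    have "w $ i = 0" using \<open>w = 0\<close> by simp
    then show "u v = 0" using A i by (simp add: w_def)
  qed
  obtain B where B: "B \<subseteq> span ?R" "pairwise orthogonal B" "\<And>x. x \<in> B \<Longrightarrow> norm x = 1"
     "independent B" "card B = dim (span ?R)" "span B = span ?R"
    using orthonormal_basis_subspace[OF subspace_span[of ?R]] by metis
  have "dim (span ?R) = card ?R" using ind by (simp add: dim_eq_card_independent)
  also have "\<dots> = CARD('k)" using inj by (simp add: card_image)
  finally have card: "card B = CARD('k)" using B by simp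
  have finB: "finite B" using card by (metis card.infinite zero_less_card_finite less_irrefl)
  obtain q where q: "bij_betw q (UNIV :: 'k set) B"
    using finite_same_card_bij[of "UNIV :: 'k set" B] finB card by auto
  define Q where "Q = (\<chi> i. q i)"
  define M where "M = (\<chi> i j. D $ i \<bullet> q j)"
  have orth: "q i \<bullet> q j = (if i = j then 1 else 0)" for i j
  proof (cases "i = j")
    case True then show ?thesis using B(3) q by (simp add: bij_betwE norm_eq_1)
  next
    case False
    then have "q i \<noteq> q j" using q by (auto simp: bij_betw_def inj_on_def)
    then show ?thesis using B(2) q False by (auto simp: pairwise_def orthogonal_def bij_betwE)
  qed
  have "Q ** transpose Q = mat 1"
    using orth by (simp add: vec_eq_iff matrix_matrix_mult_def mat_def Q_def transpose_def inner_vec_def)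
  moreover have "D = M ** Q"
  proof -
    have "D $ i = (\<Sum>j\<in>UNIV. (D $ i \<bullet> q j) *\<^sub>R q j)" for i
    proof -
      have "D $ i \<in> span B" using B(6) by (simp add: span_base)
      then have "D $ i = (\<Sum>b\<in>B. (D $ i \<bullet> b) *\<^sub>R b)"
        using orthonormal_basis_expand[OF B(2) B(3) _ finB, of "D $ i"] by simp
      also have "\<dots> = (\<Sum>j\<in>UNIV. (D $ i \<bullet> q j) *\<^sub>R q j)"
        by (rule sum.reindex_bij_betw[OF q, symmetric])
      finally show ?thesis .
    qed
    then show ?thesis
      by (simp add: vec_eq_iff matrix_matrix_mult_def M_def Q_def)
  qed
  ultimately show ?thesis using that by blast
qed

text \<open>Both sides scale by \<open>\<bar>det M\<bar>\<close> under left multiplication, so they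
  need comparing only at matrices with orthonormal rows. These form a compact set on which the
  Jacobian is positive; where \<open>D\<close> is not onto, both sides vanish.\<close>

lemma wedge_le_gram_jac:
  fixes \<G> :: "(real^'n::finite^'n) set"
  assumes "compact \<G>" and pd: "\<And>G. G \<in> \<G> \<Longrightarrow> pos_def_matrix G"
  obtains C where "C > 0" "\<And>G (D :: real^'n^'k::finite). G \<in> \<G> \<Longrightarrow> norm (wedge D) \<le> C * gram_jac G D"
proof -
  let ?Q = "{Q :: real^'n^'k. Q ** transpose Q = mat 1}"
  have nQ: "norm Q \<le> real CARD('k)" if "Q \<in> ?Q" for Q
  proof -
    have 1: "norm (Q $ i) = 1" for i
    proof -
      have "(Q ** transpose Q) $ i $ i = 1" using that by (simp add: mat_def)
      then show ?thesis
        by (simp add: matrix_matrix_mult_def transpose_def norm_eq_1 inner_vec_def)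
    qed
    have "norm Q = L2_set (\<lambda>i. norm (Q $ i)) UNIV" by (rule norm_vec_def)
    also have "\<dots> \<le> (\<Sum>i\<in>UNIV. norm (Q $ i))" by (rule L2_set_le_sum) simp
    finally show ?thesis by (simp add: 1)
  qed
  have "?Q = (\<Inter>i. \<Inter>j. {Q. (\<Sum>k\<in>UNIV. Q $ i $ k * Q $ j $ k) = (mat 1 :: real^'k^'k) $ i $ j})"
    by (auto simp: vec_eq_iff matrix_matrix_mult_def transpose_def)
  also have "closed \<dots>"
    by (intro closed_INT ballI closed_Collect_eq continuous_intros)
  finally have "closed ?Q" .
  moreover have "bounded ?Q" using nQ by (auto intro!: boundedI)
  ultimately have cQ: "compact ?Q" by (simp add: compact_eq_bounded_closed)
  have sQ: "surj ((*v) Q)" if "Q \<in> ?Q" for Q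
    using that matrix_right_invertible_surjective[of Q] by blast
  let ?S = "\<G> \<times> ?Q"
  have cS: "compact ?S" using assms(1) cQ by (rule compact_Times)
  have cont: "continuous_on ?S (\<lambda>x. norm (wedge (snd x)) / gram_jac (fst x) (snd x))"
  proof (intro continuous_intros continuous_on_gram_jac)
    show "continuous_on ?S (\<lambda>x. wedge (snd x))"
      by (rule continuous_on_compose2[OF continuous_on_wedge]) (auto intro: continuous_intros)
    show "\<forall>x\<in>?S. gram_jac (fst x) (snd x) \<noteq> 0"
    proof
      fix x assume "x \<in> ?S"
      then have "0 < gram_jac (fst x) (snd x)" by (intro gram_jac_pos pd sQ) auto
      then show "gram_jac (fst x) (snd x) \<noteq> 0" by simp
    qed
  qed (use pd in auto)
  obtain C where C: "C > 0" "\<And>x. x \<in> ?S \<Longrightarrow> norm (norm (wedge (snd x)) / gram_jac (fst x) (snd x)) \<le> C"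
    using compact_imp_bounded[OF compact_continuous_image[OF cont cS]]
    by (auto simp: bounded_pos)
  have "norm (wedge D) \<le> C * gram_jac G D" if G: "G \<in> \<G>" for G and D :: "real^'n^'k"
  proof (cases "surj ((*v) D)")
    case False
    then show ?thesis by (simp add: wedge_not_surj gram_jac_not_surj)
  next
    case True
    then obtain M :: "real^'k^'k" and Q :: "real^'n^'k" where D: "D = M ** Q" and Q: "Q ** transpose Q = mat 1"
      by (rule orthonormal_rows_decomp)
    have pos: "0 < gram_jac G Q" using pd[OF G] sQ[of Q] Q by (intro gram_jac_pos) auto
    have "norm (wedge Q) / gram_jac G Q \<le> C" using C(2)[of "(G, Q)"] G Q pos by simp
    then have le: "norm (wedge Q) \<le> C * gram_jac G Q" using pos by (simp add: field_simps)
    show ?thesis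
      unfolding D wedge_mult gram_jac_mult
      using mult_left_mono[OF le abs_ge_zero[of "det M"]]
      by (simp only: norm_scaleR real_norm_def mult.left_commute)
  qed
  then show ?thesis using that C(1) by blast
qed

text \<open>Only the values on nonzero tensors matter; at \<open>0\<close> all quotients are \<open>0\<close>.\<close>

definition dir_weight :: "real^('k::finite \<Rightarrow> 'n::finite) \<Rightarrow> ('k \<Rightarrow> 'n) \<Rightarrow> real^('k \<Rightarrow> 'n) \<Rightarrow> real" where
  "dir_weight u s w = \<bar>w \<bullet> u\<bar> * \<bar>w $ s\<bar> / (w \<bullet> w)"

text \<open>The extra factor \<open>\<bar>w $ s\<bar>\<close> is the Jacobian of the map restricted
  to the coordinate disc in direction \<open>s\<close>, so this is the weight times the density of
  the area formula on that disc.\<close>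

definition dir_part :: "real^('k::finite \<Rightarrow> 'n::finite) \<Rightarrow> ('k \<Rightarrow> 'n) \<Rightarrow> real^('k \<Rightarrow> 'n) \<Rightarrow> real" where
  "dir_part u s w = dir_weight u s w * \<bar>w $ s\<bar>"

lemma dir_weight_nonneg [simp]: "0 \<le> dir_weight u s w"
  by (simp add: dir_weight_def)

lemma dir_part_nonneg [simp]: "0 \<le> dir_part u s w"
  by (simp add: dir_part_def)

lemma dir_weight_le: "dir_weight u s w \<le> norm u"
proof (cases "w = 0")
  case False
  have "\<bar>w \<bullet> u\<bar> * \<bar>w $ s\<bar> \<le> (norm w * norm u) * norm w"
    by (intro mult_mono Cauchy_Schwarz_ineq2 component_le_norm_cart) auto
  then show ?thesis using False
    by (simp add: dir_weight_def field_simps dot_square_norm power2_eq_square)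
qed (simp add: dir_weight_def)

lemma dir_part_le: "dir_part u s w \<le> norm u * norm w"
  unfolding dir_part_def
  by (intro mult_mono dir_weight_le component_le_norm_cart) auto

text \<open>This invariance makes the weight a function of the tangent space of the zero set:
  passing to another regular map with the same zeros multiplies the wedge by a nonzero
  determinant.\<close>

lemma dir_weight_scale: "c \<noteq> 0 \<Longrightarrow> dir_weight u s (c *\<^sub>R w) = dir_weight u s w"
proof -
  assume "c \<noteq> 0"
  then have "c * c \<noteq> 0" by simp
  have "dir_weight u s (c *\<^sub>R w) = (c * c) * (\<bar>w \<bullet> u\<bar> * \<bar>w $ s\<bar>) / ((c * c) * (w \<bullet> w))"
  proof -
    have "\<bar>c * (w \<bullet> u)\<bar> * \<bar>c * w $ s\<bar> = (\<bar>c\<bar> * \<bar>c\<bar>) * (\<bar>w \<bullet> u\<bar> * \<bar>w $ s\<bar>)"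
      by (simp only: abs_mult ac_simps)
    also have "\<bar>c\<bar> * \<bar>c\<bar> = c * c" by (rule abs_mult_self_eq)
    finally show ?thesis by (simp add: dir_weight_def mult.assoc)
  qed
  also have "\<dots> = dir_weight u s w"
    unfolding dir_weight_def by (rule mult_divide_mult_cancel_left) fact
  finally show ?thesis .
qed

text \<open>The squares of the components add up to the denominator. The index \<open>s\<close> runs
  over all functions, permuted ones included, because these are exactly the components counted in
  \<open>w \<bullet> w\<close>.\<close>

lemma sum_dir_part: "(\<Sum>s\<in>UNIV. dir_part u s w) = \<bar>w \<bullet> u\<bar>"
proof (cases "w = 0")
  case False
  have "(\<Sum>s\<in>UNIV. dir_part u s w) = \<bar>w \<bullet> u\<bar> * (\<Sum>s\<in>UNIV. w $ s * w $ s) / (w \<bullet> w)"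
    by (simp add: dir_part_def dir_weight_def sum_distrib_left sum_divide_distrib mult.assoc)
  also have "(\<Sum>s\<in>UNIV. w $ s * w $ s) = w \<bullet> w" by (simp add: inner_vec_def)
  finally show ?thesis using False by simp
qed (simp add: dir_part_def dir_weight_def)

lemma continuous_on_dir_weight: "continuous_on {w. w \<noteq> 0} (dir_weight u s)"
  unfolding dir_weight_def by (intro continuous_intros) auto

text \<open>Away from 0 this is a quotient with nonvanishing denominator; at 0 the bound
  \<open>norm u * norm w\<close> forces the limit 0. The weight alone is in general discontinuous at
  0.\<close>

lemma continuous_on_dir_part: "continuous_on UNIV (dir_part u s)"
  unfolding continuous_on_eq_continuous_at[OF open_UNIV]
proof
  fix w :: "real^('a \<Rightarrow> 'b)"
  show "isCont (dir_part u s) w"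
  proof (cases "w = 0")
    case True
    have "(dir_part u s \<longlongrightarrow> 0) (at 0)"
    proof (rule Lim_null_comparison)
      show "\<forall>\<^sub>F x in at 0. norm (dir_part u s x) \<le> norm u * norm x"
        by (simp add: dir_part_le)
      have "((\<lambda>x. norm u * norm x) \<longlongrightarrow> norm u * norm (0::real^('a \<Rightarrow> 'b))) (at (0::real^('a \<Rightarrow> 'b)))"
        by (rule tendsto_mult[OF tendsto_const tendsto_norm[OF tendsto_ident_at]])
      then show "((\<lambda>x. norm u * norm x) \<longlongrightarrow> 0) (at (0::real^('a \<Rightarrow> 'b)))" by simp
    qed
    then show ?thesis using True by (simp add: isCont_def dir_part_def)
  next
    case False
    have "continuous_on {w. w \<noteq> 0} (dir_part u s)"
      unfolding dir_part_def by (intro continuous_intros continuous_on_dir_weight)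
    moreover have "open {w :: real^('a \<Rightarrow> 'b). w \<noteq> 0}" by (simp add: open_Collect_neq)
    ultimately show ?thesis using False continuous_on_eq_continuous_at by blast
  qed
qed

section \<open>Derivatives in charts\<close>

lemma C_on_1:
  "C_on 1 S f \<longleftrightarrow> (\<forall>x\<in>S. f differentiable (at x)) \<and>
     (\<forall>v. continuous_on S (\<lambda>x. frechet_derivative f (at x) v))"
  unfolding One_nat_def C_on.simps by (rule refl)

text \<open>\<open>differential\<close> refers to a preferred chart that may jump from point to
  point, so continuity in the point has to be expressed in one fixed chart.\<close>

definition chart_differential :: "('m, 'n::finite) chart \<Rightarrow> ('m \<Rightarrow> real^'k::finite) \<Rightarrow> real^'n \<Rightarrow> real^'n^'k" where
  "chart_differential c f x = matrix (frechet_derivative (f \<circ> chart_inv c) (at x))"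

lemma differential_eq:
  "differential A f p = chart_differential (chart_at A p) f (snd (chart_at A p) p)"
  by (simp add: differential_def chart_differential_def Let_def)

definition transition :: "('m, 'n) chart \<Rightarrow> ('m, 'n) chart \<Rightarrow> real^'n \<Rightarrow> real^'n^'n" where
  "transition c c' x = matrix (frechet_derivative (snd c' \<circ> chart_inv c) (at x))"

context
  fixes A :: "('m::{t2_space,second_countable_topology}, 'n::finite) chart set"
  assumes A: "smooth_atlas A"
begin

lemma chart_at_in: "chart_at A p \<in> A" "p \<in> fst (chart_at A p)"
proof -
  have "p \<in> (\<Union>c\<in>A. fst c)" using A by (simp add: smooth_atlas_def)
  then have "\<exists>c. c \<in> A \<and> p \<in> fst c" by blast
  then have "chart_at A p \<in> A \<and> p \<in> fst (chart_at A p)"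
    unfolding chart_at_def by (rule someI_ex)
  then show "chart_at A p \<in> A" "p \<in> fst (chart_at A p)" by auto
qed

lemma atlas_top_chart: "c \<in> A \<Longrightarrow> top_chart c"
  using A unfolding smooth_atlas_def by blast

lemma chart_homeomorphism:
  "c \<in> A \<Longrightarrow> homeomorphism (fst c) (snd c ` fst c) (snd c) (chart_inv c)"
  using atlas_top_chart unfolding top_chart_def by blast

lemma chart_inv_left: "c \<in> A \<Longrightarrow> p \<in> fst c \<Longrightarrow> chart_inv c (snd c p) = p"
  using chart_homeomorphism[of c] unfolding homeomorphism_def by blast

lemma chart_inv_right: "c \<in> A \<Longrightarrow> x \<in> snd c ` fst c \<Longrightarrow> snd c (chart_inv c x) = x"
  using chart_homeomorphism[of c] unfolding homeomorphism_def by blast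

lemma chart_inv_in: "c \<in> A \<Longrightarrow> x \<in> snd c ` fst c \<Longrightarrow> chart_inv c x \<in> fst c"
  using chart_inv_left[of c] by force

lemma open_chart_image: "c \<in> A \<Longrightarrow> open (snd c ` fst c)"
  using atlas_top_chart[of c] unfolding top_chart_def by blast

lemma open_chart_domain: "c \<in> A \<Longrightarrow> open (fst c)"
  using atlas_top_chart[of c] unfolding top_chart_def by blast

lemma continuous_on_chart_inv: "c \<in> A \<Longrightarrow> continuous_on (snd c ` fst c) (chart_inv c)"
  using chart_homeomorphism[of c] unfolding homeomorphism_def by blast

lemma continuous_on_chart: "c \<in> A \<Longrightarrow> continuous_on (fst c) (snd c)"
  using chart_homeomorphism[of c] unfolding homeomorphism_def by blast

lemma chart_has_derivative:
  fixes f :: "'m \<Rightarrow> real^'k::finite"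
  assumes "f \<in> C1_maps A" "c \<in> A" "x \<in> snd c ` fst c"
  shows "(f \<circ> chart_inv c has_derivative (*v) (chart_differential c f x)) (at x)"
proof -
  have "(f \<circ> chart_inv c) differentiable (at x)"
    using assms unfolding C1_maps_def C_on_1 by blast
  then have d: "(f \<circ> chart_inv c has_derivative frechet_derivative (f \<circ> chart_inv c) (at x)) (at x)"
    by (simp add: frechet_derivative_works)
  then have "(*v) (chart_differential c f x) = frechet_derivative (f \<circ> chart_inv c) (at x)"
    unfolding chart_differential_def
    by (intro ext) (simp add: matrix_works has_derivative_linear)
  then show ?thesis using d by simp
qed

lemma frechet_derivative_chart:
  fixes f :: "'m \<Rightarrow> real^'k::finite"
  assumes "f \<in> C1_maps A" "c \<in> A" "x \<in> snd c ` fst c"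
  shows "frechet_derivative (f \<circ> chart_inv c) (at x) = (*v) (chart_differential c f x)"
  using frechet_derivative_at[OF chart_has_derivative[OF assms]] by simp

lemma continuous_on_chart_differential:
  fixes f :: "'m \<Rightarrow> real^'k::finite"
  assumes f: "f \<in> C1_maps A" "c \<in> A"
  shows "continuous_on (snd c ` fst c) (chart_differential c f)"
proof -
  have "continuous_on (snd c ` fst c) (\<lambda>x. frechet_derivative (f \<circ> chart_inv c) (at x) v)" for v
    using f unfolding C1_maps_def C_on_1 by blast
  then have "continuous_on (snd c ` fst c) (\<lambda>x. \<chi> i j. frechet_derivative (f \<circ> chart_inv c) (at x) (axis j 1) $ i)"
    by (intro continuous_on_vec_lambda continuous_on_component)
  then show ?thesis
    by (simp add: chart_differential_def[abs_def] matrix_def)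
qed

lemma continuous_on_chart_fun:
  fixes f :: "'m \<Rightarrow> real^'k::finite"
  assumes f: "f \<in> C1_maps A" "c \<in> A"
  shows "continuous_on (snd c ` fst c) (f \<circ> chart_inv c)"
  using chart_has_derivative[OF f] by (meson continuous_at_imp_continuous_on has_derivative_continuous)

lemma transition_has_derivative:
  assumes "c \<in> A" "c' \<in> A" "p \<in> fst c" "p \<in> fst c'"
  shows "(snd c' \<circ> chart_inv c has_derivative (*v) (transition c c' (snd c p))) (at (snd c p))"
proof -
  have "smooth_on (snd c ` (fst c \<inter> fst c')) (snd c' \<circ> chart_inv c)"
    using A assms unfolding smooth_atlas_def by blast
  then have "C_on 1 (snd c ` (fst c \<inter> fst c')) (snd c' \<circ> chart_inv c)"
    unfolding smooth_on_def by blast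
  then have "(snd c' \<circ> chart_inv c) differentiable (at (snd c p))"
    using assms unfolding C_on_1 by blast
  then have d: "(snd c' \<circ> chart_inv c has_derivative frechet_derivative (snd c' \<circ> chart_inv c) (at (snd c p))) (at (snd c p))"
    by (simp add: frechet_derivative_works)
  then have "(*v) (transition c c' (snd c p)) = frechet_derivative (snd c' \<circ> chart_inv c) (at (snd c p))"
    unfolding transition_def
    by (intro ext) (simp add: matrix_works has_derivative_linear)
  then show ?thesis using d by simp
qed

lemma open_chart_overlap:
  assumes "c \<in> A" "open V"
  shows "open (snd c ` (fst c \<inter> V))"
proof -
  have "snd c ` (fst c \<inter> V) = chart_inv c -` V \<inter> snd c ` fst c"
    using chart_inv_left[OF assms(1)] by force
  also have "open \<dots>"
    by (rule continuous_on_open_vimage[THEN iffD1, rule_format])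
       (use assms continuous_on_chart_inv open_chart_image in blast)+
  finally show ?thesis .
qed

lemma derivative_change_chart:
  fixes f :: "'m \<Rightarrow> 'z::real_normed_vector"
  assumes c: "c \<in> A" "c' \<in> A" "p \<in> fst c" "p \<in> fst c'"
    and d: "(f \<circ> chart_inv c' has_derivative L) (at (snd c' p))"
  shows "(f \<circ> chart_inv c has_derivative (L \<circ> (*v) (transition c c' (snd c p)))) (at (snd c p))"
proof -
  have t: "(snd c' \<circ> chart_inv c has_derivative (*v) (transition c c' (snd c p))) (at (snd c p))"
    by (rule transition_has_derivative[OF c])
  have eq: "(snd c' \<circ> chart_inv c) (snd c p) = snd c' p" using c by (simp add: chart_inv_left)
  have "((f \<circ> chart_inv c') \<circ> (snd c' \<circ> chart_inv c) has_derivative (L \<circ> (*v) (transition c c' (snd c p)))) (at (snd c p))"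
    by (rule diff_chain_at[OF t]) (unfold eq, rule d)
  moreover have "open (snd c ` (fst c \<inter> fst c'))"
    by (rule open_chart_overlap[OF c(1) open_chart_domain[OF c(2)]])
  moreover have "snd c p \<in> snd c ` (fst c \<inter> fst c')" using c by blast
  moreover have "((f \<circ> chart_inv c') \<circ> (snd c' \<circ> chart_inv c)) x = (f \<circ> chart_inv c) x"
    if "x \<in> snd c ` (fst c \<inter> fst c')" for x
    using c that by (auto simp: chart_inv_left)
  ultimately show ?thesis
    by (rule has_derivative_transform_within_open)
qed

lemma transition_inverse:
  assumes c: "c \<in> A" "c' \<in> A" "p \<in> fst c" "p \<in> fst c'"
  shows "transition c' c (snd c' p) ** transition c c' (snd c p) = mat 1"
proof -
  have 1: "(snd c \<circ> chart_inv c has_derivative ((*v) (transition c' c (snd c' p)) \<circ> (*v) (transition c c' (snd c p)))) (at (snd c p))"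
    by (rule derivative_change_chart[OF c transition_has_derivative[OF c(2,1,4,3)]])
  have "((\<lambda>x. x) has_derivative ((*v) (transition c' c (snd c' p)) \<circ> (*v) (transition c c' (snd c p)))) (at (snd c p))"
    by (rule has_derivative_transform_within_open[OF 1 open_chart_image[OF c(1)]])
      (use c in \<open>auto simp: chart_inv_left\<close>)
  then have "(\<lambda>x. x) = (*v) (transition c' c (snd c' p)) \<circ> (*v) (transition c c' (snd c p))"
    using has_derivative_unique has_derivative_ident by blast
  then have "(transition c' c (snd c' p) ** transition c c' (snd c p)) *v x = mat 1 *v x" for x
    by (metis comp_apply matrix_vector_mul_assoc matrix_vector_mul_lid)
  then show ?thesis by (simp add: matrix_eq)
qed

lemma chart_differential_change:
  fixes f :: "'m \<Rightarrow> real^'k::finite"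
  assumes f: "f \<in> C1_maps A" and c: "c \<in> A" "c' \<in> A" "p \<in> fst c" "p \<in> fst c'"
  shows "chart_differential c f (snd c p) = chart_differential c' f (snd c' p) ** transition c c' (snd c p)"
proof -
  have "(f \<circ> chart_inv c' has_derivative (*v) (chart_differential c' f (snd c' p))) (at (snd c' p))"
    using f c by (intro chart_has_derivative) auto
  from derivative_change_chart[OF c this]
  have "(f \<circ> chart_inv c has_derivative ((*v) (chart_differential c' f (snd c' p)) \<circ> (*v) (transition c c' (snd c p)))) (at (snd c p))" .
  moreover have "(f \<circ> chart_inv c has_derivative (*v) (chart_differential c f (snd c p))) (at (snd c p))"
    using f c by (intro chart_has_derivative) auto
  ultimately have "(*v) (chart_differential c f (snd c p)) = (*v) (chart_differential c' f (snd c' p)) \<circ> (*v) (transition c c' (snd c p))"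
    using has_derivative_unique by blast
  then have "chart_differential c f (snd c p) *v x = (chart_differential c' f (snd c' p) ** transition c c' (snd c p)) *v x" for x
    by (metis comp_apply matrix_vector_mul_assoc)
  then show ?thesis by (simp add: matrix_eq)
qed

text \<open>Changing the chart composes the differential on the right with a transition matrix,
  which cannot enlarge the range; using this in both directions gives the equivalence.\<close>

lemma surj_chart_differential:
  fixes f :: "'m \<Rightarrow> real^'k::finite"
  assumes f: "f \<in> C1_maps A" and c: "c \<in> A" "p \<in> fst c"
  shows "surj ((*v) (chart_differential c f (snd c p))) \<longleftrightarrow> surj ((*v) (differential A f p))"
proof -
  have imp: "surj ((*v) (chart_differential c1 f (snd c1 p)))"
    if s: "surj ((*v) (chart_differential c2 f (snd c2 p)))" and c12: "c1 \<in> A" "c2 \<in> A" "p \<in> fst c1" "p \<in> fst c2" for c1 c2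
    unfolding surj_def
  proof
    fix y
    obtain x where x: "y = chart_differential c2 f (snd c2 p) *v x"
      using surjD[OF s] by blast
    have "y = chart_differential c1 f (snd c1 p) *v (transition c2 c1 (snd c2 p) *v x)"
      unfolding matrix_vector_mul_assoc chart_differential_change[OF f c12(2,1,4,3), symmetric] by (rule x)
    then show "\<exists>x. y = chart_differential c1 f (snd c1 p) *v x" by blast
  qed
  show ?thesis
    unfolding differential_eq
    using imp[OF _ chart_at_in(1) c(1) chart_at_in(2) c(2)] imp[OF _ c(1) chart_at_in(1) c(2) chart_at_in(2)]
    by (rule iffI)
qed

end

section \<open>The weak Whitney topology\<close>

lemma norm_matrix_le_entries:
  fixes B :: "real^'a::finite^'b::finite"
  assumes "\<And>i j. \<bar>B $ i $ j\<bar> \<le> e"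
  shows "norm B \<le> real (CARD('b) * CARD('a)) * e"
proof -
  have "norm B = L2_set (\<lambda>i. norm (B $ i)) UNIV" by (rule norm_vec_def)
  also have "\<dots> \<le> (\<Sum>i\<in>UNIV. norm (B $ i))" by (rule L2_set_le_sum) simp
  also have "\<dots> \<le> (\<Sum>i\<in>(UNIV :: 'b set). \<Sum>j\<in>(UNIV :: 'a set). e)"
    by (intro sum_mono order.trans[OF norm_le_l1_cart] assms)
  finally show ?thesis by simp
qed

lemma abs_SUP_diff_le:
  fixes a b :: "'x \<Rightarrow> real"
  assumes "K \<noteq> {}" "bdd_above (a ` K)" "bdd_above (b ` K)" "\<And>x. x \<in> K \<Longrightarrow> \<bar>a x - b x\<bar> \<le> \<eta>"
  shows "\<bar>(SUP x\<in>K. a x) - (SUP x\<in>K. b x)\<bar> \<le> \<eta>"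
proof -
  have "(SUP x\<in>K. a x) \<le> (SUP x\<in>K. b x) + \<eta>"
  proof (rule cSUP_least[OF assms(1)])
    fix x assume x: "x \<in> K"
    show "a x \<le> (SUP x\<in>K. b x) + \<eta>"
      using cSUP_upper[OF x assms(3)] assms(4)[OF x] by linarith
  qed
  moreover have "(SUP x\<in>K. b x) \<le> (SUP x\<in>K. a x) + \<eta>"
  proof (rule cSUP_least[OF assms(1)])
    fix x assume x: "x \<in> K"
    show "b x \<le> (SUP x\<in>K. a x) + \<eta>"
      using cSUP_upper[OF x assms(2)] assms(4)[OF x] by linarith
  qed
  ultimately show ?thesis by linarith
qed

definition chart_jet :: "('m, 'n) chart \<Rightarrow> ('m \<Rightarrow> real^'k::finite) \<Rightarrow> real^'n \<Rightarrow> (real^'k) \<times> (real^'n^'k)" where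
  "chart_jet c f x = (f (chart_inv c x), chart_differential c f x)"

context
  fixes A :: "('m::{t2_space,second_countable_topology}, 'n::finite) chart set"
  assumes A: "smooth_atlas A"
begin

section \<open>The metric and the Jacobian in a fixed chart\<close>

lemma metric_coeffs_eq:
  fixes g :: "'m \<Rightarrow> real^'n^'n"
  assumes "c \<in> A" "q \<in> fst c"
  shows "metric_coeffs A g c (snd c q) =
    transpose (transition c (chart_at A q) (snd c q)) ** g q ** transition c (chart_at A q) (snd c q)"
  using chart_inv_left[OF A assms] by (simp add: metric_coeffs_def transition_def Let_def)

lemma pos_def_metric_coeffs:
  assumes g: "riemannian_metric A g" and c: "c \<in> A" and x: "x \<in> snd c ` fst c"
  shows "pos_def_matrix (metric_coeffs A g c x)"
proof -
  obtain q where q: "q \<in> fst c" "x = snd c q" using x by blast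
  let ?T = "transition c (chart_at A q) (snd c q)"
  have inv: "transition (chart_at A q) c (snd (chart_at A q) q) ** ?T = mat 1"
    by (rule transition_inverse[OF A c chart_at_in(1)[OF A] q(1) chart_at_in(2)[OF A]])
  show ?thesis
    unfolding pos_def_matrix_def q(2) metric_coeffs_eq[OF c q(1)]
  proof (intro allI impI)
    fix v :: "real^'n" assume v: "v \<noteq> 0"
    have nz: "?T *v v \<noteq> 0"
    proof
      assume 0: "?T *v v = 0"
      have "v = (transition (chart_at A q) c (snd (chart_at A q) q) ** ?T) *v v" by (simp add: inv)
      also have "\<dots> = 0" by (simp only: matrix_vector_mul_assoc[symmetric] 0 matrix_vector_mult_0_right)
      finally show False using v by blast
    qed
    have "v \<bullet> ((transpose ?T ** g q ** ?T) *v v) = v \<bullet> (transpose ?T *v (g q *v (?T *v v)))"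
      by (simp only: matrix_vector_mul_assoc matrix_mul_assoc)
    also have "\<dots> = (?T *v v) \<bullet> (g q *v (?T *v v))"
      by (metis dot_lmul_matrix transpose_matrix_vector transpose_transpose)
    also have "\<dots> > 0" using g nz by (auto simp: riemannian_metric_def)
    finally show "0 < v \<bullet> ((transpose ?T ** g q ** ?T) *v v)" .
  qed
qed

lemma continuous_on_metric_coeffs:
  assumes "riemannian_metric A g" and "c \<in> A"
  shows "continuous_on (snd c ` fst c) (metric_coeffs A g c)"
proof -
  have "C_on 0 (snd c ` fst c) (metric_coeffs A g c)"
    using assms unfolding riemannian_metric_def smooth_on_def by blast
  then show ?thesis by (simp only: C_on.simps)
qed

text \<open>With mutually inverse transition matrices \<open>?T\<close> and \<open>?S\<close>, the
  differential acquires a factor \<open>?T\<close> and the inverse metric is conjugated by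
  \<open>?S\<close>, so everything cancels in the Gram matrix. In this form the Jacobian is seen to
  vary continuously with the point although the preferred chart does not.\<close>

lemma jac_chart:
  fixes f :: "'m \<Rightarrow> real^'k::finite"
  assumes g: "riemannian_metric A g" and f: "f \<in> C1_maps A" and c: "c \<in> A" "q \<in> fst c"
  shows "jac A g q f = gram_jac (metric_coeffs A g c (snd c q)) (chart_differential c f (snd c q))"
proof -
  let ?c = "chart_at A q"
  let ?T = "transition c ?c (snd c q)" and ?S = "transition ?c c (snd ?c q)"
  have c': "?c \<in> A" "q \<in> fst ?c" by (rule chart_at_in[OF A])+
  have ST: "?S ** ?T = mat 1" by (rule transition_inverse[OF A c(1) c'(1) c(2) c'(2)])
  then have TS: "?T ** ?S = mat 1" by (simp add: matrix_left_right_inverse)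
  let ?D = "differential A f q"
  have D: "chart_differential c f (snd c q) = ?D ** ?T"
    unfolding differential_eq by (rule chart_differential_change[OF A f c(1) c'(1) c(2) c'(2)])
  have "pos_def_matrix (g q)" using g by (auto simp: riemannian_metric_def pos_def_matrix_def)
  note gi = matrix_inv_mult[OF pos_def_matrix_det_nz[OF this]]
  have "(transpose ?T ** g q ** ?T) ** (?S ** matrix_inv (g q) ** transpose ?S)
      = transpose ?T ** g q ** (?T ** ?S) ** matrix_inv (g q) ** transpose ?S"
    by (simp only: matrix_mul_assoc)
  also have "\<dots> = transpose ?T ** (g q ** matrix_inv (g q)) ** transpose ?S"
    by (simp add: TS matrix_mul_assoc[symmetric])
  also have "\<dots> = transpose (?S ** ?T)" by (simp add: gi matrix_transpose_mul)
  also have "\<dots> = mat 1" by (simp add: ST)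
  finally have inv: "matrix_inv (transpose ?T ** g q ** ?T) = ?S ** matrix_inv (g q) ** transpose ?S"
    by (rule matrix_inv_unique)
  have "(?D ** ?T) ** (?S ** matrix_inv (g q) ** transpose ?S) ** transpose (?D ** ?T)
      = ?D ** (?T ** ?S) ** matrix_inv (g q) ** (transpose ?S ** transpose ?T) ** transpose ?D"
    by (simp only: matrix_mul_assoc matrix_transpose_mul)
  also have "transpose ?S ** transpose ?T = transpose (?T ** ?S)" by (simp only: matrix_transpose_mul)
  finally have "(?D ** ?T) ** (?S ** matrix_inv (g q) ** transpose ?S) ** transpose (?D ** ?T)
      = ?D ** matrix_inv (g q) ** transpose ?D"
    by (simp add: TS)
  then show ?thesis
    unfolding jac_eq_gram_jac gram_jac_def gram_matrix_eq metric_coeffs_eq[OF c] D inv by simp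
qed

section \<open>Continuous functionals of the 1-jet\<close>

lemma in_whitney_nbhd:
  assumes "f \<in> C1_maps A" "e > 0"
  shows "f \<in> whitney_nbhd A f c K e"
  using assms by (simp add: whitney_nbhd_def onorm_zero)

lemma openin_whitney_nbhd:
  assumes "f \<in> C1_maps A" "c \<in> A" "compact K" "K \<subseteq> fst c" "e > 0"
  shows "openin (weak_whitney A) (whitney_nbhd A f c K e)"
  unfolding weak_whitney_def by (rule topology_generated_by_Basis) (use assms in blast)

lemma topspace_weak_whitney: "topspace (weak_whitney A) = (C1_maps A :: ('m \<Rightarrow> real^'k::finite) set)"
proof
  show "topspace (weak_whitney A) \<subseteq> (C1_maps A :: ('m \<Rightarrow> real^'k) set)"
    unfolding weak_whitney_def topology_generated_by_topspace by (auto simp: whitney_nbhd_def)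
  show "(C1_maps A :: ('m \<Rightarrow> real^'k) set) \<subseteq> topspace (weak_whitney A)"
  proof
    fix f :: "'m \<Rightarrow> real^'k" assume f: "f \<in> C1_maps A"
    let ?c = "chart_at A undefined"
    have "openin (weak_whitney A) (whitney_nbhd A f ?c {} 1)"
      by (rule openin_whitney_nbhd[OF f chart_at_in(1)[OF A]]) auto
    then show "f \<in> topspace (weak_whitney A)"
      using in_whitney_nbhd[OF f, of 1 ?c "{}"] openin_subset by fastforce
  qed
qed

text \<open>One subbasic neighbourhood per map is enough for functionals that look at a single chart
  and a single compact set.\<close>

lemma continuous_map_weak_whitneyI:
  fixes \<Phi> :: "('m \<Rightarrow> real^'k::finite) \<Rightarrow> real"
  assumes "\<And>f \<eta>. f \<in> C1_maps A \<Longrightarrow> 0 < \<eta> \<Longrightarrow> \<exists>c K e. c \<in> A \<and> compact K \<and> K \<subseteq> fst c \<and> 0 < e \<and>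
     (\<forall>h\<in>whitney_nbhd A f c K e. \<bar>\<Phi> h - \<Phi> f\<bar> < \<eta>)"
  shows "continuous_map (weak_whitney A) euclideanreal \<Phi>"
  unfolding continuous_map_def
proof (intro conjI allI impI)
  show "\<Phi> \<in> topspace (weak_whitney A) \<rightarrow> topspace euclideanreal" by simp
  fix V :: "real set" assume "openin euclideanreal V"
  then have V: "open V" by simp
  show "openin (weak_whitney A) {f \<in> topspace (weak_whitney A). \<Phi> f \<in> V}"
  proof (subst openin_subopen, intro ballI)
    fix f assume "f \<in> {f \<in> topspace (weak_whitney A). \<Phi> f \<in> V}"
    then have f: "f \<in> C1_maps A" "\<Phi> f \<in> V" by (auto simp: topspace_weak_whitney)
    obtain \<eta> where \<eta>: "\<eta> > 0" "\<And>y. dist y (\<Phi> f) < \<eta> \<Longrightarrow> y \<in> V"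
      using V f(2) by (auto simp: open_dist)
    obtain c K e where cK: "c \<in> A" "compact K" "K \<subseteq> fst c" "0 < e"
      and lt: "\<And>h. h \<in> whitney_nbhd A f c K e \<Longrightarrow> \<bar>\<Phi> h - \<Phi> f\<bar> < \<eta>"
      using assms[OF f(1) \<eta>(1)] by blast
    have "whitney_nbhd A f c K e \<subseteq> {f \<in> topspace (weak_whitney A). \<Phi> f \<in> V}"
      using lt \<eta>(2) by (auto simp: topspace_weak_whitney dist_real_def) (auto simp: whitney_nbhd_def)
    then show "\<exists>T. openin (weak_whitney A) T \<and> f \<in> T \<and> T \<subseteq> {f \<in> topspace (weak_whitney A). \<Phi> f \<in> V}"
      using openin_whitney_nbhd[OF f(1) cK] in_whitney_nbhd[OF f(1) cK(4)] by blast
  qed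
qed

text \<open>Every matrix entry is bounded by the operator norm; the constant in the second estimate
  counts the entries.\<close>

lemma whitney_nbhd_jet:
  fixes f h :: "'m \<Rightarrow> real^'k::finite"
  assumes f: "f \<in> C1_maps A" and c: "c \<in> A" "K \<subseteq> fst c" and h: "h \<in> whitney_nbhd A f c K e"
    and p: "p \<in> K"
  shows "norm (h p - f p) \<le> e"
    and "norm (chart_differential c h (snd c p) - chart_differential c f (snd c p)) \<le> real (CARD('k) * CARD('n)) * e"
proof -
  have hC: "h \<in> C1_maps A" using h by (simp add: whitney_nbhd_def)
  have x: "snd c p \<in> snd c ` fst c" using c p by blast
  let ?H = "chart_differential c h (snd c p)" and ?F = "chart_differential c f (snd c p)"
  have lt: "norm (h p - f p) < e" "onorm (\<lambda>v. ?H *v v - ?F *v v) < e"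
    using h p frechet_derivative_chart[OF A hC c(1) x] frechet_derivative_chart[OF A f c(1) x]
    by (auto simp: whitney_nbhd_def)
  then show "norm (h p - f p) \<le> e" by simp
  have "\<bar>(?H - ?F) $ i $ j\<bar> \<le> e" for i j
  proof -
    have "(?H - ?F) $ i $ j = (?H *v axis j 1 - ?F *v axis j 1) $ i"
      by (simp add: matrix_vector_mult_basis column_def)
    also have "\<bar>\<dots>\<bar> \<le> norm (?H *v axis j 1 - ?F *v axis j 1)" by (rule component_le_norm_cart)
    also have "\<dots> \<le> onorm (\<lambda>v. ?H *v v - ?F *v v) * norm (axis j (1::real) :: real^'n)"
      by (rule onorm) (intro bounded_linear_sub matrix_vector_mul_bounded_linear)
    also have "\<dots> \<le> e" using lt by (simp add: norm_axis_1)
    finally show ?thesis .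
  qed
  then show "norm (?H - ?F) \<le> real (CARD('k) * CARD('n)) * e" by (rule norm_matrix_le_entries)
qed

lemma continuous_on_chart_jet:
  fixes f :: "'m \<Rightarrow> real^'k::finite"
  assumes "f \<in> C1_maps A" "c \<in> A"
  shows "continuous_on (snd c ` fst c) (chart_jet c f)"
  unfolding chart_jet_def[abs_def]
  using continuous_on_chart_fun[OF A assms]
  by (intro continuous_on_Pair continuous_on_chart_differential[OF A assms]) (simp add: o_def)

text \<open>The second jet argument, taken at a fixed point, allows functionals that compare the
  derivative at \<open>x\<close> with the one at \<open>x0\<close>.\<close>

lemma continuous_map_SUP_jet:
  fixes R :: "real^'n \<Rightarrow> ((real^'k::finite) \<times> (real^'n^'k)) \<Rightarrow> ((real^'k) \<times> (real^'n^'k)) \<Rightarrow> real"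
  assumes c: "c \<in> A" and K: "compact K" "K \<subseteq> snd c ` fst c" and x0: "x0 \<in> K"
    and R: "continuous_on (K \<times> UNIV) (\<lambda>(x, j, j'). R x j j')"
  shows "continuous_map (weak_whitney A) euclideanreal
     (\<lambda>f. SUP x\<in>K. R x (chart_jet c f x) (chart_jet c f x0))"
proof (rule continuous_map_weak_whitneyI)
  fix f :: "'m \<Rightarrow> real^'k" and \<eta> :: real assume f: "f \<in> C1_maps A" and \<eta>: "0 < \<eta>"
  have contK: "continuous_on K (chart_jet c h)" if "h \<in> C1_maps A" for h :: "'m \<Rightarrow> real^'k"
    by (rule continuous_on_subset[OF continuous_on_chart_jet[OF that c] K(2)])
  have bdd: "bdd_above ((\<lambda>x. R x (chart_jet c h x) (chart_jet c h x0)) ` K)"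
    if "h \<in> C1_maps A" for h :: "'m \<Rightarrow> real^'k"
  proof -
    have "continuous_on K (\<lambda>x. (\<lambda>(x, j, j'). R x j j') (x, chart_jet c h x, chart_jet c h x0))"
      by (rule continuous_on_compose2[OF R]) (auto intro!: continuous_intros contK that)
    then have "compact ((\<lambda>x. R x (chart_jet c h x) (chart_jet c h x0)) ` K)"
      using K(1) compact_continuous_image by fastforce
    then show ?thesis by (intro bounded_imp_bdd_above compact_imp_bounded)
  qed
  have "bounded (chart_jet c f ` K)"
    by (intro compact_imp_bounded compact_continuous_image contK f K)
  then obtain B where B: "\<And>x. x \<in> K \<Longrightarrow> norm (chart_jet c f x) \<le> B"
    by (auto simp: bounded_iff)
  \<comment> \<open>Jets of \<open>f\<close> over \<open>K\<close> have norm at most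
    \<open>B\<close>; the extra 1 leaves room for the jets of nearby maps inside one compact set,
    where \<open>R\<close> is uniformly continuous.\<close>
  let ?C = "K \<times> cball (0 :: (real^'k) \<times> (real^'n^'k)) (B + 1) \<times> cball (0 :: (real^'k) \<times> (real^'n^'k)) (B + 1)"
  have cC: "compact ?C" using K by (intro compact_Times compact_cball)
  have "continuous_on ?C (\<lambda>(x, j, j'). R x j j')" by (rule continuous_on_subset[OF R]) auto
  then have "uniformly_continuous_on ?C (\<lambda>(x, j, j'). R x j j')"
    using cC by (rule compact_uniformly_continuous)
  then obtain d where d: "d > 0"
    "\<And>z z'. z \<in> ?C \<Longrightarrow> z' \<in> ?C \<Longrightarrow> dist z z' < d \<Longrightarrow>
        dist ((\<lambda>(x, j, j'). R x j j') z) ((\<lambda>(x, j, j'). R x j j') z') < \<eta> / 2"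
    using \<eta> unfolding uniformly_continuous_on_def by (meson half_gt_zero)
  \<comment> \<open>\<open>N\<close> is the factor by which an error \<open>e\<close> in value and
    derivative can grow in the jet. With \<open>e\<close> as below each jet moves by at most 1,
    hence stays in the ball, and by at most \<open>d / 3\<close>, so the two jets together move by
    less than \<open>d\<close>.\<close>
  define N where "N = 1 + real (CARD('k) * CARD('n))"
  define e where "e = min 1 (d / 3) / N"
  have N: "N > 0" by (simp add: N_def add_pos_nonneg)
  have e: "e > 0" using d N by (simp add: e_def)
  let ?K = "chart_inv c ` K"
  have Kc: "compact ?K" "?K \<subseteq> fst c"
    using compact_continuous_image[OF continuous_on_subset[OF continuous_on_chart_inv[OF A c] K(2)] K(1)]
      K(2) chart_inv_in[OF A c] by auto
  have "\<bar>(SUP x\<in>K. R x (chart_jet c h x) (chart_jet c h x0)) - (SUP x\<in>K. R x (chart_jet c f x) (chart_jet c f x0))\<bar> < \<eta>"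
    if h: "h \<in> whitney_nbhd A f c ?K e" for h
  proof -
    have hC: "h \<in> C1_maps A" using h by (simp add: whitney_nbhd_def)
    have jet: "norm (chart_jet c h x - chart_jet c f x) \<le> min 1 (d / 3)" if x: "x \<in> K" for x
    proof -
      have p: "chart_inv c x \<in> ?K" "snd c (chart_inv c x) = x"
        using x K(2) chart_inv_right[OF A c] by auto
      have "norm (chart_jet c h x - chart_jet c f x)
        \<le> norm (h (chart_inv c x) - f (chart_inv c x)) + norm (chart_differential c h x - chart_differential c f x)"
        unfolding chart_jet_def diff_Pair by (rule norm_Pair_le)
      also have "\<dots> \<le> e + real (CARD('k) * CARD('n)) * e"
        using whitney_nbhd_jet[OF f c Kc(2) h p(1)] unfolding p(2) by (rule add_mono)
      also have "\<dots> = N * e" by (simp add: N_def algebra_simps)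
      also have "\<dots> = min 1 (d / 3)" using N by (simp add: e_def)
      finally show ?thesis .
    qed
    have "\<bar>(SUP x\<in>K. R x (chart_jet c h x) (chart_jet c h x0)) - (SUP x\<in>K. R x (chart_jet c f x) (chart_jet c f x0))\<bar> \<le> \<eta> / 2"
    proof (rule abs_SUP_diff_le)
      show "K \<noteq> {}" using x0 by blast
      fix x assume x: "x \<in> K"
      let ?z = "(x, chart_jet c h x, chart_jet c h x0)" and ?z' = "(x, chart_jet c f x, chart_jet c f x0)"
      have le: "norm (chart_jet c h y) \<le> B + 1" if "y \<in> K" for y
        using norm_triangle_sub[of "chart_jet c h y" "chart_jet c f y"] B[OF that] jet[OF that] by linarith
      have B1: "norm (chart_jet c f y) \<le> B + 1" if "y \<in> K" for y
        using B[OF that] by linarith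
      have "dist ?z ?z' = norm (0 :: real^'n, chart_jet c h x - chart_jet c f x, chart_jet c h x0 - chart_jet c f x0)"
        by (simp add: dist_norm)
      also have "\<dots> \<le> norm (0 :: real^'n) + (norm (chart_jet c h x - chart_jet c f x) + norm (chart_jet c h x0 - chart_jet c f x0))"
        by (intro order.trans[OF norm_Pair_le] add_mono norm_Pair_le order_refl)
      also have "\<dots> < d" using jet[OF x] jet[OF x0] d(1) by simp
      finally have "dist ?z ?z' < d" .
      then have "dist ((\<lambda>(x, j, j'). R x j j') ?z) ((\<lambda>(x, j, j'). R x j j') ?z') < \<eta> / 2"
        using x x0 le B1 by (intro d(2)) auto
      then show "\<bar>R x (chart_jet c h x) (chart_jet c h x0) - R x (chart_jet c f x) (chart_jet c f x0)\<bar> \<le> \<eta> / 2"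
        by (simp add: dist_real_def)
    qed (use bdd hC f in auto)
    then show ?thesis using \<eta> by linarith
  qed
  then show "\<exists>c' L e. c' \<in> A \<and> compact L \<and> L \<subseteq> fst c' \<and> 0 < e \<and>
     (\<forall>h\<in>whitney_nbhd A f c' L e. \<bar>(SUP x\<in>K. R x (chart_jet c h x) (chart_jet c h x0))
        - (SUP x\<in>K. R x (chart_jet c f x) (chart_jet c f x0))\<bar> < \<eta>)"
    using c Kc e by (intro exI[of _ c] exI[of _ ?K] exI[of _ e]) simp
qed

section \<open>Borel sets of maps\<close>

lemma space_borel_C1 [simp]: "space (borel_C1 A) = (C1_maps A :: ('m \<Rightarrow> real^'k::finite) set)"
  unfolding borel_C1_def topspace_weak_whitney[symmetric]
  by (rule space_measure_of) (use openin_subset in blast)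

lemma openin_sets_borel_C1:
  fixes U :: "('m \<Rightarrow> real^'k::finite) set"
  assumes "openin (weak_whitney A) U"
  shows "U \<in> sets (borel_C1 A)"
proof -
  have "{U. openin (weak_whitney A) U} \<subseteq> Pow (topspace (weak_whitney A :: ('m \<Rightarrow> real^'k) topology))"
    using openin_subset by blast
  then show ?thesis
    unfolding borel_C1_def using assms by (simp add: sets_measure_of sigma_sets.Basic)
qed

lemma borel_measurable_continuous_map:
  fixes \<Phi> :: "('m \<Rightarrow> real^'k::finite) \<Rightarrow> real"
  assumes "continuous_map (weak_whitney A) euclideanreal \<Phi>"
  shows "\<Phi> \<in> borel_measurable (borel_C1 A)"
proof (rule borel_measurableI)
  fix S :: "real set" assume "open S"
  then have "openin (weak_whitney A) {f \<in> topspace (weak_whitney A). \<Phi> f \<in> S}"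
    using assms unfolding continuous_map_def by simp
  moreover have "{f \<in> topspace (weak_whitney A). \<Phi> f \<in> S} = \<Phi> -` S \<inter> space (borel_C1 A)"
    unfolding space_borel_C1 topspace_weak_whitney by auto
  ultimately show "\<Phi> -` S \<inter> space (borel_C1 A) \<in> sets (borel_C1 A)"
    using openin_sets_borel_C1 by simp
qed

text \<open>Evaluation at a point is a supremum over a one-point set.\<close>

lemma continuous_map_jet:
  fixes R :: "(real^'k::finite) \<times> (real^'n^'k) \<Rightarrow> real"
  assumes "c \<in> A" "x \<in> snd c ` fst c" "continuous_on UNIV R"
  shows "continuous_map (weak_whitney A) euclideanreal (\<lambda>f. R (chart_jet c f x))"
proof -
  have "continuous_on ({x} \<times> UNIV) (\<lambda>(y, j, j'). R j)"
    unfolding split_beta by (rule continuous_on_compose2[OF assms(3)]) (auto intro!: continuous_intros)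
  from continuous_map_SUP_jet[OF assms(1) _ _ _ this, of x] assms(2)
  show ?thesis by simp
qed

text \<open>On a compact set a continuous function takes a nonnegative value exactly when its
  maximum is nonnegative, and this maximum depends continuously on \<open>f\<close>. An existence
  statement over uncountably many points thereby becomes a Borel condition.\<close>

lemma sets_ex_jet:
  fixes R :: "real^'n \<Rightarrow> (real^'k::finite) \<times> (real^'n^'k) \<Rightarrow> real"
  assumes c: "c \<in> A" and K: "compact K" "K \<subseteq> snd c ` fst c"
    and R: "continuous_on (K \<times> UNIV) (\<lambda>(x, j). R x j)"
  shows "{f \<in> C1_maps A. \<exists>x\<in>K. 0 \<le> R x (chart_jet c f x)} \<in> sets (borel_C1 A)"
proof (cases "K = {}")
  case False
  then obtain x0 where x0: "x0 \<in> K" by blast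
  let ?\<Phi> = "\<lambda>f. SUP x\<in>K. R x (chart_jet c f x)"
  have "continuous_on (K \<times> UNIV) (\<lambda>(x, j, j' :: (real^'k) \<times> (real^'n^'k)). R x j)"
  proof -
    have "continuous_on (K \<times> UNIV) (\<lambda>z. (\<lambda>(x, j). R x j) (fst z, fst (snd z) :: (real^'k) \<times> (real^'n^'k)))"
      by (rule continuous_on_compose2[OF R]) (auto intro!: continuous_intros)
    then show ?thesis by (simp add: split_beta)
  qed
  then have "?\<Phi> \<in> borel_measurable (borel_C1 A)"
    by (intro borel_measurable_continuous_map continuous_map_SUP_jet[OF c K x0])
  then have "{f \<in> space (borel_C1 A). 0 \<le> ?\<Phi> f} \<in> sets (borel_C1 A)" by measurable
  also have "{f \<in> space (borel_C1 A). 0 \<le> ?\<Phi> f} = {f \<in> C1_maps A. \<exists>x\<in>K. 0 \<le> R x (chart_jet c f x)}"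
  proof (rule Collect_cong, rule conj_cong)
    fix f :: "'m \<Rightarrow> real^'k" assume f: "f \<in> C1_maps A"
    have "continuous_on K (\<lambda>x. (\<lambda>(x, j). R x j) (x, chart_jet c f x))"
      by (rule continuous_on_compose2[OF R])
        (auto intro!: continuous_intros continuous_on_subset[OF continuous_on_chart_jet[OF f c] K(2)])
    then have cont: "continuous_on K (\<lambda>x. R x (chart_jet c f x))" by simp
    then obtain x where x: "x \<in> K" "\<And>y. y \<in> K \<Longrightarrow> R y (chart_jet c f y) \<le> R x (chart_jet c f x)"
      using continuous_attains_sup[OF K(1) False] by blast
    have "?\<Phi> f = R x (chart_jet c f x)"
      using x by (intro cSup_eq_maximum) auto
    then show "(0 \<le> ?\<Phi> f) = (\<exists>x\<in>K. 0 \<le> R x (chart_jet c f x))"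
      using x by (auto intro: order_trans)
  qed simp
  finally show ?thesis .
qed simp

end

section \<open>Regular maps and their zero sets\<close>

lemma continuous_on_matrix_mult:
  fixes f :: "'x::topological_space \<Rightarrow> real^'b::finite^'a::finite" and h :: "'x \<Rightarrow> real^'c::finite^'b"
  assumes "continuous_on S f" "continuous_on S h"
  shows "continuous_on S (\<lambda>x. f x ** h x)"
  unfolding matrix_matrix_mult_def
  by (intro continuous_on_vec_lambda2 continuous_intros assms)

lemma continuous_on_matrix_inv:
  fixes G :: "'x::topological_space \<Rightarrow> real^'n::finite^'n"
  assumes "\<And>x. x \<in> S \<Longrightarrow> det (G x) \<noteq> 0" "continuous_on S G"
  shows "continuous_on S (\<lambda>x. matrix_inv (G x))"
proof -
  have eq: "matrix_inv (G x) = (\<chi> i j. covector_inner (G x) (axis i 1) (axis j 1))" for x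
    by (simp add: vec_eq_iff covector_inner_def inner_axis' matrix_vector_mult_basis column_def)
  show ?thesis
    unfolding eq by (intro continuous_on_vec_lambda2 continuous_on_covector_inner assms continuous_on_const)
qed

lemma C_on_1I:
  fixes f :: "real^'a::finite \<Rightarrow> real^'b::finite"
  assumes d: "\<And>x. x \<in> S \<Longrightarrow> (f has_derivative (*v) (M x)) (at x)" and M: "continuous_on S M"
  shows "C_on 1 S f"
  unfolding C_on_1
proof (intro conjI ballI allI)
  fix x assume "x \<in> S"
  then show "f differentiable at x" using d unfolding differentiable_def by blast
next
  fix v
  have "continuous_on S (\<lambda>x. M x *v v)"
    unfolding matrix_vector_mult_def
    by (intro continuous_on_vec_lambda continuous_intros M)
  moreover have "frechet_derivative f (at x) v = M x *v v" if "x \<in> S" for x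
    using frechet_derivative_at[OF d[OF that]] by simp
  ultimately show "continuous_on S (\<lambda>x. frechet_derivative f (at x) v)"
    by (simp cong: continuous_on_cong)
qed

lemma matrix_inv_inverse:
  fixes X :: "real^'n::finite^'n"
  assumes "bij ((*v) X)"
  shows "det X \<noteq> 0" "inv ((*v) X) = (*v) (matrix_inv X)"
proof -
  have "invertible X"
    using assms by (simp add: invertible_right_inverse matrix_right_invertible_surjective bij_is_surj)
  then show det: "det X \<noteq> 0" by (simp add: invertible_det_nz)
  show "inv ((*v) X) = (*v) (matrix_inv X)"
  proof (rule ext, rule inv_f_eq[OF bij_is_inj[OF assms]])
    fix y show "X *v (matrix_inv X *v y) = y"
      by (simp add: matrix_vector_mul_assoc matrix_inv_mult[OF det])
  qed
qed

text \<open>With a right inverse \<open>R\<close> of the derivative \<open>D\<close> at \<open>x0\<close>, the map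
  \<open>x - R D x + R F x\<close> has identity derivative at \<open>x0\<close> and satisfies \<open>D \<circ> \<psi> = F\<close>, so it
  straightens the zero set of \<open>F\<close> to the kernel of \<open>D\<close>.\<close>

lemma straighten:
  fixes F :: "real^'n::finite \<Rightarrow> real^'k::finite"
  assumes U: "open U" and d: "\<And>x. x \<in> U \<Longrightarrow> (F has_derivative (*v) (DF x)) (at x)"
    and DF: "continuous_on U DF" and x0: "x0 \<in> U" and surj: "surj ((*v) (DF x0))"
  obtains R :: "real^'k^'n" and U' V \<psi> g \<psi>' where
    "DF x0 ** R = mat 1" "open U'" "U' \<subseteq> U" "x0 \<in> U'" "open V" "homeomorphism U' V \<psi> g"
    "\<And>x. DF x0 *v \<psi> x = F x" "\<And>x. x \<in> U \<Longrightarrow> (\<psi> has_derivative (*v) (\<psi>' x)) (at x)"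
    "continuous_on U \<psi>'" "\<psi>' x0 = mat 1" "\<And>y. y \<in> V \<Longrightarrow> det (\<psi>' (g y)) \<noteq> 0"
    "\<And>y. y \<in> V \<Longrightarrow> (g has_derivative (*v) (matrix_inv (\<psi>' (g y)))) (at y)"
proof -
  let ?D = "DF x0"
  obtain R :: "real^'k^'n" where R: "?D ** R = mat 1"
    using surj matrix_right_invertible_surjective[of ?D] by blast
  define \<psi> where "\<psi> x = x - R *v (?D *v x) + R *v F x" for x
  define \<psi>' where "\<psi>' x = mat 1 - R ** ?D + R ** DF x" for x
  have Dpsi: "?D *v \<psi> x = F x" for x
  proof -
    have "?D *v \<psi> x = ?D *v x - (?D ** R) *v (?D *v x) + (?D ** R) *v F x"
      unfolding \<psi>_def matrix_vector_right_distrib matrix_vector_mult_diff_distrib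
      by (simp only: matrix_vector_mul_assoc matrix_mul_assoc)
    then show ?thesis by (simp add: R)
  qed
  have bl: "bounded_linear ((*v) X)" for X :: "real^'a::finite^'b::finite"
    by (rule matrix_vector_mul_bounded_linear)
  have der: "(\<psi> has_derivative (*v) (\<psi>' x)) (at x)" if x: "x \<in> U" for x
  proof -
    have "(\<psi> has_derivative (\<lambda>v. v - R *v (?D *v v) + R *v (DF x *v v))) (at x)"
      unfolding \<psi>_def[abs_def]
      by (intro has_derivative_add has_derivative_diff has_derivative_ident
          bounded_linear.has_derivative[OF bl] d[OF x])
    moreover have "(\<lambda>v. v - R *v (?D *v v) + R *v (DF x *v v)) = (*v) (\<psi>' x)"
      by (rule ext) (simp add: \<psi>'_def matrix_vector_mult_add_rdistrib matrix_vector_mult_diff_rdistrib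
          matrix_vector_mul_assoc)
    ultimately show ?thesis by simp
  qed
  have cont: "continuous_on U \<psi>'"
    unfolding \<psi>'_def[abs_def] by (intro continuous_intros continuous_on_matrix_mult DF)
  have id: "\<psi>' x0 = mat 1" by (simp add: \<psi>'_def)
  define L where "L x = Blinfun ((*v) (\<psi>' x))" for x
  have L: "blinfun_apply (L x) = (*v) (\<psi>' x)" for x
    by (simp add: L_def bounded_linear_Blinfun_apply bl)
  have contL: "continuous_on U L"
  proof (rule continuous_on_blinfun_componentwise)
    fix i :: "real^'n"
    show "continuous_on U (\<lambda>x. blinfun_apply (L x) i)"
      unfolding L matrix_vector_mult_def
      by (intro continuous_on_vec_lambda continuous_intros cont)
  qed
  have invL: "id_blinfun o\<^sub>L L x0 = id_blinfun"
    by (rule blinfun_eqI) (simp add: L id)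
  obtain U' V g g' where *: "open U'" "U' \<subseteq> U" "x0 \<in> U'" "open V" "homeomorphism U' V \<psi> g"
    and g': "\<And>y. y \<in> V \<Longrightarrow> (g has_derivative (g' y)) (at y)"
      "\<And>y. y \<in> V \<Longrightarrow> g' y = inv (blinfun_apply (L (g y)))"
      "\<And>y. y \<in> V \<Longrightarrow> bij (blinfun_apply (L (g y)))"
    using inverse_function_theorem[OF U _ contL x0 invL, of \<psi>] der L by metis
  have "det (\<psi>' (g y)) \<noteq> 0" "(g has_derivative (*v) (matrix_inv (\<psi>' (g y)))) (at y)" if y: "y \<in> V" for y
    using matrix_inv_inverse[of "\<psi>' (g y)"] g'[OF y] unfolding L by auto
  then show ?thesis using that[OF R * Dpsi der cont id] by blast
qed

text \<open>The kernel is the orthogonal complement of the row space, whose dimension is the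
  rank.\<close>

lemma dim_kernel_surj:
  fixes D :: "real^'n::finite^'k::finite"
  assumes "surj ((*v) D)"
  shows "dim {v. D *v v = 0} = CARD('n) - CARD('k)"
proof -
  have "{v. D *v v = 0} = {v \<in> UNIV. \<forall>r\<in>span (rows D). orthogonal r v}"
  proof -
    have "D *v v = 0 \<longleftrightarrow> (\<forall>i. D $ i \<bullet> v = 0)" for v
      by (simp add: vec_eq_iff matrix_vector_mul_component)
    then have "{v. D *v v = 0} = {v \<in> UNIV. \<forall>r\<in>rows D. orthogonal r v}"
      by (auto simp: rows_def orthogonal_def row_def vec_lambda_eta)
    also have "\<dots> = {v \<in> UNIV. \<forall>r\<in>span (rows D). orthogonal r v}"
      using orthogonal_to_span[of _ "rows D"] by (auto simp: orthogonal_commute span_base) (metis orthogonal_commute)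
    finally show ?thesis .
  qed
  moreover have "dim {v \<in> UNIV. \<forall>r\<in>span (rows D). orthogonal r v} + dim (span (rows D)) = dim (UNIV :: (real^'n) set)"
    by (rule dim_subspace_orthogonal_to_vectors) (auto simp: subspace_span)
  moreover have "dim (span (rows D)) = CARD('k)"
  proof -
    have "dim (span (rows D)) = rank D" by (simp add: row_rank_def)
    also have "\<dots> = dim (range ((*v) D))" by (rule rank_dim_range)
    finally show ?thesis using assms by simp
  qed
  ultimately show ?thesis by simp
qed

context
  fixes A :: "('m::{t2_space,second_countable_topology}, 'n::finite) chart set"
  assumes A: "smooth_atlas A"
begin

lemma regular_surj:
  fixes f :: "'m \<Rightarrow> real^'k::finite"
  assumes f: "f \<in> regular_maps A" and c: "c \<in> A" "p \<in> fst c" and p: "f p = 0"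
  shows "surj ((*v) (chart_differential c f (snd c p)))"
  using f p surj_chart_differential[OF A _ c, of f] by (auto simp: regular_maps_def zero_set_def)

lemma continuous_on_transition:
  assumes "c \<in> A" "c' \<in> A"
  shows "continuous_on (snd c ` (fst c \<inter> fst c')) (transition c c')"
proof -
  have "C_on 1 (snd c ` (fst c \<inter> fst c')) (snd c' \<circ> chart_inv c)"
    using A assms unfolding smooth_atlas_def smooth_on_def by blast
  then have "continuous_on (snd c ` (fst c \<inter> fst c')) (\<lambda>x. frechet_derivative (snd c' \<circ> chart_inv c) (at x) v)" for v
    unfolding C_on_1 by blast
  then have "continuous_on (snd c ` (fst c \<inter> fst c')) (\<lambda>x. \<chi> i j. frechet_derivative (snd c' \<circ> chart_inv c) (at x) (axis j 1) $ i)"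
    by (intro continuous_on_vec_lambda continuous_on_component)
  then show ?thesis by (simp add: transition_def[abs_def] matrix_def)
qed

text \<open>The hypothesis on the laws concerns families of submanifolds, so zero sets must be shown
  to be such. Near a zero, a chart is followed by the map from \<open>straighten\<close>, which
  carries the zero set to the kernel of the differential at that zero.\<close>

lemma zero_set_C1_submanifold:
  fixes f :: "'m \<Rightarrow> real^'k::finite"
  assumes f: "f \<in> regular_maps A"
  shows "C1_submanifold A (zero_set f)"
  unfolding C1_submanifold_def
proof (intro exI[of _ "CARD('n) - CARD('k)"] ballI)
  fix p assume "p \<in> zero_set f"
  then have p: "f p = 0" by (simp add: zero_set_def)
  have fC: "f \<in> C1_maps A" using f by (simp add: regular_maps_def)
  define c where "c = chart_at A p"
  have c: "c \<in> A" "p \<in> fst c" unfolding c_def by (rule chart_at_in[OF A])+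
  let ?U = "snd c ` fst c" and ?F = "f \<circ> chart_inv c" and ?DF = "chart_differential c f" and ?x0 = "snd c p"
  have x0: "?x0 \<in> ?U" using c by blast
  obtain R :: "real^'k^'n" and U' V \<psi> g \<psi>' where
    R: "?DF ?x0 ** R = mat 1" and U': "open U'" "U' \<subseteq> ?U" "?x0 \<in> U'" and V: "open V" and hom: "homeomorphism U' V \<psi> g"
    and Dpsi: "\<And>x. ?DF ?x0 *v \<psi> x = ?F x" and der: "\<And>x. x \<in> ?U \<Longrightarrow> (\<psi> has_derivative (*v) (\<psi>' x)) (at x)"
    and cont: "continuous_on ?U \<psi>'" and id: "\<psi>' ?x0 = mat 1" and det: "\<And>y. y \<in> V \<Longrightarrow> det (\<psi>' (g y)) \<noteq> 0"
    and derg: "\<And>y. y \<in> V \<Longrightarrow> (g has_derivative (*v) (matrix_inv (\<psi>' (g y)))) (at y)"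
    by (rule straighten[of ?U ?F ?DF ?x0, OF open_chart_image[OF A c(1)] chart_has_derivative[OF A fC c(1)]
        continuous_on_chart_differential[OF A fC c(1)] x0 regular_surj[OF f c p]], assumption) (rule that)
  note inv_l = chart_inv_left[OF A c(1)]
  define U1 where "U1 = fst c \<inter> snd c -` U'"
  define c1 where "c1 = (U1, \<psi> \<circ> snd c)"
  have c1 [simp]: "fst c1 = U1" "snd c1 = \<psi> \<circ> snd c" by (simp_all add: c1_def)
  have U1_sub: "U1 \<subseteq> fst c" by (auto simp: U1_def)
  have openU1: "open U1"
    unfolding U1_def using continuous_on_open_vimage[OF open_chart_domain[OF A c(1)]]
      continuous_on_chart[OF A c(1)] U'(1) by (metis inf.commute)
  have sU1: "snd c ` U1 = U'" using U'(2) by (auto simp: U1_def)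
  have psi_g: "\<psi> (g y) = y" "g y \<in> U'" if "y \<in> V" for y using hom that by (auto simp: homeomorphism_def)
  have g_psi: "g (\<psi> x) = x" "\<psi> x \<in> V" if "x \<in> U'" for x using hom that by (auto simp: homeomorphism_def)
  have im: "snd c1 ` fst c1 = V"
  proof -
    have "snd c1 ` fst c1 = \<psi> ` (snd c ` U1)" by (simp add: image_comp)
    also have "\<dots> = V" unfolding sU1 using hom by (simp add: homeomorphism_def)
    finally show ?thesis .
  qed
  have inj1: "inj_on (snd c1) (fst c1)"
    by (rule inj_on_inverseI[where g = "chart_inv c \<circ> g"]) (auto simp: U1_def g_psi inv_l)
  have inv1: "chart_inv c1 y = chart_inv c (g y)" if "y \<in> V" for y
  proof -
    have "chart_inv c (g y) \<in> U1" "snd c (chart_inv c (g y)) = g y"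
      using psi_g[OF that] U'(2) inv_l by (auto simp: U1_def)
    then show ?thesis
      unfolding chart_inv_def by (intro inv_into_f_eq[OF inj1]) (auto simp: psi_g[OF that])
  qed
  have inv1_in: "chart_inv c1 y \<in> U1" if "y \<in> V" for y
    using that im inv_into_into unfolding chart_inv_def by (metis c1(1))
  have contpsi: "continuous_on U' \<psi>" and contg: "continuous_on V g" using hom by (auto simp: homeomorphism_def)
  have "homeomorphism U1 V (snd c1) (chart_inv c1)"
  proof (rule homeomorphismI)
    show "continuous_on U1 (snd c1)"
      unfolding c1 by (rule continuous_on_compose)
        (use continuous_on_chart[OF A c(1)] U1_sub sU1 contpsi in \<open>auto intro: continuous_on_subset\<close>)
    have "continuous_on V (chart_inv c \<circ> g)"
      by (rule continuous_on_compose[OF contg continuous_on_subset[OF continuous_on_chart_inv[OF A c(1)]]])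
        (use psi_g U'(2) in blast)
    then show "continuous_on V (chart_inv c1)" by (rule continuous_on_eq) (simp add: inv1)
    show "snd c1 ` U1 \<subseteq> V" using im by simp
    show "chart_inv c1 ` V \<subseteq> U1" using inv1_in by blast
    show "chart_inv c1 (snd c1 x) = x" if "x \<in> U1" for x
      using that inv_into_f_f[OF inj1, of x] by (simp add: chart_inv_def)
    show "snd c1 (chart_inv c1 y) = y" if "y \<in> V" for y
      using that im unfolding chart_inv_def by (metis f_inv_into_f)
  qed
  then have top: "top_chart c1"
    unfolding top_chart_def im using openU1 V by simp
  have "C1_chart A c1"
    unfolding C1_chart_def
  proof (intro conjI ballI top)
    fix c' assume c': "c' \<in> A"
    let ?T = "transition c c'" and ?T' = "transition c' c"
    show "C_on 1 (snd c1 ` (fst c1 \<inter> fst c')) (snd c' \<circ> chart_inv c1)"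
    proof (rule C_on_1I[where M = "\<lambda>y. ?T (g y) ** matrix_inv (\<psi>' (g y))"])
      have sub: "snd c1 ` (fst c1 \<inter> fst c') \<subseteq> V" using im by blast
      have gy: "g y \<in> snd c ` (fst c \<inter> fst c')" if "y \<in> snd c1 ` (fst c1 \<inter> fst c')" for y
        using that by (auto simp: U1_def g_psi)
      show "continuous_on (snd c1 ` (fst c1 \<inter> fst c')) (\<lambda>y. ?T (g y) ** matrix_inv (\<psi>' (g y)))"
      proof (intro continuous_on_matrix_mult continuous_on_matrix_inv)
        have cg: "continuous_on (snd c1 ` (fst c1 \<inter> fst c')) g"
          by (rule continuous_on_subset[OF contg sub])
        show "continuous_on (snd c1 ` (fst c1 \<inter> fst c')) (\<lambda>y. ?T (g y))"
          by (rule continuous_on_compose2[OF continuous_on_transition[OF c(1) c'] cg]) (use gy in blast)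
        show "continuous_on (snd c1 ` (fst c1 \<inter> fst c')) (\<lambda>y. \<psi>' (g y))"
          by (rule continuous_on_compose2[OF cont cg]) (use gy in blast)
        show "det (\<psi>' (g y)) \<noteq> 0" if "y \<in> snd c1 ` (fst c1 \<inter> fst c')" for y
          using that sub by (intro det) blast
      qed
      fix y assume y: "y \<in> snd c1 ` (fst c1 \<inter> fst c')"
      then have yV: "y \<in> V" using sub by blast
      obtain q where q: "q \<in> fst c" "q \<in> fst c'" "g y = snd c q" using gy[OF y] by blast
      have 1: "(snd c' \<circ> chart_inv c has_derivative (*v) (?T (g y))) (at (g y))"
        unfolding q(3) by (rule transition_has_derivative[OF A c(1) c' q(1,2)])
      have "((snd c' \<circ> chart_inv c) \<circ> g has_derivative (*v) (?T (g y)) \<circ> (*v) (matrix_inv (\<psi>' (g y)))) (at y)"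
        by (rule diff_chain_at[OF derg[OF yV] 1])
      moreover have "(*v) (?T (g y)) \<circ> (*v) (matrix_inv (\<psi>' (g y))) = (*v) (?T (g y) ** matrix_inv (\<psi>' (g y)))"
        by (rule ext) (simp add: matrix_vector_mul_assoc)
      ultimately have "((snd c' \<circ> chart_inv c) \<circ> g has_derivative (*v) (?T (g y) ** matrix_inv (\<psi>' (g y)))) (at y)"
        by simp
      then show "(snd c' \<circ> chart_inv c1 has_derivative (*v) (?T (g y) ** matrix_inv (\<psi>' (g y)))) (at y)"
        by (rule has_derivative_transform_within_open[OF _ V yV]) (simp add: inv1)
    qed
    show "C_on 1 (snd c' ` (fst c1 \<inter> fst c')) (snd c1 \<circ> chart_inv c')"
    proof (rule C_on_1I[where M = "\<lambda>x. \<psi>' (snd c (chart_inv c' x)) ** ?T' x"])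
      have sub: "snd c' ` (fst c1 \<inter> fst c') \<subseteq> snd c' ` (fst c' \<inter> fst c)" using U1_sub by auto
      show "continuous_on (snd c' ` (fst c1 \<inter> fst c')) (\<lambda>x. \<psi>' (snd c (chart_inv c' x)) ** ?T' x)"
      proof (rule continuous_on_matrix_mult)
        show "continuous_on (snd c' ` (fst c1 \<inter> fst c')) ?T'"
          by (rule continuous_on_subset[OF continuous_on_transition[OF c' c(1)] sub])
        have ci: "continuous_on (snd c' ` (fst c1 \<inter> fst c')) (chart_inv c')"
          by (rule continuous_on_subset[OF continuous_on_chart_inv[OF A c']]) auto
        have "continuous_on (snd c' ` (fst c1 \<inter> fst c')) (\<lambda>x. snd c (chart_inv c' x))"
          by (rule continuous_on_compose2[OF continuous_on_chart[OF A c(1)] ci])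
            (use U1_sub in \<open>auto simp: chart_inv_left[OF A c']\<close>)
        then show "continuous_on (snd c' ` (fst c1 \<inter> fst c')) (\<lambda>x. \<psi>' (snd c (chart_inv c' x)))"
          by (rule continuous_on_compose2[OF cont]) (use U1_sub in \<open>auto simp: chart_inv_left[OF A c']\<close>)
      qed
      fix x assume "x \<in> snd c' ` (fst c1 \<inter> fst c')"
      then obtain q where q: "q \<in> U1" "q \<in> fst c'" "x = snd c' q" by auto
      have qc: "q \<in> fst c" using q U1_sub by blast
      have ix: "chart_inv c' x = q" using q by (simp add: chart_inv_left[OF A c'])
      have 1: "(snd c \<circ> chart_inv c' has_derivative (*v) (?T' x)) (at x)"
        unfolding q(3) by (rule transition_has_derivative[OF A c' c(1) q(2) qc])
      have "(\<psi> has_derivative (*v) (\<psi>' (snd c q))) (at ((snd c \<circ> chart_inv c') x))"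
        using der[of "snd c q"] qc by (simp add: ix)
      from diff_chain_at[OF 1 this]
      have "(\<psi> \<circ> (snd c \<circ> chart_inv c') has_derivative (*v) (\<psi>' (snd c q)) \<circ> (*v) (?T' x)) (at x)" .
      moreover have "(*v) (\<psi>' (snd c q)) \<circ> (*v) (?T' x) = (*v) (\<psi>' (snd c (chart_inv c' x)) ** ?T' x)"
        by (rule ext) (simp add: matrix_vector_mul_assoc ix)
      ultimately show "(snd c1 \<circ> chart_inv c' has_derivative (*v) (\<psi>' (snd c (chart_inv c' x)) ** ?T' x)) (at x)"
        by (simp add: o_assoc)
    qed
  qed
  moreover have "p \<in> fst c1" using c(2) U'(3) by (simp add: U1_def)
  moreover have "subspace {v. ?DF ?x0 *v v = 0}"
    by (auto simp: subspace_def matrix_vector_right_distrib matrix_vector_mult_scaleR)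
  moreover have "dim {v. ?DF ?x0 *v v = 0} = CARD('n) - CARD('k)"
    by (rule dim_kernel_surj[OF regular_surj[OF f c p]])
  moreover have "snd c1 ` (zero_set f \<inter> fst c1) = snd c1 ` fst c1 \<inter> {v. ?DF ?x0 *v v = 0}"
  proof -
    have "?DF ?x0 *v snd c1 q = f q" if "q \<in> fst c1" for q
      using that by (simp add: Dpsi U1_def inv_l)
    then show ?thesis by (auto simp: zero_set_def)
  qed
  ultimately show "\<exists>c L. C1_chart A c \<and> p \<in> fst c \<and> subspace L \<and> dim L = CARD('n) - CARD('k) \<and>
        snd c ` (zero_set f \<inter> fst c) = snd c ` fst c \<inter> L"
    by blast
qed

text \<open>A vector tangent to the common zero set is killed by both differentials. The kernel of
  one is thus contained in the kernel of the other, and the differential of \<open>h\<close> factors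
  through that of \<open>f\<close>.\<close>

lemma same_zero_set_differential:
  fixes f h :: "'m \<Rightarrow> real^'k::finite"
  assumes f: "f \<in> regular_maps A" and h: "h \<in> regular_maps A" and z: "zero_set f = zero_set h"
    and c: "c \<in> A" "p \<in> fst c" and p: "f p = 0"
  obtains M where "det M \<noteq> 0" "chart_differential c h (snd c p) = M ** chart_differential c f (snd c p)"
proof -
  have fC: "f \<in> C1_maps A" and hC: "h \<in> C1_maps A" using f h by (simp_all add: regular_maps_def)
  have hp: "h p = 0" using p z by (auto simp: zero_set_def)
  let ?U = "snd c ` fst c" and ?F = "f \<circ> chart_inv c" and ?DF = "chart_differential c f" and ?x0 = "snd c p"
  let ?DH = "chart_differential c h"
  have x0: "?x0 \<in> ?U" using c by blast
  obtain R :: "real^'k^'n" and U' V \<psi> g \<psi>' where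
    R: "?DF ?x0 ** R = mat 1" and U': "open U'" "U' \<subseteq> ?U" "?x0 \<in> U'" and V: "open V" and hom: "homeomorphism U' V \<psi> g"
    and Dpsi: "\<And>x. ?DF ?x0 *v \<psi> x = ?F x" and der: "\<And>x. x \<in> ?U \<Longrightarrow> (\<psi> has_derivative (*v) (\<psi>' x)) (at x)"
    and cont: "continuous_on ?U \<psi>'" and id: "\<psi>' ?x0 = mat 1" and det: "\<And>y. y \<in> V \<Longrightarrow> det (\<psi>' (g y)) \<noteq> 0"
    and derg: "\<And>y. y \<in> V \<Longrightarrow> (g has_derivative (*v) (matrix_inv (\<psi>' (g y)))) (at y)"
    by (rule straighten[of ?U ?F ?DF ?x0, OF open_chart_image[OF A c(1)] chart_has_derivative[OF A fC c(1)]
        continuous_on_chart_differential[OF A fC c(1)] x0 regular_surj[OF f c p]], assumption) (rule that)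
  have psi_g: "\<psi> (g y) = y" "g y \<in> U'" if "y \<in> V" for y using hom that by (auto simp: homeomorphism_def)
  have g_psi: "g (\<psi> ?x0) = ?x0" "\<psi> ?x0 \<in> V" using hom U'(3) by (auto simp: homeomorphism_def)
  have ker: "?DH ?x0 *v v = 0" if v: "?DF ?x0 *v v = 0" for v
  proof -
    \<comment> \<open>In straightened coordinates this line stays in the kernel, so near
      \<open>t = 0\<close> its image under \<open>g\<close> is a curve of zeros of \<open>f\<close>,
      hence of \<open>h\<close>, with velocity \<open>v\<close> at 0.\<close>
    define y where "y t = \<psi> ?x0 + t *\<^sub>R v" for t :: real
    have yd: "(y has_derivative (\<lambda>t. t *\<^sub>R v)) (at 0)"
      unfolding y_def[abs_def] by (auto intro!: derivative_eq_intros)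
    have m1: "matrix_inv (mat 1 :: real^'n^'n) = mat 1"
      using matrix_inv_mult(1)[of "mat 1 :: real^'n^'n"] by simp
    have gd: "(g has_derivative (\<lambda>v. v)) (at (y 0))"
    proof -
      have "(*v) (mat 1 :: real^'n^'n) = (\<lambda>v. v)" by (rule ext) simp
      then show ?thesis using derg[OF g_psi(2)] by (simp add: y_def g_psi id m1)
    qed
    have hd: "(h \<circ> chart_inv c has_derivative (*v) (?DH ?x0)) (at ((g \<circ> y) 0))"
      using chart_has_derivative[OF A hC c(1) x0] by (simp add: y_def g_psi)
    have "(g \<circ> y has_derivative (\<lambda>v. v) \<circ> (\<lambda>t. t *\<^sub>R v)) (at 0)"
      by (rule diff_chain_at[OF yd gd])
    from diff_chain_at[OF this hd]
    have 1: "((h \<circ> chart_inv c) \<circ> (g \<circ> y) has_derivative (*v) (?DH ?x0) \<circ> ((\<lambda>v. v) \<circ> (\<lambda>t. t *\<^sub>R v))) (at 0)" .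
    have "open (y -` V)"
      unfolding y_def[abs_def] by (intro open_vimage V continuous_intros)
    moreover have "0 \<in> y -` V" using g_psi by (simp add: y_def)
    moreover have "((h \<circ> chart_inv c) \<circ> (g \<circ> y)) t = 0" if "t \<in> y -` V" for t
    proof -
      have yV: "y t \<in> V" using that by simp
      have "?F (g (y t)) = ?DF ?x0 *v \<psi> (g (y t))" by (simp only: Dpsi)
      also have "\<dots> = ?DF ?x0 *v \<psi> ?x0 + t *\<^sub>R (?DF ?x0 *v v)"
        by (simp add: psi_g[OF yV]) (simp add: y_def matrix_vector_right_distrib matrix_vector_mult_scaleR)
      also have "\<dots> = 0" unfolding Dpsi using c p by (simp add: v chart_inv_left[OF A])
      finally have "chart_inv c (g (y t)) \<in> zero_set f" by (simp add: zero_set_def)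
      then have "chart_inv c (g (y t)) \<in> zero_set h" by (simp only: z)
      then show ?thesis by (simp add: zero_set_def)
    qed
    ultimately have "((\<lambda>t. 0) has_derivative (*v) (?DH ?x0) \<circ> ((\<lambda>v. v) \<circ> (\<lambda>t. t *\<^sub>R v))) (at 0)"
      by (rule has_derivative_transform_within_open[OF 1])
    then have "(*v) (?DH ?x0) \<circ> ((\<lambda>v. v) \<circ> (\<lambda>t::real. t *\<^sub>R v)) = (\<lambda>t. 0)"
      by (rule has_derivative_unique) (rule has_derivative_const)
    from fun_cong[OF this, of 1] show ?thesis by simp
  qed
  \<comment> \<open>For \<open>D\<close> the differential of \<open>f\<close>, the vector
    \<open>v - R *v (D *v v)\<close> lies in the kernel of \<open>D\<close>, so the differential of
    \<open>h\<close> agrees on \<open>v\<close> and on \<open>R *v (D *v v)\<close>.\<close>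
  define M where "M = ?DH ?x0 ** R"
  have eq: "?DH ?x0 = M ** ?DF ?x0"
  proof -
    have "?DH ?x0 *v v = (M ** ?DF ?x0) *v v" for v
    proof -
      have "?DF ?x0 *v (v - R *v (?DF ?x0 *v v)) = ?DF ?x0 *v v - (?DF ?x0 ** R) *v (?DF ?x0 *v v)"
        by (simp only: matrix_vector_mult_diff_distrib matrix_vector_mul_assoc matrix_mul_assoc)
      then have "?DF ?x0 *v (v - R *v (?DF ?x0 *v v)) = 0" by (simp add: R)
      from ker[OF this] have "?DH ?x0 *v v = ?DH ?x0 *v (R *v (?DF ?x0 *v v))"
        by (simp only: matrix_vector_mult_diff_distrib right_minus_eq)
      then show ?thesis by (simp only: M_def matrix_vector_mul_assoc matrix_mul_assoc)
    qed
    then show ?thesis by (simp add: matrix_eq)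
  qed
  have sH: "surj ((*v) (?DH ?x0))" by (rule regular_surj[OF h c hp])
  have "surj ((*v) M)"
    unfolding surj_def
  proof
    fix y
    obtain x where "y = ?DH ?x0 *v x" using surjD[OF sH] by blast
    then have "y = M *v (?DF ?x0 *v x)" unfolding eq by (simp only: matrix_vector_mul_assoc)
    then show "\<exists>x. y = M *v x" by blast
  qed
  then have "det M \<noteq> 0"
    by (simp add: invertible_det_nz[symmetric] invertible_right_inverse matrix_right_invertible_surjective)
  then show ?thesis using that eq by blast
qed

end

section \<open>Measurability and conditioning\<close>

text \<open>The point \<open>y\<close> is rounded down to a grid of mesh 1/(n+1). The rounding takes
  countably many values, so the rounded function is jointly measurable, and continuity in
  \<open>y\<close> gives convergence.\<close>

lemma borel_measurable_caratheodory:
  fixes F :: "real^'k::finite \<Rightarrow> 'a \<Rightarrow> real"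
  assumes cont: "\<And>w. w \<in> space M \<Longrightarrow> continuous_on UNIV (\<lambda>y. F y w)"
    and meas: "\<And>y. F y \<in> borel_measurable M"
  shows "(\<lambda>z. F (fst z) (snd z)) \<in> borel_measurable (borel \<Otimes>\<^sub>M M)"
proof -
  define fl where "fl n y = (\<lambda>i. \<lfloor>real (Suc n) * y $ i\<rfloor>)" for n and y :: "real^'k"
  define r where "r n t = (\<chi> i. real_of_int (t i) / real (Suc n))" for n and t :: "'k \<Rightarrow> int"
  have lim: "(\<lambda>n. r n (fl n y)) \<longlonglongrightarrow> y" for y
  proof (rule vec_tendstoI)
    fix i
    have "\<bar>r n (fl n y) $ i - y $ i\<bar> \<le> 1 / real (Suc n)" for n
    proof -
      have "r n (fl n y) $ i - y $ i = (real_of_int \<lfloor>real (Suc n) * y $ i\<rfloor> - real (Suc n) * y $ i) / real (Suc n)"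
        by (simp add: r_def fl_def diff_divide_distrib del: of_nat_Suc)
      also have "\<bar>\<dots>\<bar> = \<bar>real_of_int \<lfloor>real (Suc n) * y $ i\<rfloor> - real (Suc n) * y $ i\<bar> / real (Suc n)"
        by (simp only: abs_divide abs_of_nat)
      also have "\<dots> \<le> 1 / real (Suc n)"
        by (rule divide_right_mono) linarith+
      finally show ?thesis .
    qed
    moreover have "(\<lambda>n. 1 / real (Suc n)) \<longlonglongrightarrow> 0"
      using LIMSEQ_inverse_real_of_nat by (simp add: inverse_eq_divide)
    ultimately have "(\<lambda>n. r n (fl n y) $ i - y $ i) \<longlonglongrightarrow> 0"
      by (intro Lim_null_comparison[of "\<lambda>n. r n (fl n y) $ i - y $ i" "\<lambda>n. 1 / real (Suc n)"]) auto
    then show "(\<lambda>n. r n (fl n y) $ i) \<longlonglongrightarrow> y $ i" by (simp only: LIM_zero_iff)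
  qed
  show ?thesis
  proof (rule borel_measurable_LIMSEQ_real)
    fix z assume z: "z \<in> space (borel \<Otimes>\<^sub>M M :: ((real^'k) \<times> 'a) measure)"
    then have "isCont (\<lambda>y. F y (snd z)) (fst z)"
      using cont[of "snd z"] by (auto simp: space_pair_measure continuous_on_eq_continuous_at)
    then show "(\<lambda>n. F (r n (fl n (fst z))) (snd z)) \<longlonglongrightarrow> F (fst z) (snd z)"
      using lim by (rule isCont_tendsto_compose)
  next
    fix n
    have fl: "(\<lambda>z. fl n (fst z)) \<in> measurable (borel \<Otimes>\<^sub>M M) (count_space (UNIV :: ('k \<Rightarrow> int) set))"
    proof (subst measurable_count_space_eq_countable)
      show "countable (UNIV :: ('k \<Rightarrow> int) set)" by simp
      show "(\<lambda>z. fl n (fst z)) \<in> space (borel \<Otimes>\<^sub>M M) \<rightarrow> UNIV \<and>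
        (\<forall>t\<in>UNIV. (\<lambda>z. fl n (fst z)) -` {t} \<inter> space (borel \<Otimes>\<^sub>M M) \<in> sets (borel \<Otimes>\<^sub>M M))"
      proof (intro conjI ballI)
        fix t
        have [measurable]: "(\<lambda>z. fst z $ i) \<in> borel_measurable ((borel :: (real^'k) measure) \<Otimes>\<^sub>M M)" for i
          by (rule measurable_compose[OF measurable_fst])
            (intro borel_measurable_continuous_onI continuous_intros)
        have "(\<lambda>z. fl n (fst z)) -` {t} \<inter> space (borel \<Otimes>\<^sub>M M)
          = {z \<in> space (borel \<Otimes>\<^sub>M M). \<forall>i. \<lfloor>real (Suc n) * fst z $ i\<rfloor> = t i}"
          by (auto simp: fl_def fun_eq_iff)
        also have "\<dots> \<in> sets (borel \<Otimes>\<^sub>M M)" by measurable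
        finally show "(\<lambda>z. fl n (fst z)) -` {t} \<inter> space (borel \<Otimes>\<^sub>M M) \<in> sets (borel \<Otimes>\<^sub>M M)" .
      qed simp
    qed
    show "(\<lambda>z. F (r n (fl n (fst z))) (snd z)) \<in> borel_measurable (borel \<Otimes>\<^sub>M M)"
      by (rule measurable_compose_countable'[OF _ fl, of "\<lambda>t z. F (r n t) (snd z)"])
        (auto intro!: measurable_compose[OF measurable_snd meas])
  qed
qed

context
  fixes A :: "('m::{t2_space,second_countable_topology}, 'n::finite) chart set"
  assumes A: "smooth_atlas A"
begin

lemma sets_C1_maps: "(C1_maps A :: ('m \<Rightarrow> real^'k::finite) set) \<in> sets (borel_C1 A)"
  using sets.top[of "borel_C1 A"] by (simp add: space_borel_C1[OF A])

text \<open>The complement is a countable union of sets of the kind in \<open>sets_ex_jet\<close>: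
  some point of a closed coordinate ball is a zero with degenerate differential.\<close>

lemma sets_regular_maps: "(regular_maps A :: ('m \<Rightarrow> real^'k::finite) set) \<in> sets (borel_C1 A)"
proof -
  \<comment> \<open>The open balls serve for the Lindelof covering; their closures must stay in the
    chart because the existence statement is applied to compact sets.\<close>
  define \<F> where "\<F> = {chart_inv c ` ball x r | c x r. c \<in> A \<and> cball x r \<subseteq> snd c ` fst c}"
  have img: "chart_inv c ` ball x r = fst c \<inter> snd c -` ball x r"
    if "c \<in> A" "cball x r \<subseteq> snd c ` fst c" for c x r
  proof -
    have "ball x r \<subseteq> snd c ` fst c" using that(2) ball_subset_cball by blast
    then show ?thesis
      using chart_inv_left[OF A that(1)] chart_inv_in[OF A that(1)] chart_inv_right[OF A that(1)]
      by (auto simp: image_iff subset_iff) (metis mem_ball)+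
  qed
  have "open S" if SF: "S \<in> \<F>" for S
  proof -
    obtain c x r where S: "S = chart_inv c ` ball x r" "c \<in> A" "cball x r \<subseteq> snd c ` fst c"
      using SF unfolding \<F>_def by blast
    show ?thesis
      unfolding S(1) img[OF S(2,3)]
      using continuous_on_open_vimage[OF open_chart_domain[OF A S(2)]] continuous_on_chart[OF A S(2)]
      by (metis inf.commute open_ball)
  qed
  then obtain \<C> where \<C>: "\<C> \<subseteq> \<F>" "countable \<C>" "\<Union>\<C> = \<Union>\<F>"
    by (rule Lindelof)
  have cover: "\<Union>\<F> = UNIV"
  proof -
    have "p \<in> \<Union>\<F>" for p
    proof -
      let ?c = "chart_at A p"
      have c: "?c \<in> A" "p \<in> fst ?c" by (rule chart_at_in[OF A])+
      then obtain r where r: "r > 0" "cball (snd ?c p) r \<subseteq> snd ?c ` fst ?c"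
        using open_chart_image[OF A c(1)] open_contains_cball by blast
      have "p \<in> chart_inv ?c ` ball (snd ?c p) r"
        using r c chart_inv_left[OF A c] by (intro image_eqI[of _ _ "snd ?c p"]) auto
      moreover have "chart_inv ?c ` ball (snd ?c p) r \<in> \<F>"
        unfolding \<F>_def using c(1) r(2) by blast
      ultimately show ?thesis by blast
    qed
    then show ?thesis by blast
  qed
  have "\<forall>S\<in>\<C>. \<exists>c x r. S = chart_inv c ` ball x r \<and> c \<in> A \<and> cball x r \<subseteq> snd c ` fst c"
    using \<C>(1) unfolding \<F>_def by blast
  then obtain c x r where cxr: "\<And>S. S \<in> \<C> \<Longrightarrow> S = chart_inv (c S) ` ball (x S) (r S)"
    "\<And>S. S \<in> \<C> \<Longrightarrow> c S \<in> A" "\<And>S. S \<in> \<C> \<Longrightarrow> cball (x S) (r S) \<subseteq> snd (c S) ` fst (c S)"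
    by metis
  \<comment> \<open>Nonnegative exactly at jets with value 0 and degenerate derivative: the Gram
    Jacobian of the Euclidean metric is a continuous test of surjectivity.\<close>
  define R where "R j = - norm (fst j) - \<bar>gram_jac (mat 1) (snd j)\<bar>" for j :: "(real^'k) \<times> (real^'n^'k)"
  have pd: "pos_def_matrix (mat 1 :: real^'n^'n)" by (auto simp: pos_def_matrix_def)
  have R0: "0 \<le> R j \<longleftrightarrow> fst j = 0 \<and> \<not> surj ((*v) (snd j))" for j
  proof -
    have "0 \<le> R j \<longleftrightarrow> norm (fst j) + \<bar>gram_jac (mat 1) (snd j)\<bar> \<le> 0"
      unfolding R_def by linarith
    also have "\<dots> \<longleftrightarrow> norm (fst j) + \<bar>gram_jac (mat 1) (snd j)\<bar> = 0"
      using norm_ge_zero[of "fst j"] by linarith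
    also have "\<dots> \<longleftrightarrow> fst j = 0 \<and> gram_jac (mat 1) (snd j) = 0"
      by (subst add_nonneg_eq_0_iff) simp_all
    also have "gram_jac (mat 1) (snd j) = 0 \<longleftrightarrow> \<not> surj ((*v) (snd j))"
    proof
      show "\<not> surj ((*v) (snd j))" if "gram_jac (mat 1) (snd j) = 0"
        using gram_jac_pos[OF pd, of "snd j"] that by (metis less_irrefl)
    qed (rule gram_jac_not_surj)
    finally show ?thesis .
  qed
  have contR: "continuous_on UNIV R"
    unfolding R_def by (intro continuous_intros continuous_on_gram_jac pd)
  define B where "B S = {f \<in> C1_maps A. \<exists>y\<in>cball (x S) (r S). 0 \<le> R (chart_jet (c S) f y)}" for S
  have "B S \<in> sets (borel_C1 A)" if "S \<in> \<C>" for S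
    unfolding B_def
  proof (rule sets_ex_jet[OF A cxr(2)[OF that] compact_cball cxr(3)[OF that]])
    show "continuous_on (cball (x S) (r S) \<times> UNIV) (\<lambda>(x, j). R j)"
      unfolding split_beta by (rule continuous_on_compose2[OF contR]) (auto intro!: continuous_intros)
  qed
  then have "(\<Union>S\<in>\<C>. B S) \<in> sets (borel_C1 A)"
    using \<C>(2) by blast
  then have "C1_maps A - (\<Union>S\<in>\<C>. B S) \<in> sets (borel_C1 A)"
    using sets_C1_maps by blast
  also have "C1_maps A - (\<Union>S\<in>\<C>. B S) = (regular_maps A :: ('m \<Rightarrow> real^'k) set)"
  proof (intro set_eqI iffI)
    fix f :: "'m \<Rightarrow> real^'k" assume f: "f \<in> C1_maps A - (\<Union>S\<in>\<C>. B S)"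
    have "surj ((*v) (differential A f p))" if p: "f p = 0" for p
    proof -
      obtain S where S: "S \<in> \<C>" "p \<in> S" using \<C>(3) cover by blast
      obtain y where y: "y \<in> ball (x S) (r S)" "p = chart_inv (c S) y" using S(2) cxr(1)[OF S(1)] by blast
      have yc: "y \<in> snd (c S) ` fst (c S)" using y(1) cxr(3)[OF S(1)] by auto
      have "\<not> 0 \<le> R (chart_jet (c S) f y)" using f S(1) y(1) by (auto simp: B_def)
      then have "surj ((*v) (chart_differential (c S) f y))"
        using p y(2) by (simp add: R0 chart_jet_def)
      moreover have "y = snd (c S) p" unfolding y(2) using chart_inv_right[OF A cxr(2)[OF S(1)] yc] by simp
      moreover have "p \<in> fst (c S)" unfolding y(2) by (rule chart_inv_in[OF A cxr(2)[OF S(1)] yc])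
      ultimately show ?thesis
        using surj_chart_differential[OF A _ cxr(2)[OF S(1)], of f p] f by simp
    qed
    then show "f \<in> regular_maps A" using f by (auto simp: regular_maps_def zero_set_def)
  next
    fix f :: "'m \<Rightarrow> real^'k" assume f: "f \<in> regular_maps A"
    have "f \<notin> B S" if S: "S \<in> \<C>" for S
    proof
      assume "f \<in> B S"
      then obtain y where y: "y \<in> cball (x S) (r S)" "0 \<le> R (chart_jet (c S) f y)" by (auto simp: B_def)
      have yc: "y \<in> snd (c S) ` fst (c S)" using y(1) cxr(3)[OF S] by auto
      have "surj ((*v) (chart_differential (c S) f (snd (c S) (chart_inv (c S) y))))"
        by (rule regular_surj[OF A f cxr(2)[OF S] chart_inv_in[OF A cxr(2)[OF S] yc]])
          (use y(2) in \<open>simp add: R0 chart_jet_def\<close>)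
      then show False using y(2) by (simp add: R0 chart_jet_def chart_inv_right[OF A cxr(2)[OF S] yc])
    qed
    then show "f \<in> C1_maps A - (\<Union>S\<in>\<C>. B S)" using f by (auto simp: regular_maps_def)
  qed
  finally show ?thesis .
qed

lemma continuous_map_jac:
  assumes g: "riemannian_metric A g"
  shows "continuous_map (weak_whitney A) euclideanreal (jac A g q :: ('m \<Rightarrow> real^'k::finite) \<Rightarrow> real)"
proof -
  let ?c = "chart_at A q"
  have c: "?c \<in> A" "q \<in> fst ?c" by (rule chart_at_in[OF A])+
  let ?G = "metric_coeffs A g ?c (snd ?c q)"
  have pd: "pos_def_matrix ?G" using c by (intro pos_def_metric_coeffs[OF A g]) auto
  have "continuous_map (weak_whitney A) euclideanreal (\<lambda>f :: 'm \<Rightarrow> real^'k. gram_jac ?G (snd (chart_jet ?c f (snd ?c q))))"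
    using c by (intro continuous_map_jet[OF A c(1), where R = "\<lambda>j. gram_jac ?G (snd j)"]
      continuous_on_gram_jac pd continuous_intros) auto
  then show ?thesis
  proof (rule continuous_map_eq)
    fix f :: "'m \<Rightarrow> real^'k" assume "f \<in> topspace (weak_whitney A)"
    then have f: "f \<in> C1_maps A" by (simp add: topspace_weak_whitney[OF A])
    show "gram_jac ?G (snd (chart_jet ?c f (snd ?c q))) = jac A g q f"
      using jac_chart[OF A g f c] by (simp add: chart_jet_def)
  qed
qed

lemma jac_nonneg:
  fixes f :: "'m \<Rightarrow> real^'k::finite"
  assumes g: "riemannian_metric A g"
  shows "0 \<le> jac A g q f"
  unfolding jac_eq_gram_jac
  using g by (intro gram_jac_nonneg) (auto simp: riemannian_metric_def pos_def_matrix_def)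

text \<open>For indicators of Borel sets this is the defining identity of a regular conditional
  probability, read through the density of \<open>X(p)\<close>. It says that two measures on the
  space of maps coincide, \<open>?N2\<close> being the mixture of the conditional laws, and
  \<open>\<Psi>\<close> is integrated against both.\<close>

lemma regular_conditional_nn_integral:
  fixes X :: "'a \<Rightarrow> 'm \<Rightarrow> real^'k::finite" and \<Psi> :: "('m \<Rightarrow> real^'k) \<Rightarrow> ennreal"
  assumes P: "prob_space P" and X: "X \<in> measurable P (borel_C1 A)"
    and rcp: "regular_conditional_prob A P X p \<kappa>"
    and dist: "distributed P lborel (\<lambda>\<omega>. X \<omega> p) (\<lambda>x. ennreal (\<rho> x))"
    and \<Psi>: "\<Psi> \<in> borel_measurable (borel_C1 A)" and V: "V \<in> sets borel"
  shows "(\<integral>\<^sup>+\<omega>. indicator V (X \<omega> p) * \<Psi> (X \<omega>) \<partial>P)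
     = (\<integral>\<^sup>+x. indicator V x * ennreal (\<rho> x) * (\<integral>\<^sup>+f. \<Psi> f \<partial>\<kappa> x) \<partial>lborel)"
proof -
  interpret prob_space P by (rule P)
  note [measurable] = X \<Psi> V
  have Xp [measurable]: "(\<lambda>\<omega>. X \<omega> p) \<in> borel_measurable P"
    using distributed_measurable[OF dist] by simp
  have \<rho> [measurable]: "(\<lambda>x. ennreal (\<rho> x)) \<in> borel_measurable lborel"
    using distributed_borel_measurable[OF dist] .
  have \<kappa>1: "prob_space (\<kappa> x)" "sets (\<kappa> x) = sets (borel_C1 A)" for x
    using rcp by (auto simp: regular_conditional_prob_def)
  have \<kappa>m: "(\<lambda>x. measure (\<kappa> x) B) \<in> borel_measurable borel" if "B \<in> sets (borel_C1 A)" for B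
    using rcp that by (auto simp: regular_conditional_prob_def)
  have em: "emeasure (\<kappa> x) B = ennreal (measure (\<kappa> x) B)" for x B
  proof -
    interpret k: prob_space "\<kappa> x" by (rule \<kappa>1)
    show ?thesis by (rule k.emeasure_eq_measure)
  qed
  have \<kappa> [measurable]: "\<kappa> \<in> measurable lborel (subprob_algebra (borel_C1 A))"
  proof (rule measurable_subprob_algebra)
    show "subprob_space (\<kappa> x)" "sets (\<kappa> x) = sets (borel_C1 A)" for x
      using \<kappa>1 prob_space_imp_subprob_space by auto
    show "(\<lambda>x. emeasure (\<kappa> x) B) \<in> borel_measurable lborel" if "B \<in> sets (borel_C1 A)" for B
      unfolding em using \<kappa>m[OF that] by simp
  qed
  let ?N1 = "distr (density P (\<lambda>\<omega>. indicator V (X \<omega> p))) (borel_C1 A) X"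
  let ?D = "density lborel (\<lambda>x. indicator V x * ennreal (\<rho> x))"
  have \<kappa>D: "\<kappa> \<in> measurable ?D (subprob_algebra (borel_C1 A))" using \<kappa> by simp
  let ?N2 = "?D \<bind> \<kappa>"
  have "?N1 = ?N2"
  proof (rule measure_eqI)
    show "sets ?N1 = sets ?N2" using sets_bind[of ?D \<kappa> "borel_C1 A"] \<kappa>1(2) by simp
    fix B assume "B \<in> sets ?N1"
    then have B [measurable]: "B \<in> sets (borel_C1 A)" by simp
    have "emeasure ?N1 B = emeasure (density P (\<lambda>\<omega>. indicator V (X \<omega> p))) (X -` B \<inter> space P)"
      by (subst emeasure_distr) simp_all
    also have "\<dots> = (\<integral>\<^sup>+\<omega>. indicator V (X \<omega> p) * indicator (X -` B \<inter> space P) \<omega> \<partial>P)"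
      by (subst emeasure_density) simp_all
    also have "\<dots> = (\<integral>\<^sup>+\<omega>. indicator {\<omega> \<in> space P. X \<omega> \<in> B \<and> X \<omega> p \<in> V} \<omega> \<partial>P)"
      by (intro nn_integral_cong) (auto simp: indicator_def)
    also have "\<dots> = emeasure P {\<omega> \<in> space P. X \<omega> \<in> B \<and> X \<omega> p \<in> V}"
      by (intro nn_integral_indicator) measurable
    also have "\<dots> = ennreal (measure P {\<omega> \<in> space P. X \<omega> \<in> B \<and> X \<omega> p \<in> V})"
      by (rule emeasure_eq_measure)
    also have "\<dots> = ennreal (LINT x:V|distr P borel (\<lambda>\<omega>. X \<omega> p). measure (\<kappa> x) B)"
      using rcp B V by (auto simp: regular_conditional_prob_def)
    also have "\<dots> = (\<integral>\<^sup>+x. ennreal (indicator V x * measure (\<kappa> x) B) \<partial>distr P borel (\<lambda>\<omega>. X \<omega> p))"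
    proof -
      interpret d: prob_space "distr P borel (\<lambda>\<omega>. X \<omega> p)" by (rule prob_space_distr) measurable
      have m: "(\<lambda>x. indicator V x * measure (\<kappa> x) B) \<in> borel_measurable borel" using \<kappa>m[OF B] by measurable
      have "integrable (distr P borel (\<lambda>\<omega>. X \<omega> p)) (\<lambda>x. indicator V x * measure (\<kappa> x) B)"
        by (rule d.integrable_const_bound[where B = 1])
          (use m \<kappa>1 in \<open>auto simp: indicator_def intro!: prob_space.prob_le_1\<close>)
      then show ?thesis
        unfolding set_lebesgue_integral_def by (subst nn_integral_eq_integral) auto
    qed
    also have "\<dots> = (\<integral>\<^sup>+x. ennreal (\<rho> x) * ennreal (indicator V x * measure (\<kappa> x) B) \<partial>lborel)"
    proof -
      have "distr P borel (\<lambda>\<omega>. X \<omega> p) = distr P lborel (\<lambda>\<omega>. X \<omega> p)"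
        by (rule distr_cong) auto
      also have "\<dots> = density lborel (\<lambda>x. ennreal (\<rho> x))"
        by (rule distributed_distr_eq_density[OF dist])
      finally show ?thesis
        using \<kappa>m[OF B] by (simp add: nn_integral_density)
    qed
    also have "\<dots> = (\<integral>\<^sup>+x. (indicator V x * ennreal (\<rho> x)) * emeasure (\<kappa> x) B \<partial>lborel)"
      by (intro nn_integral_cong) (auto simp: em indicator_def)
    also have "\<dots> = (\<integral>\<^sup>+x. emeasure (\<kappa> x) B \<partial>?D)"
      using \<kappa>m[OF B] by (subst nn_integral_density) (auto simp: em)
    also have "\<dots> = emeasure ?N2 B"
      by (rule emeasure_bind[symmetric, OF _ \<kappa>D B]) simp
    finally show "emeasure ?N1 B = emeasure ?N2 B" .
  qed
  then have "(\<integral>\<^sup>+f. \<Psi> f \<partial>?N1) = (\<integral>\<^sup>+f. \<Psi> f \<partial>?N2)" by simp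
  moreover have "(\<integral>\<^sup>+f. \<Psi> f \<partial>?N1) = (\<integral>\<^sup>+\<omega>. indicator V (X \<omega> p) * \<Psi> (X \<omega>) \<partial>P)"
    by (subst nn_integral_distr) (simp_all add: nn_integral_density)
  moreover have "(\<integral>\<^sup>+f. \<Psi> f \<partial>?N2) = (\<integral>\<^sup>+x. indicator V x * ennreal (\<rho> x) * (\<integral>\<^sup>+f. \<Psi> f \<partial>\<kappa> x) \<partial>lborel)"
  proof -
    have "(\<lambda>x. \<integral>\<^sup>+f. \<Psi> f \<partial>\<kappa> x) \<in> borel_measurable lborel"
      by (rule measurable_compose[OF \<kappa> nn_integral_measurable_subprob_algebra[OF \<Psi>]])
    then show ?thesis
      by (subst nn_integral_bind[OF \<Psi> \<kappa>D]) (simp add: nn_integral_density)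
  qed
  ultimately show ?thesis by simp
qed

text \<open>Joins two forms of one integral: the continuity hypothesis is about real integrals
  against the measure with the Jacobian as density, whereas conditioning produces nonnegative
  integrals with the Jacobian in the integrand.\<close>

lemma nn_integral_jac_measure:
  fixes \<nu> :: "('m \<Rightarrow> real^'k::finite) measure"
  assumes g: "riemannian_metric A g" and \<nu>: "sets \<nu> = sets (borel_C1 A)"
    and fin: "finite_measure (jac_measure A g q \<nu>)"
    and \<Theta>: "\<Theta> \<in> borel_measurable (borel_C1 A)" "\<And>f. f \<in> C1_maps A \<Longrightarrow> 0 \<le> \<Theta> f"
       "\<And>f. f \<in> C1_maps A \<Longrightarrow> \<Theta> f \<le> B"
  shows "(\<integral>\<^sup>+f. ennreal (\<Theta> f * jac A g q f) \<partial>\<nu>) = ennreal (\<integral>f. \<Theta> f \<partial>jac_measure A g q \<nu>)"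
proof -
  interpret finite_measure "jac_measure A g q \<nu>" by (rule fin)
  have sp: "space \<nu> = C1_maps A" using sets_eq_imp_space_eq[OF \<nu>] by (simp add: space_borel_C1[OF A])
  have spj: "space (jac_measure A g q \<nu>) = C1_maps A" by (simp add: jac_measure_def sp)
  have jm: "jac A g q \<in> borel_measurable \<nu>" 
    using borel_measurable_continuous_map[OF A continuous_map_jac[OF g]] measurable_cong_sets[OF \<nu> refl] by blast
  have \<Theta>m: "\<Theta> \<in> borel_measurable \<nu>" using \<Theta>(1) measurable_cong_sets[OF \<nu> refl] by blast
  then have \<Theta>j: "\<Theta> \<in> borel_measurable (jac_measure A g q \<nu>)" by (simp add: jac_measure_def)
  have "integrable (jac_measure A g q \<nu>) \<Theta>"
    by (rule integrable_const_bound[OF _ \<Theta>j, of B]) (use \<Theta>(2,3) spj in auto)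
  then have "ennreal (\<integral>f. \<Theta> f \<partial>jac_measure A g q \<nu>) = (\<integral>\<^sup>+f. ennreal (\<Theta> f) \<partial>jac_measure A g q \<nu>)"
    by (intro nn_integral_eq_integral[symmetric]) (use \<Theta>(2) spj in auto)
  also have "\<dots> = (\<integral>\<^sup>+f. ennreal (jac A g q f) * ennreal (\<Theta> f) \<partial>\<nu>)"
    unfolding jac_measure_def using jm \<Theta>m by (subst nn_integral_density) auto
  also have "\<dots> = (\<integral>\<^sup>+f. ennreal (\<Theta> f * jac A g q f) \<partial>\<nu>)"
    by (intro nn_integral_cong) (simp add: sp \<Theta>(2) jac_nonneg[OF g] ennreal_mult' mult.commute)
  finally show ?thesis by simp
qed

text \<open>Conditioning on the value at \<open>q\<close> turns the expectation into the integral of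
  \<open>H q x\<close> over the \<open>\<epsilon>\<close>-ball, and \<open>H\<close> is continuous
  at \<open>(p, 0)\<close>. The bound on \<open>\<epsilon>\<close> is uniform in \<open>q\<close>,
  so the estimates can later be integrated along a disc.\<close>

lemma z_KROK_average:
  fixes X :: "'a \<Rightarrow> 'm \<Rightarrow> real^'k::finite" and \<Theta> :: "('m \<Rightarrow> real^'k) \<Rightarrow> real" and p :: 'm
  assumes g: "riemannian_metric A g" and zk: "z_KROK A g P X \<rho> \<mu>"
    and \<Theta>: "continuous_map (weak_whitney A) euclideanreal \<Theta>" "\<And>f. f \<in> C1_maps A \<Longrightarrow> 0 \<le> \<Theta> f"
       "\<And>f. f \<in> C1_maps A \<Longrightarrow> \<Theta> f \<le> B"
    and \<eta>: "\<eta> > 0"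
  defines "G \<equiv> \<rho> p 0 * (\<integral>f. \<Theta> f \<partial>jac_measure A g p (\<mu> p 0))"
  obtains U \<epsilon>0 where "open U" "p \<in> U" "\<epsilon>0 > 0"
    "\<And>q \<epsilon>. q \<in> U \<Longrightarrow> 0 < \<epsilon> \<Longrightarrow> \<epsilon> < \<epsilon>0 \<Longrightarrow> ennreal (G - \<eta>) * emeasure lborel (ball (0::real^'k) \<epsilon>)
        \<le> (\<integral>\<^sup>+\<omega>. indicator (ball 0 \<epsilon>) (X \<omega> q) * ennreal (\<Theta> (X \<omega>) * jac A g q (X \<omega>)) \<partial>P)"
    "\<And>q \<epsilon>. q \<in> U \<Longrightarrow> 0 < \<epsilon> \<Longrightarrow> \<epsilon> < \<epsilon>0 \<Longrightarrow>
        (\<integral>\<^sup>+\<omega>. indicator (ball 0 \<epsilon>) (X \<omega> q) * ennreal (\<Theta> (X \<omega>) * jac A g q (X \<omega>)) \<partial>P)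
        \<le> ennreal (G + \<eta>) * emeasure lborel (ball (0::real^'k) \<epsilon>)"
proof -
  define H where "H q x = \<rho> q x * (\<integral>f. \<Theta> f \<partial>jac_measure A g q (\<mu> q x))" for q x
  have bdd: "bounded (\<Theta> ` topspace (weak_whitney A))"
    unfolding bounded_iff using \<Theta>(2,3) by (intro exI[of _ B]) (auto simp: topspace_weak_whitney[OF A])
  have "isCont (\<lambda>(q, x). \<rho> q x) (p, 0)" "isCont (\<lambda>(q, x). \<integral>f. \<Theta> f \<partial>jac_measure A g q (\<mu> q x)) (p, 0)"
    using zk \<Theta>(1) bdd unfolding z_KROK_def by blast+
  then have "isCont (\<lambda>z. (case z of (q, x) \<Rightarrow> \<rho> q x) * (case z of (q, x) \<Rightarrow> \<integral>f. \<Theta> f \<partial>jac_measure A g q (\<mu> q x))) (p, 0)"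
    by (rule continuous_mult)
  then have cH: "isCont (\<lambda>z. H (fst z) (snd z)) (p, 0)"
    by (simp add: H_def split_beta)
  have "\<forall>\<^sub>F z in nhds (p, 0). dist (H (fst z) (snd z)) G < \<eta>"
    using cH \<eta> unfolding isCont_def tendsto_iff eventually_at_filter G_def H_def
    by (auto elim!: allE[of _ \<eta>] eventually_mono)
  then obtain W where W: "open W" "(p, 0) \<in> W" "\<And>z. z \<in> W \<Longrightarrow> dist (H (fst z) (snd z)) G < \<eta>"
    unfolding eventually_nhds by blast
  obtain U V where UV: "open U" "p \<in> U" "open V" "0 \<in> V" "U \<times> V \<subseteq> W"
    using W(1,2) by (auto elim!: open_prod_elim)
  obtain \<epsilon>0 where \<epsilon>0: "\<epsilon>0 > 0" "ball 0 \<epsilon>0 \<subseteq> V" using UV(3,4) open_contains_ball by blast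
  have H: "G - \<eta> \<le> H q x" "H q x \<le> G + \<eta>" if "q \<in> U" "norm x < \<epsilon>0" for q x
  proof -
    have "(q, x) \<in> W" using that UV \<epsilon>0 by auto
    from W(3)[OF this] show "G - \<eta> \<le> H q x" "H q x \<le> G + \<eta>" by (auto simp: dist_real_def)
  qed
  have P: "prob_space P" "X \<in> measurable P (borel_C1 A)"
    and \<rho>0: "\<And>q x. 0 \<le> \<rho> q x"
    and dist: "\<And>q. distributed P lborel (\<lambda>\<omega>. X \<omega> q) (\<lambda>x. ennreal (\<rho> q x))"
    and rcp: "\<And>q. regular_conditional_prob A P X q (\<mu> q)"
    and fin: "\<And>q x. finite_measure (jac_measure A g q (\<mu> q x))"
    using zk unfolding z_KROK_def by auto
  have \<Theta>m: "\<Theta> \<in> borel_measurable (borel_C1 A)" by (rule borel_measurable_continuous_map[OF A \<Theta>(1)])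
  have eq: "(\<integral>\<^sup>+\<omega>. indicator (ball 0 \<epsilon>) (X \<omega> q) * ennreal (\<Theta> (X \<omega>) * jac A g q (X \<omega>)) \<partial>P)
     = (\<integral>\<^sup>+x. indicator (ball 0 \<epsilon>) x * ennreal (H q x) \<partial>lborel)" for q \<epsilon>
  proof -
    have m: "(\<lambda>f. ennreal (\<Theta> f * jac A g q f)) \<in> borel_measurable (borel_C1 A)"
      using \<Theta>m borel_measurable_continuous_map[OF A continuous_map_jac[OF g]] by measurable
    have "(\<integral>\<^sup>+f. ennreal (\<Theta> f * jac A g q f) \<partial>\<mu> q x) = ennreal (\<integral>f. \<Theta> f \<partial>jac_measure A g q (\<mu> q x))" for x
      using rcp[of q] by (intro nn_integral_jac_measure[OF g _ fin \<Theta>m \<Theta>(2,3)]) (auto simp: regular_conditional_prob_def)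
    then show ?thesis
      unfolding regular_conditional_nn_integral[OF P rcp dist m borel_open[OF open_ball]]
      by (simp add: H_def ennreal_mult' \<rho>0 mult.assoc)
  qed
  show ?thesis
  proof (rule that[OF UV(1,2) \<epsilon>0(1)])
    fix q \<epsilon> assume q: "q \<in> U" and \<epsilon>: "0 < \<epsilon>" "\<epsilon> < \<epsilon>0"
    have c: "(\<integral>\<^sup>+x. indicator (ball (0::real^'k) \<epsilon>) x * ennreal t \<partial>lborel) = ennreal t * emeasure lborel (ball (0::real^'k) \<epsilon>)" for t
      by (subst mult.commute) (simp add: nn_integral_cmult_indicator)
    show "ennreal (G - \<eta>) * emeasure lborel (ball (0::real^'k) \<epsilon>)
        \<le> (\<integral>\<^sup>+\<omega>. indicator (ball 0 \<epsilon>) (X \<omega> q) * ennreal (\<Theta> (X \<omega>) * jac A g q (X \<omega>)) \<partial>P)"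
      unfolding eq c[symmetric] using H(1)[OF q] \<epsilon> by (intro nn_integral_mono) (auto simp: indicator_def intro!: ennreal_leI)
    show "(\<integral>\<^sup>+\<omega>. indicator (ball 0 \<epsilon>) (X \<omega> q) * ennreal (\<Theta> (X \<omega>) * jac A g q (X \<omega>)) \<partial>P)
        \<le> ennreal (G + \<eta>) * emeasure lborel (ball (0::real^'k) \<epsilon>)"
      unfolding eq c[symmetric] using H(2)[OF q] \<epsilon> by (intro nn_integral_mono) (auto simp: indicator_def intro!: ennreal_leI)
  qed
qed

end

section \<open>Zeros on coordinate discs\<close>

text \<open>The indices \<open>s j\<close> may repeat. The disc is then degenerate, but so is the
  corresponding minor, and that direction contributes zero.\<close>

definition disc :: "real^'n::finite \<Rightarrow> ('k::finite \<Rightarrow> 'n) \<Rightarrow> real^'k \<Rightarrow> real^'n" where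
  "disc x0 s y = x0 + (\<Sum>j\<in>UNIV. y $ j *\<^sub>R axis (s j) 1)"

definition column_minor :: "('k::finite \<Rightarrow> 'n::finite) \<Rightarrow> real^'n^'k \<Rightarrow> real^'k^'k" where
  "column_minor s D = (\<chi> i j. D $ i $ s j)"

text \<open>The Jacobian determinant of a map along the disc is a component of the wedge of its
  differential; this is the origin of the factor \<open>\<bar>w $ s\<bar>\<close> in
  \<open>dir_part\<close>.\<close>

lemma det_column_minor: "det (column_minor s D) = wedge D $ s"
  by (simp add: column_minor_def wedge_nth)

lemma disc_0 [simp]: "disc x0 s 0 = x0"
  by (simp add: disc_def)

lemma continuous_on_disc: "continuous_on S (disc x0 s)"
  unfolding disc_def by (intro continuous_intros)

lemma continuous_on_column_minor: "continuous_on S (column_minor s)"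
  unfolding column_minor_def by (intro continuous_on_vec_lambda2 continuous_intros)

lemma disc_has_derivative:
  "(disc x0 s has_derivative (\<lambda>v. \<Sum>j\<in>UNIV. v $ j *\<^sub>R axis (s j) 1)) (at y)"
proof -
  have "((\<lambda>y. y $ j *\<^sub>R axis (s j) 1) has_derivative (\<lambda>v. v $ j *\<^sub>R axis (s j) (1::real))) (at y)" for j
    by (rule bounded_linear_imp_has_derivative)
      (rule bounded_linear_compose[OF bounded_linear_scaleR_left bounded_linear_vec_nth])
  then have "((\<lambda>y. x0 + (\<Sum>j\<in>UNIV. y $ j *\<^sub>R axis (s j) 1)) has_derivative
     (\<lambda>v. 0 + (\<Sum>j\<in>UNIV. v $ j *\<^sub>R axis (s j) (1::real)))) (at y)"
    by (intro has_derivative_add has_derivative_const has_derivative_sum) auto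
  then show ?thesis by (simp add: disc_def[abs_def])
qed

lemma mult_disc_derivative:
  "D *v (\<Sum>j\<in>UNIV. v $ j *\<^sub>R axis (s j) 1) = column_minor s D *v v"
proof -
  have "D *v (\<Sum>j\<in>UNIV. v $ j *\<^sub>R axis (s j) 1) = (\<Sum>j\<in>UNIV. v $ j *\<^sub>R column (s j) D)"
    by (simp add: linear_sum[OF matrix_vector_mul_linear] matrix_vector_mult_scaleR matrix_vector_mult_basis)
  also have "\<dots> = column_minor s D *v v"
    by (simp add: vec_eq_iff column_def matrix_vector_mult_def column_minor_def mult.commute)
  finally show ?thesis .
qed

text \<open>For regular \<open>f\<close> this depends on the zero set only; it is the functional to which the
  hypothesis on the two laws is applied.\<close>

definition disc_weight ::
    "('m, 'n::finite) chart \<Rightarrow> real^'n \<Rightarrow> ('k::finite \<Rightarrow> 'n) \<Rightarrow> real^('k \<Rightarrow> 'n) \<Rightarrow> real \<Rightarrow> ('m \<Rightarrow> real^'k) \<Rightarrow> ennreal" where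
  "disc_weight c x0 s u \<delta> f =
     (SUP y\<in>{y \<in> cball 0 \<delta>. f (chart_inv c (disc x0 s y)) = 0}.
        ennreal (dir_weight u s (wedge (chart_differential c f (disc x0 s y)))))"

lemma disc_weight_le: "disc_weight c x0 s u \<delta> f \<le> ennreal (norm u)"
  unfolding disc_weight_def by (intro SUP_least ennreal_leI dir_weight_le)

lemma less_disc_weight_iff:
  "t < disc_weight c x0 s u \<delta> f \<longleftrightarrow> (\<exists>y\<in>cball 0 \<delta>. f (chart_inv c (disc x0 s y)) = 0 \<and>
     t < ennreal (dir_weight u s (wedge (chart_differential c f (disc x0 s y)))))"
  unfolding disc_weight_def less_SUP_iff by auto

lemma nn_integral_det_image_scaled:
  fixes F :: "real^'k::finite \<Rightarrow> real^'k"
  assumes S: "S \<in> sets borel" and FS: "F ` S \<in> sets borel" "emeasure lborel (F ` S) < \<infinity>"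
    and der: "\<And>y. y \<in> S \<Longrightarrow> (F has_derivative (*v) (M y)) (at y within S)"
    and cont: "continuous_on S M" and inj: "inj_on F S" and t: "0 \<le> t"
  shows "(\<integral>\<^sup>+y. indicator S y * ennreal (t * \<bar>det (M y)\<bar>) \<partial>lborel) = ennreal t * emeasure lborel (F ` S)"
proof -
  have mat: "matrix ((*v) (M y)) = M y" for y by simp
  have cd: "continuous_on S (\<lambda>y. det (M y))" by (intro continuous_on_det cont)
  have "(\<lambda>y. indicator S y *\<^sub>R \<bar>det (M y)\<bar>) \<in> borel_measurable borel"
    using cd S by (intro borel_measurable_continuous_on_indicator) (auto intro: continuous_intros)
  then have [measurable]: "(\<lambda>y. indicator S y * \<bar>det (M y)\<bar>) \<in> borel_measurable borel" by simp
  have eq: "indicator S y * ennreal (t * \<bar>det (M y)\<bar>) = ennreal t * ennreal (indicator S y * \<bar>det (M y)\<bar>)" for y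
    using t by (auto simp: indicator_def ennreal_mult)
  have eq2: "indicator S y * ennreal \<bar>det (M y)\<bar> = ennreal (indicator S y * \<bar>det (M y)\<bar>)" for y
    by (auto simp: indicator_def)
  have "(\<integral>\<^sup>+y. indicator S y * ennreal (t * \<bar>det (M y)\<bar>) \<partial>lborel)
      = ennreal t * (\<integral>\<^sup>+y. indicator S y * ennreal \<bar>det (M y)\<bar> \<partial>lborel)"
    unfolding eq eq2 by (rule nn_integral_cmult) measurable
  also have "(\<integral>\<^sup>+y. indicator S y * ennreal \<bar>det (M y)\<bar> \<partial>lborel) = emeasure lborel (F ` S)"
    using nn_integral_det_image[OF S FS der _ inj] cd unfolding mat by simp
  finally show ?thesis .
qed

context
  fixes A :: "('m::{t2_space,second_countable_topology}, 'n::finite) chart set"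
  assumes A: "smooth_atlas A"
begin

section \<open>Area formula estimates for a single map on a disc\<close>

lemma disc_fun_has_derivative:
  fixes f :: "'m \<Rightarrow> real^'k::finite"
  assumes "f \<in> C1_maps A" "c \<in> A" "disc x0 s y \<in> snd c ` fst c"
  shows "((\<lambda>y. f (chart_inv c (disc x0 s y))) has_derivative
     (*v) (column_minor s (chart_differential c f (disc x0 s y)))) (at y)"
proof -
  have "((f \<circ> chart_inv c) \<circ> disc x0 s has_derivative
     (*v) (chart_differential c f (disc x0 s y)) \<circ> (\<lambda>v. \<Sum>j\<in>UNIV. v $ j *\<^sub>R axis (s j) 1)) (at y)"
    by (rule diff_chain_at[OF disc_has_derivative chart_has_derivative[OF A assms]])
  moreover have "(*v) (chart_differential c f (disc x0 s y)) \<circ> (\<lambda>v. \<Sum>j\<in>UNIV. v $ j *\<^sub>R axis (s j) 1)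
     = (*v) (column_minor s (chart_differential c f (disc x0 s y)))"
    by (rule ext) (simp add: mult_disc_derivative)
  ultimately show ?thesis by (simp add: o_def)
qed

lemma continuous_on_disc_differential:
  fixes f :: "'m \<Rightarrow> real^'k::finite"
  assumes "f \<in> C1_maps A" "c \<in> A" "disc x0 s ` S \<subseteq> snd c ` fst c"
  shows "continuous_on S (\<lambda>y. chart_differential c f (disc x0 s y))"
  by (rule continuous_on_compose2[OF continuous_on_chart_differential[OF A assms(1,2)] continuous_on_disc assms(3)])

lemma continuous_on_disc_wedge:
  fixes f :: "'m \<Rightarrow> real^'k::finite"
  assumes "f \<in> C1_maps A" "c \<in> A" "disc x0 s ` S \<subseteq> snd c ` fst c"
  shows "continuous_on S (\<lambda>y. wedge (chart_differential c f (disc x0 s y)))"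
  by (rule continuous_on_compose2[OF continuous_on_wedge continuous_on_disc_differential[OF assms]]) simp

lemma continuous_on_disc_fun:
  fixes f :: "'m \<Rightarrow> real^'k::finite" and s :: "'k \<Rightarrow> 'n"
  assumes "f \<in> C1_maps A" "c \<in> A" "disc x0 s ` S \<subseteq> snd c ` fst c"
  shows "continuous_on S (\<lambda>y. f (chart_inv c (disc x0 s y)))"
proof (rule continuous_at_imp_continuous_on, rule ballI)
  fix y assume "y \<in> S"
  then have "disc x0 s y \<in> snd c ` fst c" by (intro subsetD[OF assms(3)] imageI)
  from disc_fun_has_derivative[OF assms(1,2) this]
  show "isCont (\<lambda>y. f (chart_inv c (disc x0 s y))) y" by (rule has_derivative_continuous)
qed

text \<open>Where the map has norm below \<open>\<epsilon>\<close>, the integrand is at most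
  \<open>t\<close> times the Jacobian along the disc. Injectivity lets the area formula turn the
  integral of that Jacobian into the volume of an image contained in the
  \<open>\<epsilon>\<close>-ball.\<close>

lemma integral_near_zeros_le:
  fixes f :: "'m \<Rightarrow> real^'k::finite"
  assumes f: "f \<in> C1_maps A" and c: "c \<in> A" and D: "disc x0 s ` cball 0 \<delta> \<subseteq> snd c ` fst c"
    and inj: "inj_on (\<lambda>y. f (chart_inv c (disc x0 s y))) (cball 0 \<delta>)" and t: "0 \<le> t"
    and le: "\<And>y. y \<in> cball 0 \<delta> \<Longrightarrow> norm (f (chart_inv c (disc x0 s y))) < \<epsilon> \<Longrightarrow>
        h y \<le> t * \<bar>wedge (chart_differential c f (disc x0 s y)) $ s\<bar>"
  shows "(\<integral>\<^sup>+y. indicator (cball 0 \<delta>) y * (indicator (ball 0 \<epsilon>) (f (chart_inv c (disc x0 s y))) * ennreal (h y)) \<partial>lborel)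
     \<le> ennreal t * emeasure lborel (ball (0::real^'k) \<epsilon>)"
proof -
  let ?F = "\<lambda>y. f (chart_inv c (disc x0 s y))"
  let ?M = "\<lambda>y. column_minor s (chart_differential c f (disc x0 s y))"
  let ?K = "cball (0::real^'k) \<delta>"
  define S where "S = {y \<in> ?K. norm (?F y) < \<epsilon>}"
  have cF: "continuous_on ?K ?F" by (rule continuous_on_disc_fun[OF f c D])
  have S: "S \<in> sets borel"
  proof -
    obtain T where "open T" "?F -` ball 0 \<epsilon> \<inter> ?K = T \<inter> ?K"
      using cF unfolding continuous_on_open_invariant by (metis open_ball)
    moreover have "S = ?F -` ball 0 \<epsilon> \<inter> ?K" by (auto simp: S_def)
    ultimately show ?thesis by (auto intro!: sets.Int)
  qed
  have FS: "?F ` S = ?F ` ?K \<inter> ball 0 \<epsilon>" by (auto simp: S_def)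
  have cK: "compact (?F ` ?K)" by (intro compact_continuous_image cF compact_cball)
  then have FSb: "?F ` S \<in> sets borel" unfolding FS by (intro sets.Int borel_compact borel_open open_ball)
  have FSle: "emeasure lborel (?F ` S) \<le> emeasure lborel (ball (0::real^'k) \<epsilon>)"
    unfolding FS by (intro emeasure_mono) auto
  have fin: "emeasure lborel (?F ` S) < \<infinity>"
    using FSle emeasure_lborel_ball_finite[of 0 \<epsilon>] by (rule order_le_less_trans)
  have "(\<integral>\<^sup>+y. indicator ?K y * (indicator (ball 0 \<epsilon>) (?F y) * ennreal (h y)) \<partial>lborel)
     \<le> (\<integral>\<^sup>+y. indicator S y * ennreal (t * \<bar>det (?M y)\<bar>) \<partial>lborel)"
  proof (rule nn_integral_mono)
    fix y
    show "indicator ?K y * (indicator (ball 0 \<epsilon>) (?F y) * ennreal (h y))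
        \<le> indicator S y * ennreal (t * \<bar>det (?M y)\<bar>)"
    proof (cases "y \<in> S")
      case True
      then have "h y \<le> t * \<bar>det (?M y)\<bar>" unfolding det_column_minor by (intro le) (simp_all add: S_def)
      moreover have "y \<in> ?K" "?F y \<in> ball 0 \<epsilon>" using True by (simp_all add: S_def)
      ultimately show ?thesis using True by (simp add: ennreal_leI)
    next
      case False
      then have "y \<notin> ?K \<or> ?F y \<notin> ball 0 \<epsilon>" by (simp add: S_def)
      then show ?thesis by (elim disjE) simp_all
    qed
  qed
  also have "\<dots> = ennreal t * emeasure lborel (?F ` S)"
  proof (rule nn_integral_det_image_scaled[OF S FSb fin _ _ _ t])
    show "(?F has_derivative (*v) (?M y)) (at y within S)" if "y \<in> S" for y
    proof -
      have yK: "y \<in> ?K" using that by (simp add: S_def)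
      have "disc x0 s y \<in> snd c ` fst c" by (rule subsetD[OF D imageI[OF yK]])
      from disc_fun_has_derivative[OF f c this] show ?thesis by (rule has_derivative_at_withinI)
    qed
    show "continuous_on S ?M"
    proof -
      have "S \<subseteq> ?K" unfolding S_def by (rule Collect_restrict)
      then have SD: "disc x0 s ` S \<subseteq> snd c ` fst c" by (intro subset_trans[OF image_mono D])
      show ?thesis
        by (rule continuous_on_compose2[OF continuous_on_column_minor[of UNIV] continuous_on_disc_differential[OF f c SD]]) simp
    qed
    show "inj_on ?F S" by (rule inj_on_subset[OF inj]) (auto simp: S_def)
  qed
  also have "\<dots> \<le> ennreal t * emeasure lborel (ball (0::real^'k) \<epsilon>)" by (intro mult_left_mono FSle) simp
  finally show ?thesis .
qed

text \<open>Close enough to the zeros, the weight is below its largest value at a zero plus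
  \<open>\<eta>\<close>; this constant then plays the role of \<open>t\<close> in
  \<open>integral_near_zeros_le\<close>. The wedge does not vanish on the disc, so the weight is
  continuous there.\<close>

lemma integral_near_zeros_eventually_le:
  fixes f :: "'m \<Rightarrow> real^'k::finite"
  assumes f: "f \<in> C1_maps A" and c: "c \<in> A" and D: "disc x0 s ` cball 0 \<delta> \<subseteq> snd c ` fst c"
    and inj: "inj_on (\<lambda>y. f (chart_inv c (disc x0 s y))) (cball 0 \<delta>)"
    and nz: "\<And>y. y \<in> cball 0 \<delta> \<Longrightarrow> wedge (chart_differential c f (disc x0 s y)) \<noteq> 0"
    and le: "\<And>y. y \<in> cball 0 \<delta> \<Longrightarrow> h y \<le> dir_part u s (wedge (chart_differential c f (disc x0 s y)))"
    and \<eta>: "0 < \<eta>"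
  obtains \<epsilon>1 where "\<epsilon>1 > 0" "\<And>\<epsilon>. 0 < \<epsilon> \<Longrightarrow> \<epsilon> < \<epsilon>1 \<Longrightarrow>
     (\<integral>\<^sup>+y. indicator (cball 0 \<delta>) y * (indicator (ball 0 \<epsilon>) (f (chart_inv c (disc x0 s y))) * ennreal (h y)) \<partial>lborel)
     \<le> (disc_weight c x0 s u \<delta> f + ennreal \<eta>) * emeasure lborel (ball (0::real^'k) \<epsilon>)"
proof -
  let ?F = "\<lambda>y. f (chart_inv c (disc x0 s y))"
  let ?W = "\<lambda>y. wedge (chart_differential c f (disc x0 s y))"
  let ?K = "cball (0::real^'k) \<delta>"
  define m where "m = enn2real (disc_weight c x0 s u \<delta> f)"
  have "disc_weight c x0 s u \<delta> f < \<infinity>" using disc_weight_le by (rule order_le_less_trans) simp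
  then have m: "disc_weight c x0 s u \<delta> f = ennreal m" "0 \<le> m" by (simp_all add: m_def)
  \<comment> \<open>On this compact set of points with too large a weight the map has no zero, so
    its norm has a positive lower bound \<open>\<epsilon>1\<close>; for smaller
    \<open>\<epsilon>\<close> these points do not enter the integral.\<close>
  define L where "L = {y \<in> ?K. m + \<eta> \<le> dir_weight u s (?W y)}"
  have cb: "continuous_on ?K (\<lambda>y. dir_weight u s (?W y))"
    by (rule continuous_on_compose2[OF continuous_on_dir_weight continuous_on_disc_wedge[OF f c D]]) (use nz in auto)
  have "closed L"
    unfolding L_def by (intro continuous_closed_preimage_constant continuous_on_closed_Collect_le cb continuous_intros) auto
  moreover have "bounded L"
    by (rule bounded_subset[OF bounded_cball[of 0 \<delta>]]) (auto simp: L_def)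
  ultimately have cL: "compact L" by (simp add: compact_eq_bounded_closed)
  have nF: "?F y \<noteq> 0" if "y \<in> L" for y
  proof
    assume "?F y = 0"
    then have "ennreal (dir_weight u s (?W y)) \<le> disc_weight c x0 s u \<delta> f"
      using that unfolding disc_weight_def by (intro SUP_upper) (auto simp: L_def)
    then have "dir_weight u s (?W y) \<le> m" using m by simp
    then show False using that \<eta> by (simp add: L_def)
  qed
  obtain \<epsilon>1 where \<epsilon>1: "\<epsilon>1 > 0" "\<And>y. y \<in> L \<Longrightarrow> \<epsilon>1 \<le> norm (?F y)"
  proof (cases "L = {}")
    case True then show ?thesis using that[of 1] by simp
  next
    case False
    have "continuous_on L (\<lambda>y. norm (?F y))"
    proof (intro continuous_intros continuous_on_disc_fun[OF f c])
      have "L \<subseteq> ?K" unfolding L_def by (rule Collect_restrict)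
      then show "disc x0 s ` L \<subseteq> snd c ` fst c" by (intro subset_trans[OF image_mono D])
    qed
    then obtain y where "y \<in> L" "\<And>y'. y' \<in> L \<Longrightarrow> norm (?F y) \<le> norm (?F y')"
      using continuous_attains_inf[OF cL False] by blast
    then show ?thesis using that[of "norm (?F y)"] nF by simp
  qed
  show ?thesis
  proof (rule that[OF \<epsilon>1(1)])
    fix \<epsilon> assume \<epsilon>: "0 < \<epsilon>" "\<epsilon> < \<epsilon>1"
    have "(\<integral>\<^sup>+y. indicator ?K y * (indicator (ball 0 \<epsilon>) (?F y) * ennreal (h y)) \<partial>lborel)
       \<le> ennreal (m + \<eta>) * emeasure lborel (ball (0::real^'k) \<epsilon>)"
    proof (rule integral_near_zeros_le[OF f c D inj])
      show "0 \<le> m + \<eta>" using m \<eta> by simp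
      fix y assume y: "y \<in> ?K" "norm (?F y) < \<epsilon>"
      then have "y \<notin> L" using \<epsilon>1(2)[of y] \<epsilon> by auto
      then have "dir_weight u s (?W y) \<le> m + \<eta>" using y by (simp add: L_def)
      then have "dir_part u s (?W y) \<le> (m + \<eta>) * \<bar>?W y $ s\<bar>"
        unfolding dir_part_def by (intro mult_right_mono) auto
      then show "h y \<le> (m + \<eta>) * \<bar>?W y $ s\<bar>" using le[OF y(1)] by linarith
    qed
    then show "(\<integral>\<^sup>+y. indicator ?K y * (indicator (ball 0 \<epsilon>) (?F y) * ennreal (h y)) \<partial>lborel)
     \<le> (disc_weight c x0 s u \<delta> f + ennreal \<eta>) * emeasure lborel (ball (0::real^'k) \<epsilon>)"
      using m \<eta> by simp
  qed
qed

text \<open>A single zero of weight above \<open>r\<close> is enough. Its minor is nonzero, so the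
  map is injective and open near it and covers a whole small ball, whose volume the area formula
  recovers from the Jacobian.\<close>

lemma integral_near_zeros_eventually_ge:
  fixes f :: "'m \<Rightarrow> real^'k::finite"
  assumes f: "f \<in> C1_maps A" and c: "c \<in> A" and D: "disc x0 s ` cball 0 \<delta>' \<subseteq> snd c ` fst c"
    and \<delta>: "\<delta> < \<delta>'" and r: "0 \<le> r" "ennreal r < disc_weight c x0 s u \<delta> f"
    and ge: "\<And>y. y \<in> cball 0 \<delta>' \<Longrightarrow> dir_part u s (wedge (chart_differential c f (disc x0 s y))) \<le> h y"
  obtains \<epsilon>1 where "\<epsilon>1 > 0" "\<And>\<epsilon>. 0 < \<epsilon> \<Longrightarrow> \<epsilon> < \<epsilon>1 \<Longrightarrow> ennreal r * emeasure lborel (ball (0::real^'k) \<epsilon>) \<le>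
     (\<integral>\<^sup>+y. indicator (cball 0 \<delta>') y * (indicator (ball 0 \<epsilon>) (f (chart_inv c (disc x0 s y))) * ennreal (h y)) \<partial>lborel)"
proof -
  let ?F = "\<lambda>y. f (chart_inv c (disc x0 s y))"
  let ?D = "\<lambda>y. chart_differential c f (disc x0 s y)"
  let ?M = "\<lambda>y. column_minor s (?D y)"
  obtain z where z: "z \<in> cball 0 \<delta>" "?F z = 0" "ennreal r < ennreal (dir_weight u s (wedge (?D z)))"
    using r(2) unfolding less_disc_weight_iff by blast
  have rz: "r < dir_weight u s (wedge (?D z))" using z(3) r(1) by (simp add: ennreal_less_iff)
  \<comment> \<open>A weight above the nonnegative \<open>r\<close> is positive, which excludes a
    vanishing component.\<close>
  have zs: "wedge (?D z) $ s \<noteq> 0" using rz r(1) by (auto simp: dir_weight_def)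
  \<comment> \<open>The zero lies in the smaller closed disc, hence in this open ball; its
    neighbourhood can therefore be chosen inside the disc of integration even if the zero has norm
    \<open>\<delta>\<close>.\<close>
  define B where "B = ball (0::real^'k) \<delta>'"
  have BD: "disc x0 s ` B \<subseteq> snd c ` fst c"
    unfolding B_def by (rule subset_trans[OF image_mono[OF ball_subset_cball] D])
  have zB: "z \<in> B" using z(1) \<delta> by (simp add: B_def)
  define O1 where "O1 = {w :: real^('k \<Rightarrow> 'n). w \<noteq> 0} \<inter> dir_weight u s -` {r<..}"
  have O1: "open O1"
  proof -
    have "open {w :: real^('k \<Rightarrow> 'n). w \<noteq> 0}" by (intro open_Collect_neq continuous_intros)
    then have "open (dir_weight u s -` {r<..} \<inter> {w. w \<noteq> 0})"
      using continuous_on_open_vimage continuous_on_dir_weight open_greaterThan by blast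
    then show ?thesis unfolding O1_def by (simp only: Int_commute)
  qed
  define U where "U = (\<lambda>y. wedge (?D y)) -` O1 \<inter> B"
  have oU: "open U"
    unfolding U_def using continuous_on_open_vimage[of B "\<lambda>y. wedge (?D y)"]
      continuous_on_disc_wedge[OF f c BD] O1 by (simp add: B_def)
  have zU: "z \<in> U" using zB zs rz by (auto simp: U_def O1_def)
  have UB: "U \<subseteq> B" by (auto simp: U_def)
  have der: "(?F has_derivative (*v) (?M y)) (at y)" if "y \<in> U" for y
    using that UB by (intro disc_fun_has_derivative[OF f c] subsetD[OF BD] imageI) blast
  have UD: "disc x0 s ` U \<subseteq> snd c ` fst c" by (rule subset_trans[OF image_mono[OF UB] BD])
  have cM: "continuous_on U ?M"
    by (rule continuous_on_compose2[OF continuous_on_column_minor[of UNIV] continuous_on_disc_differential[OF f c UD]]) simp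
  have inv: "invertible (?M z)" using zs by (simp add: invertible_det_nz det_column_minor)
  then have sM: "surj ((*v) (?M z))"
    by (simp add: invertible_right_inverse matrix_right_invertible_surjective)
  have iM: "inj ((*v) (?M z))"
    using inv by (simp add: invertible_left_inverse matrix_left_invertible_injective)
  obtain R :: "real^'k^'k" and U' V \<psi> g \<psi>' where
    U': "open U'" "U' \<subseteq> U" "z \<in> U'" and V: "open V" and hom: "homeomorphism U' V \<psi> g"
    and Mpsi: "\<And>x. ?M z *v \<psi> x = ?F x"
    by (rule straighten[of U ?F ?M z, OF oU der cM zU sM], assumption) (rule that)
  have injF: "inj_on ?F U'"
  proof (rule inj_onI)
    fix x y assume xy: "x \<in> U'" "y \<in> U'" "?F x = ?F y"
    then have "\<psi> x = \<psi> y" using iM by (auto simp: Mpsi[symmetric] inj_def)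
    then show "x = y" using xy hom by (metis homeomorphism_apply1)
  qed
  \<comment> \<open>\<open>?F\<close> is the homeomorphism \<open>\<psi>\<close> followed by the
    invertible matrix \<open>?M z\<close>, hence open.\<close>
  have "?F ` U' = (*v) (?M z) ` V"
    using hom by (auto simp: homeomorphism_def Mpsi[symmetric])
  moreover have "open ((*v) (?M z) ` V)"
    using open_surjective_linear_image[OF V matrix_vector_mul_linear sM] .
  ultimately have "open (?F ` U')" by simp
  moreover have "0 \<in> ?F ` U'" using U'(3) z(2) by (metis image_eqI)
  ultimately obtain \<epsilon>1 where \<epsilon>1: "\<epsilon>1 > 0" "ball 0 \<epsilon>1 \<subseteq> ?F ` U'"
    using open_contains_ball by blast
  show ?thesis
  proof (rule that[OF \<epsilon>1(1)])
    fix \<epsilon> assume \<epsilon>: "0 < \<epsilon>" "\<epsilon> < \<epsilon>1"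
    define S where "S = ?F -` ball 0 \<epsilon> \<inter> U'"
    have U'D: "disc x0 s ` U' \<subseteq> snd c ` fst c" by (rule subset_trans[OF image_mono[OF U'(2)] UD])
    have oS: "open S"
      unfolding S_def using continuous_on_open_vimage[OF U'(1), of ?F] continuous_on_disc_fun[OF f c U'D]
      by blast
    have FS: "?F ` S = ball 0 \<epsilon>"
    proof
      show "ball 0 \<epsilon> \<subseteq> ?F ` S"
      proof
        fix v assume v: "v \<in> ball (0::real^'k) \<epsilon>"
        then have "v \<in> ball 0 \<epsilon>1" using \<epsilon> by simp
        then obtain y where y: "y \<in> U'" "v = ?F y" using \<epsilon>1(2) by blast
        have "y \<in> S" using v y(1) unfolding S_def y(2) by blast
        then show "v \<in> ?F ` S" unfolding y(2) by (rule imageI)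
      qed
    qed (auto simp: S_def)
    have SU: "S \<subseteq> U" using U'(2) by (auto simp: S_def)
    have "ennreal r * emeasure lborel (ball (0::real^'k) \<epsilon>) = ennreal r * emeasure lborel (?F ` S)"
      by (simp only: FS)
    also have "\<dots> = (\<integral>\<^sup>+y. indicator S y * ennreal (r * \<bar>det (?M y)\<bar>) \<partial>lborel)"
    proof (rule nn_integral_det_image_scaled[symmetric, OF _ _ _ _ _ _ r(1)])
      show "?F ` S \<in> sets borel" "emeasure lborel (?F ` S) < \<infinity>"
        unfolding FS using emeasure_lborel_ball_finite[of 0 \<epsilon>] by auto
      show "(?F has_derivative (*v) (?M y)) (at y within S)" if "y \<in> S" for y
        by (rule has_derivative_at_withinI, rule der) (use that SU in blast)
      show "continuous_on S ?M" by (rule continuous_on_subset[OF cM SU])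
      show "inj_on ?F S" by (rule inj_on_subset[OF injF]) (auto simp: S_def)
    qed (use oS in auto)
    also have "\<dots> \<le> (\<integral>\<^sup>+y. indicator (cball 0 \<delta>') y * (indicator (ball 0 \<epsilon>) (?F y) * ennreal (h y)) \<partial>lborel)"
    proof (rule nn_integral_mono)
      fix y
      show "indicator S y * ennreal (r * \<bar>det (?M y)\<bar>)
          \<le> indicator (cball 0 \<delta>') y * (indicator (ball 0 \<epsilon>) (?F y) * ennreal (h y))"
      proof (cases "y \<in> S")
        case True
        then have yU: "y \<in> U" and yF: "?F y \<in> ball 0 \<epsilon>" using SU by (auto simp: S_def)
        have yK: "y \<in> cball 0 \<delta>'" using yU UB by (auto simp: B_def)
        have "r \<le> dir_weight u s (wedge (?D y))" using yU by (auto simp: U_def O1_def)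
        then have "r * \<bar>det (?M y)\<bar> \<le> dir_part u s (wedge (?D y))"
          unfolding dir_part_def det_column_minor by (intro mult_right_mono) auto
        also have "\<dots> \<le> h y" by (rule ge[OF yK])
        finally show ?thesis using True yF yK by (simp add: ennreal_leI)
      qed simp
    qed
    finally show "ennreal r * emeasure lborel (ball (0::real^'k) \<epsilon>) \<le>
     (\<integral>\<^sup>+y. indicator (cball 0 \<delta>') y * (indicator (ball 0 \<epsilon>) (?F y) * ennreal (h y)) \<partial>lborel)" .
  qed
qed

lemma disc_radius:
  fixes s :: "'k::finite \<Rightarrow> 'n"
  assumes c: "c \<in> A" and p: "p \<in> fst c"
  obtains \<delta> where "\<delta> > 0" "disc (snd c p) s ` cball 0 \<delta> \<subseteq> snd c ` fst c"
proof -
  have "open (disc (snd c p) s -` (snd c ` fst c))"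
    by (rule open_vimage[OF open_chart_image[OF A c]]) (rule continuous_on_disc)
  moreover have "0 \<in> disc (snd c p) s -` (snd c ` fst c)" using p by auto
  ultimately obtain \<delta> where "\<delta> > 0" "cball 0 \<delta> \<subseteq> disc (snd c p) s -` (snd c ` fst c)"
    using open_contains_cball by blast
  then show ?thesis using that by blast
qed

lemma disc_in_nbhd:
  fixes s :: "'k::finite \<Rightarrow> 'n"
  assumes c: "c \<in> A" and p: "p \<in> fst c" and U: "open U" "p \<in> U"
  obtains \<delta>1 where "\<delta>1 > 0" "\<And>y. norm y < \<delta>1 \<Longrightarrow> chart_inv c (disc (snd c p) s y) \<in> U"
proof -
  let ?O = "snd c ` (fst c \<inter> U)"
  have "open ?O" by (rule open_chart_overlap[OF A c U(1)])
  then have "open (disc (snd c p) s -` ?O)"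
    by (rule open_vimage) (rule continuous_on_disc)
  moreover have "0 \<in> disc (snd c p) s -` ?O" using p U by auto
  ultimately obtain \<delta>1 where \<delta>1: "\<delta>1 > 0" "ball 0 \<delta>1 \<subseteq> disc (snd c p) s -` ?O"
    using open_contains_ball by blast
  show ?thesis
  proof (rule that[OF \<delta>1(1)])
    fix y :: "real^'k" assume "norm y < \<delta>1"
    then have "y \<in> ball 0 \<delta>1" by simp
    then obtain q where "q \<in> fst c" "q \<in> U" "disc (snd c p) s y = snd c q" using \<delta>1(2) by blast
    then show "chart_inv c (disc (snd c p) s y) \<in> U" using chart_inv_left[OF A c] by simp
  qed
qed

section \<open>The disc functional: dependence on the zero set and measurability\<close>

text \<open>At each common zero the differentials differ by an invertible left factor, which
  multiplies the wedge by a nonzero number that the weight does not see.\<close>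

lemma disc_weight_same_zero_set:
  fixes f h :: "'m \<Rightarrow> real^'k::finite"
  assumes f: "f \<in> regular_maps A" and h: "h \<in> regular_maps A" and z: "zero_set f = zero_set h"
    and c: "c \<in> A" and D: "disc x0 s ` cball 0 \<delta> \<subseteq> snd c ` fst c"
  shows "disc_weight c x0 s u \<delta> f = disc_weight c x0 s u \<delta> h"
proof -
  let ?q = "\<lambda>y. chart_inv c (disc x0 s y)"
  have fh: "f q = 0 \<longleftrightarrow> h q = 0" for q
  proof -
    have "q \<in> zero_set f \<longleftrightarrow> q \<in> zero_set h" by (simp only: z)
    then show ?thesis by (simp add: zero_set_def)
  qed
  have eq: "dir_weight u s (wedge (chart_differential c f (disc x0 s y)))
      = dir_weight u s (wedge (chart_differential c h (disc x0 s y)))"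
    if y: "y \<in> cball 0 \<delta>" "f (?q y) = 0" for y
  proof -
    have yU: "disc x0 s y \<in> snd c ` fst c" by (rule subsetD[OF D imageI[OF y(1)]])
    obtain M where M: "det M \<noteq> 0"
      "chart_differential c h (snd c (?q y)) = M ** chart_differential c f (snd c (?q y))"
      by (rule same_zero_set_differential[OF A f h z c chart_inv_in[OF A c yU] y(2)])
    have "chart_differential c h (disc x0 s y) = M ** chart_differential c f (disc x0 s y)"
      using M(2) unfolding chart_inv_right[OF A c yU] .
    then show ?thesis using M(1) by (simp add: wedge_mult dir_weight_scale)
  qed
  show ?thesis
    unfolding disc_weight_def by (rule SUP_cong) (use eq fh in auto)
qed

text \<open>Clearing the denominator turns the inequality for the weight into a strict
  polynomial-type inequality. It is split into countably many closed conditions with margin 1/(m+1),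
  each covered by \<open>sets_ex_jet\<close>.\<close>

lemma sets_disc_weight:
  fixes s :: "'k::finite \<Rightarrow> 'n"
  assumes t: "0 \<le> t" and c: "c \<in> A" and D: "disc x0 s ` cball 0 \<delta> \<subseteq> snd c ` fst c"
  shows "{f \<in> regular_maps A. ennreal t < disc_weight c x0 s u \<delta> f} \<in> sets (borel_C1 A)"
proof -
  let ?K = "disc x0 s ` cball 0 \<delta>"
  define R where "R m j = min (- norm (fst j))
     (\<bar>wedge (snd j) \<bullet> u\<bar> * \<bar>wedge (snd j) $ s\<bar> - t * (wedge (snd j) \<bullet> wedge (snd j)) - 1 / real (Suc m))"
    for m and j :: "(real^'k) \<times> (real^'n^'k)"
  define B where "B m = {f \<in> C1_maps A. \<exists>x\<in>?K. 0 \<le> R m (chart_jet c f x)}" for m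
  have less: "t < dir_weight u s w \<longleftrightarrow> (\<exists>m. 0 \<le> \<bar>w \<bullet> u\<bar> * \<bar>w $ s\<bar> - t * (w \<bullet> w) - 1 / real (Suc m))" for w
  proof -
    have "t < dir_weight u s w \<longleftrightarrow> 0 < \<bar>w \<bullet> u\<bar> * \<bar>w $ s\<bar> - t * (w \<bullet> w)"
    proof (cases "w = 0")
      case False
      then have "0 < w \<bullet> w" by simp
      then show ?thesis by (simp add: dir_weight_def pos_less_divide_eq)
    qed (use t in \<open>simp add: dir_weight_def\<close>)
    also have "\<dots> \<longleftrightarrow> (\<exists>m. 1 / real (Suc m) \<le> \<bar>w \<bullet> u\<bar> * \<bar>w $ s\<bar> - t * (w \<bullet> w))"
    proof
      assume "0 < \<bar>w \<bullet> u\<bar> * \<bar>w $ s\<bar> - t * (w \<bullet> w)"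
      then obtain m where "inverse (real (Suc m)) < \<bar>w \<bullet> u\<bar> * \<bar>w $ s\<bar> - t * (w \<bullet> w)"
        using reals_Archimedean by blast
      then show "\<exists>m. 1 / real (Suc m) \<le> \<bar>w \<bullet> u\<bar> * \<bar>w $ s\<bar> - t * (w \<bullet> w)"
        by (intro exI[of _ m]) (simp add: inverse_eq_divide)
    next
      assume "\<exists>m. 1 / real (Suc m) \<le> \<bar>w \<bullet> u\<bar> * \<bar>w $ s\<bar> - t * (w \<bullet> w)"
      then obtain m where "1 / real (Suc m) \<le> \<bar>w \<bullet> u\<bar> * \<bar>w $ s\<bar> - t * (w \<bullet> w)" by blast
      moreover have "0 < 1 / real (Suc m)" by simp
      ultimately show "0 < \<bar>w \<bullet> u\<bar> * \<bar>w $ s\<bar> - t * (w \<bullet> w)" by linarith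
    qed
    finally show ?thesis by simp
  qed
  have "B m \<in> sets (borel_C1 A)" for m
    unfolding B_def
  proof (rule sets_ex_jet[OF A c _ D])
    show "compact ?K" by (intro compact_continuous_image continuous_on_disc compact_cball)
    have cw: "continuous_on UNIV (\<lambda>j :: (real^'k) \<times> (real^'n^'k). wedge (snd j))"
      by (rule continuous_on_compose2[OF continuous_on_wedge]) (auto intro: continuous_intros)
    have "continuous_on UNIV (R m)"
      unfolding R_def by (intro continuous_intros cw)
    then show "continuous_on (?K \<times> UNIV) (\<lambda>(x, j). R m j)"
      unfolding split_beta by (rule continuous_on_compose2) (auto intro!: continuous_intros)
  qed
  then have "regular_maps A \<inter> (\<Union>m. B m) \<in> sets (borel_C1 A)"
    using sets_regular_maps[OF A] by blast
  also have "regular_maps A \<inter> (\<Union>m. B m) = {f \<in> regular_maps A. ennreal t < disc_weight c x0 s u \<delta> f}"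
  proof -
    have "(\<exists>m. \<exists>x\<in>?K. 0 \<le> R m (chart_jet c f x)) \<longleftrightarrow> ennreal t < disc_weight c x0 s u \<delta> f" for f
    proof -
      have "(\<exists>m. \<exists>x\<in>?K. 0 \<le> R m (chart_jet c f x)) \<longleftrightarrow>
        (\<exists>y\<in>cball 0 \<delta>. f (chart_inv c (disc x0 s y)) = 0 \<and> t < dir_weight u s (wedge (chart_differential c f (disc x0 s y))))"
        unfolding less by (auto simp: R_def chart_jet_def)
      then show ?thesis unfolding less_disc_weight_iff using t by (simp add: ennreal_less_iff)
    qed
    then show ?thesis by (auto simp: B_def regular_maps_def)
  qed
  finally show ?thesis .
qed

end

section \<open>Expectations over shrinking discs\<close>

text \<open>Upper tails identify the two distributions, and for nonnegative functions the tails at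
  negative levels are the whole space.\<close>

lemma nn_integral_eq_of_tails:
  fixes F :: "'a \<Rightarrow> real" and H :: "'b \<Rightarrow> real"
  assumes M: "prob_space M" and N: "prob_space N"
    and F: "F \<in> borel_measurable M" "\<And>x. 0 \<le> F x" and H: "H \<in> borel_measurable N" "\<And>x. 0 \<le> H x"
    and eq: "\<And>t. 0 \<le> t \<Longrightarrow> measure M {x \<in> space M. t < F x} = measure N {x \<in> space N. t < H x}"
  shows "(\<integral>\<^sup>+x. ennreal (F x) \<partial>M) = (\<integral>\<^sup>+x. ennreal (H x) \<partial>N)"
proof -
  interpret M: prob_space M by (rule M)
  interpret N: prob_space N by (rule N)
  note [measurable] = F(1) H(1)
  have "distr M borel F = distr N borel H"
  proof (rule measure_eqI_lessThan)
    fix t :: real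
    have e: "emeasure (distr M borel F) {t<..} = emeasure M {x \<in> space M. t < F x}"
      "emeasure (distr N borel H) {t<..} = emeasure N {x \<in> space N. t < H x}"
      by (subst emeasure_distr; auto intro!: arg_cong2[where f = emeasure])+
    show "emeasure (distr M borel F) {t<..} < \<infinity>"
      unfolding e by (simp add: M.emeasure_eq_measure)
    show "emeasure (distr M borel F) {t<..} = emeasure (distr N borel H) {t<..}"
    proof (cases "0 \<le> t")
      case True
      then show ?thesis unfolding e by (simp add: M.emeasure_eq_measure N.emeasure_eq_measure eq)
    next
      case False
      then have "{x \<in> space M. t < F x} = space M" "{x \<in> space N. t < H x} = space N"
        using F(2) H(2) by (auto intro: less_le_trans[of t 0])
      then show ?thesis unfolding e by (simp add: M.emeasure_space_1 N.emeasure_space_1)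
    qed
  qed simp_all
  then have "(\<integral>\<^sup>+t. ennreal t \<partial>distr M borel F) = (\<integral>\<^sup>+t. ennreal t \<partial>distr N borel H)" by simp
  then show ?thesis by (simp add: nn_integral_distr)
qed

lemma volume_ball:
  "0 < \<epsilon> \<Longrightarrow> emeasure lborel (ball (0::real^'k::finite) \<epsilon>) \<noteq> 0"
  "emeasure lborel (ball (0::real^'k::finite) \<epsilon>) \<noteq> \<infinity>"
proof -
  show "emeasure lborel (ball (0::real^'k::finite) \<epsilon>) \<noteq> \<infinity>"
    using emeasure_lborel_ball_finite[of "0::real^'k" \<epsilon>] by (simp add: less_top)
  assume "0 < \<epsilon>"
  then show "emeasure lborel (ball (0::real^'k::finite) \<epsilon>) \<noteq> 0"
  proof -
    have "0 < unit_ball_vol (real CARD('k))" by (rule unit_ball_vol_pos) simp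
    then have "unit_ball_vol (real CARD('k)) \<noteq> 0" by linarith
    then show ?thesis using \<open>0 < \<epsilon>\<close> by (simp add: emeasure_ball)
  qed
qed

lemma nn_integral_cball_const:
  "(\<integral>\<^sup>+y. indicator (cball (0::real^'k::finite) \<delta>) y * t \<partial>lborel) = t * emeasure lborel (cball (0::real^'k) \<delta>)"
  by (subst mult.commute) (simp add: nn_integral_cmult_indicator)

context
  fixes A :: "('m::{t2_space,second_countable_topology}, 'n::finite) chart set"
    and g :: "'m \<Rightarrow> real^'n^'n"
  assumes A: "smooth_atlas A" and g: "riemannian_metric A g"
begin

lemma jac_disc:
  fixes f :: "'m \<Rightarrow> real^'k::finite"
  assumes f: "f \<in> C1_maps A" and c: "c \<in> A" and y: "disc x0 s y \<in> snd c ` fst c"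
  shows "jac A g (chart_inv c (disc x0 s y)) f
     = gram_jac (metric_coeffs A g c (disc x0 s y)) (chart_differential c f (disc x0 s y))"
  using jac_chart[OF A g f c chart_inv_in[OF A c y]] by (simp only: chart_inv_right[OF A c y])

lemma continuous_on_jac_disc:
  fixes f :: "'m \<Rightarrow> real^'k::finite"
  assumes f: "f \<in> C1_maps A" and c: "c \<in> A" and S: "disc x0 s ` S \<subseteq> snd c ` fst c"
  shows "continuous_on S (\<lambda>y. jac A g (chart_inv c (disc x0 s y)) f)"
proof -
  have S': "disc x0 s y \<in> snd c ` fst c" if "y \<in> S" for y by (rule subsetD[OF S imageI[OF that]])
  have "continuous_on S (\<lambda>y. gram_jac (metric_coeffs A g c (disc x0 s y)) (chart_differential c f (disc x0 s y)))"
  proof (rule continuous_on_gram_jac)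
    show "pos_def_matrix (metric_coeffs A g c (disc x0 s y))" if "y \<in> S" for y
      by (rule pos_def_metric_coeffs[OF A g c S'[OF that]])
    show "continuous_on S (\<lambda>y. metric_coeffs A g c (disc x0 s y))"
      by (rule continuous_on_compose2[OF continuous_on_metric_coeffs[OF A g c] continuous_on_disc S])
    show "continuous_on S (\<lambda>y. chart_differential c f (disc x0 s y))"
      by (rule continuous_on_disc_differential[OF A f c S])
  qed
  then show ?thesis
    by (rule continuous_on_eq) (rule jac_disc[OF f c S', symmetric])
qed

text \<open>The Kac-Rice approximation before division by the volume of the
  \<open>\<epsilon>\<close>-ball. The number \<open>\<Theta> f\<close>, constant along the disc,
  takes the place of the quotient of \<open>dir_part\<close> by the Jacobian at the individual
  points.\<close>

definition smoothed ::
    "('m, 'n) chart \<Rightarrow> real^'n \<Rightarrow> ('k::finite \<Rightarrow> 'n) \<Rightarrow> (('m \<Rightarrow> real^'k) \<Rightarrow> real) \<Rightarrow> real \<Rightarrow> real \<Rightarrow> ('m \<Rightarrow> real^'k) \<Rightarrow> ennreal" where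
  "smoothed c x0 s \<Theta> \<delta> \<epsilon> f = (\<integral>\<^sup>+y. indicator (cball 0 \<delta>) y * (indicator (ball 0 \<epsilon>) (f (chart_inv c (disc x0 s y))) *
     ennreal (\<Theta> f * jac A g (chart_inv c (disc x0 s y)) f)) \<partial>lborel)"

text \<open>The integrand is continuous in the point and measurable in the sample, hence jointly
  measurable, and the integrals may be exchanged.\<close>

lemma smoothed_measurable_Fubini:
  fixes X :: "'a \<Rightarrow> 'm \<Rightarrow> real^'k::finite"
  assumes P: "prob_space P" and X: "X \<in> measurable P (borel_C1 A)"
    and \<Theta>: "continuous_map (weak_whitney A) euclideanreal \<Theta>"
    and c: "c \<in> A" and \<delta>: "0 \<le> \<delta>" and D: "disc x0 s ` cball 0 \<delta> \<subseteq> snd c ` fst c"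
  shows "(\<lambda>\<omega>. smoothed c x0 s \<Theta> \<delta> \<epsilon> (X \<omega>)) \<in> borel_measurable P" (is ?meas)
    and "(\<integral>\<^sup>+\<omega>. smoothed c x0 s \<Theta> \<delta> \<epsilon> (X \<omega>) \<partial>P) =
      (\<integral>\<^sup>+y. indicator (cball 0 \<delta>) y * (\<integral>\<^sup>+\<omega>. indicator (ball 0 \<epsilon>) (X \<omega> (chart_inv c (disc x0 s y))) *
         ennreal (\<Theta> (X \<omega>) * jac A g (chart_inv c (disc x0 s y)) (X \<omega>)) \<partial>P) \<partial>lborel)" (is ?fubini)
proof -
  interpret P: prob_space P by (rule P)
  interpret pair_sigma_finite lborel P ..
  let ?K = "cball (0::real^'k) \<delta>"
  let ?q = "\<lambda>y. chart_inv c (disc x0 s y)"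
  \<comment> \<open>The projection to the disc extends the integrand continuously to the whole of
    \<open>real^'k\<close>, as \<open>borel_measurable_caratheodory\<close> requires; on the disc it
    is the identity.\<close>
  define r where "r = closest_point ?K"
  have rK: "r y \<in> ?K" for y unfolding r_def by (rule closest_point_in_set) (use \<delta> in auto)
  have r_id: "r y = y" if "y \<in> ?K" for y unfolding r_def by (rule closest_point_self[OF that])
  have cr: "continuous_on UNIV r" unfolding r_def by (rule continuous_on_closest_point) (use \<delta> in auto)
  have rD: "disc x0 s (r y) \<in> snd c ` fst c" for y by (rule subsetD[OF D imageI[OF rK]])
  have XC: "X \<omega> \<in> C1_maps A" if "\<omega> \<in> space P" for \<omega>
    using measurable_space[OF X that] by (simp add: space_borel_C1[OF A])
  \<comment> \<open>Membership in the ball depends on the norm of the value only, and the norm is a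
    real function, to which the measurability lemma applies.\<close>
  have nm: "(\<lambda>z. norm (X (snd z) (?q (r (fst z))))) \<in> borel_measurable (borel \<Otimes>\<^sub>M P)"
  proof (rule borel_measurable_caratheodory[where F = "\<lambda>y \<omega>. norm (X \<omega> (?q (r y)))"])
    fix \<omega> assume "\<omega> \<in> space P"
    then have "continuous_on UNIV (\<lambda>y. X \<omega> (?q (r y)))"
      by (intro continuous_on_compose2[OF continuous_on_disc_fun[OF A XC c D] cr]) (use rK in auto)
    then show "continuous_on UNIV (\<lambda>y. norm (X \<omega> (?q (r y))))" by (rule continuous_on_norm)
  next
    fix y
    have "continuous_map (weak_whitney A) euclideanreal (\<lambda>f :: 'm \<Rightarrow> real^'k. norm (fst (chart_jet c f (disc x0 s (r y)))))"
      by (rule continuous_map_jet[OF A c rD, where R = "\<lambda>j. norm (fst j)"]) (intro continuous_intros)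
    from measurable_compose[OF X borel_measurable_continuous_map[OF A this]]
    show "(\<lambda>\<omega>. norm (X \<omega> (?q (r y)))) \<in> borel_measurable P" by (simp add: chart_jet_def)
  qed
  have [measurable]: "(\<lambda>z. jac A g (?q (r (fst z))) (X (snd z))) \<in> borel_measurable (borel \<Otimes>\<^sub>M P)"
  proof (rule borel_measurable_caratheodory[where F = "\<lambda>y \<omega>. jac A g (?q (r y)) (X \<omega>)"])
    fix \<omega> assume "\<omega> \<in> space P"
    then show "continuous_on UNIV (\<lambda>y. jac A g (?q (r y)) (X \<omega>))"
      by (intro continuous_on_compose2[OF continuous_on_jac_disc[OF XC c D] cr]) (use rK in auto)
  next
    fix y
    show "(\<lambda>\<omega>. jac A g (?q (r y)) (X \<omega>)) \<in> borel_measurable P"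
      by (rule measurable_compose[OF X borel_measurable_continuous_map[OF A continuous_map_jac[OF A g]]])
  qed
  have [measurable]: "(\<lambda>\<omega>. \<Theta> (X \<omega>)) \<in> borel_measurable P"
    by (rule measurable_compose[OF X borel_measurable_continuous_map[OF A \<Theta>]])
  define H where "H z = indicator ?K (fst z) * (indicator {..<\<epsilon>} (norm (X (snd z) (?q (r (fst z))))) *
     ennreal (\<Theta> (X (snd z)) * jac A g (?q (r (fst z))) (X (snd z))))" for z
  have H: "H \<in> borel_measurable (lborel \<Otimes>\<^sub>M P)"
  proof -
    have [measurable]: "(\<lambda>z. indicator ?K (fst z) :: ennreal) \<in> borel_measurable (borel \<Otimes>\<^sub>M P)"
      by (rule measurable_compose[OF measurable_fst]) (intro borel_measurable_indicator borel_closed closed_cball)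
    have [measurable]: "(\<lambda>z. indicator {..<\<epsilon>} (norm (X (snd z) (?q (r (fst z))))) :: ennreal) \<in> borel_measurable (borel \<Otimes>\<^sub>M P)"
      by (rule measurable_compose[OF nm]) simp
    have [measurable]: "(\<lambda>z. \<Theta> (X (snd z))) \<in> borel_measurable (borel \<Otimes>\<^sub>M P)"
      by (rule measurable_compose[OF measurable_snd]) fact
    have "H \<in> borel_measurable (borel \<Otimes>\<^sub>M P)"
      unfolding H_def by (intro borel_measurable_times_ennreal) measurable
    moreover have "sets (lborel \<Otimes>\<^sub>M P) = sets (borel \<Otimes>\<^sub>M P :: ((real^'k) \<times> 'a) measure)"
      by (intro sets_pair_measure_cong) auto
    ultimately show ?thesis using measurable_cong_sets by blast
  qed
  have Heq: "indicator ?K y * (indicator (ball 0 \<epsilon>) (X \<omega> (?q y)) * ennreal (\<Theta> (X \<omega>) * jac A g (?q y) (X \<omega>))) = H (y, \<omega>)"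
    for y \<omega>
  proof (cases "y \<in> ?K")
    case True
    then show ?thesis by (simp add: H_def r_id indicator_def)
  qed (simp add: H_def)
  have sm: "smoothed c x0 s \<Theta> \<delta> \<epsilon> (X \<omega>) = (\<integral>\<^sup>+y. H (y, \<omega>) \<partial>lborel)" for \<omega>
    unfolding smoothed_def Heq ..
  have swap: "(\<lambda>z. H (snd z, fst z)) \<in> borel_measurable (P \<Otimes>\<^sub>M lborel)"
    using measurable_pair_swap[OF H] by (simp add: split_beta)
  show ?meas
    unfolding sm using lborel.borel_measurable_nn_integral_fst[OF swap] by simp
  have "(\<integral>\<^sup>+\<omega>. smoothed c x0 s \<Theta> \<delta> \<epsilon> (X \<omega>) \<partial>P) = (\<integral>\<^sup>+y. \<integral>\<^sup>+\<omega>. H (y, \<omega>) \<partial>P \<partial>lborel)"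
    unfolding sm by (rule Fubini[OF H])
  also have "\<dots> = (\<integral>\<^sup>+y. indicator ?K y * (\<integral>\<^sup>+\<omega>. indicator (ball 0 \<epsilon>) (X \<omega> (?q y)) *
         ennreal (\<Theta> (X \<omega>) * jac A g (?q y) (X \<omega>)) \<partial>P) \<partial>lborel)"
    by (intro nn_integral_cong) (simp add: Heq[symmetric] indicator_def)
  finally show ?fubini .
qed

text \<open>For each sample the quotients of \<open>smoothed\<close> by the ball volume have limsup
  at most the disc weight, and they stay below \<open>norm u\<close>, so the reverse Fatou lemma
  applies. Their expectations are bounded below by \<open>z_KROK_average\<close>, integrated along
  the disc.\<close>

lemma expectation_disc_weight_ge:
  fixes X :: "'a \<Rightarrow> 'm \<Rightarrow> real^'k::finite" and \<Theta> :: "('m \<Rightarrow> real^'k) \<Rightarrow> real" and p :: 'm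
  assumes zk: "z_KROK A g P X \<rho> \<mu>" and c: "c \<in> A" and p: "p \<in> fst c"
    and \<Theta>: "continuous_map (weak_whitney A) euclideanreal \<Theta>" "\<And>f. f \<in> C1_maps A \<Longrightarrow> 0 \<le> \<Theta> f"
       "\<And>f. f \<in> C1_maps A \<Longrightarrow> \<Theta> f \<le> B"
    and \<delta>0: "\<delta>0 > 0" and D: "disc (snd c p) s ` cball 0 \<delta>0 \<subseteq> snd c ` fst c"
    and le: "\<And>f y. f \<in> C1_maps A \<Longrightarrow> y \<in> cball 0 \<delta>0 \<Longrightarrow> \<Theta> f * jac A g (chart_inv c (disc (snd c p) s y)) f
       \<le> dir_part u s (wedge (chart_differential c f (disc (snd c p) s y)))"
    and inj: "\<And>f. f \<in> C1_maps A \<Longrightarrow> 0 < \<Theta> f \<Longrightarrow> inj_on (\<lambda>y. f (chart_inv c (disc (snd c p) s y))) (cball 0 \<delta>0)"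
    and nz: "\<And>f y. f \<in> C1_maps A \<Longrightarrow> 0 < \<Theta> f \<Longrightarrow> y \<in> cball 0 \<delta>0 \<Longrightarrow> wedge (chart_differential c f (disc (snd c p) s y)) \<noteq> 0"
    and \<eta>: "\<eta> > 0"
  obtains \<delta>1 where "\<delta>1 > 0" "\<And>\<delta>. 0 < \<delta> \<Longrightarrow> \<delta> < \<delta>1 \<Longrightarrow>
     ennreal (\<rho> p 0 * (\<integral>f. \<Theta> f \<partial>jac_measure A g p (\<mu> p 0)) - \<eta>) * emeasure lborel (cball (0::real^'k) \<delta>)
      \<le> (\<integral>\<^sup>+\<omega>. disc_weight c (snd c p) s u \<delta> (X \<omega>) \<partial>P)"
proof -
  let ?x0 = "snd c p"
  let ?q = "\<lambda>y. chart_inv c (disc ?x0 s y)"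
  define G where "G = \<rho> p 0 * (\<integral>f. \<Theta> f \<partial>jac_measure A g p (\<mu> p 0))"
  have P: "prob_space P" and X: "X \<in> measurable P (borel_C1 A)" using zk unfolding z_KROK_def by auto
  interpret P: prob_space P by (rule P)
  have XC: "X \<omega> \<in> C1_maps A" if "\<omega> \<in> space P" for \<omega>
    using measurable_space[OF X that] by (simp add: space_borel_C1[OF A])
  obtain U \<epsilon>0 where U: "open U" "p \<in> U" and \<epsilon>0: "\<epsilon>0 > 0"
    and avg: "\<And>q \<epsilon>. q \<in> U \<Longrightarrow> 0 < \<epsilon> \<Longrightarrow> \<epsilon> < \<epsilon>0 \<Longrightarrow> ennreal (G - \<eta>) * emeasure lborel (ball (0::real^'k) \<epsilon>)
        \<le> (\<integral>\<^sup>+\<omega>. indicator (ball 0 \<epsilon>) (X \<omega> q) * ennreal (\<Theta> (X \<omega>) * jac A g q (X \<omega>)) \<partial>P)"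
    by (rule z_KROK_average[OF A g zk \<Theta> \<eta>, of p, folded G_def], assumption, assumption) (rule that)
  obtain \<delta>1 where \<delta>1: "\<delta>1 > 0" "\<And>y :: real^'k. norm y < \<delta>1 \<Longrightarrow> ?q y \<in> U"
    using disc_in_nbhd[OF A c p U] by blast
  show ?thesis
  proof (rule that[of "min \<delta>0 \<delta>1", folded G_def])
    show "0 < min \<delta>0 \<delta>1" using \<delta>0 \<delta>1 by simp
    fix \<delta> assume \<delta>: "0 < \<delta>" "\<delta> < min \<delta>0 \<delta>1"
    have sub: "cball (0::real^'k) \<delta> \<subseteq> cball 0 \<delta>0" using \<delta> by auto
    have D\<delta>: "disc ?x0 s ` cball 0 \<delta> \<subseteq> snd c ` fst c" by (rule subset_trans[OF image_mono[OF sub] D])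
    \<comment> \<open>The 2 in the denominator keeps every radius strictly below
      \<open>\<epsilon>0\<close>, also for \<open>n = 0\<close>.\<close>
    define e where "e n = \<epsilon>0 / (real n + 2)" for n
    have e: "0 < e n" "e n < \<epsilon>0" for n using \<epsilon>0 by (simp_all add: e_def field_simps add_pos_nonneg)
    have e0: "e \<longlonglongrightarrow> 0" unfolding e_def by real_asymp
    define v where "v n = emeasure lborel (ball (0::real^'k) (e n))" for n
    have v: "v n \<noteq> 0" "v n \<noteq> \<infinity>" for n unfolding v_def using volume_ball e by auto
    define J where "J n \<omega> = smoothed c ?x0 s \<Theta> \<delta> (e n) (X \<omega>) / v n" for n \<omega>
    note sm = smoothed_measurable_Fubini[OF P X \<Theta>(1) c less_imp_le[OF \<delta>(1)] D\<delta>]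
    have Jm: "J n \<in> borel_measurable P" for n
      unfolding J_def using sm(1)[of "e n"] by measurable
    have int: "ennreal (G - \<eta>) * emeasure lborel (cball (0::real^'k) \<delta>) \<le> (\<integral>\<^sup>+\<omega>. J n \<omega> \<partial>P)" for n
    proof -
      have "ennreal (G - \<eta>) * v n * emeasure lborel (cball (0::real^'k) \<delta>)
          = (\<integral>\<^sup>+y. indicator (cball (0::real^'k) \<delta>) y * (ennreal (G - \<eta>) * v n) \<partial>lborel)"
        by (rule nn_integral_cball_const[symmetric])
      also have "\<dots> \<le> (\<integral>\<^sup>+\<omega>. smoothed c ?x0 s \<Theta> \<delta> (e n) (X \<omega>) \<partial>P)"
        unfolding sm(2)
      proof (rule nn_integral_mono)
        fix y :: "real^'k"
        show "indicator (cball 0 \<delta>) y * (ennreal (G - \<eta>) * v n) \<le> indicator (cball 0 \<delta>) y *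
           (\<integral>\<^sup>+\<omega>. indicator (ball 0 (e n)) (X \<omega> (?q y)) * ennreal (\<Theta> (X \<omega>) * jac A g (?q y) (X \<omega>)) \<partial>P)"
        proof (cases "y \<in> cball 0 \<delta>")
          case True
          then have "?q y \<in> U" using \<delta> by (intro \<delta>1(2)) simp
          then show ?thesis using avg[of "?q y" "e n"] e True by (simp add: v_def)
        qed simp
      qed
      finally have "ennreal (G - \<eta>) * v n * emeasure lborel (cball (0::real^'k) \<delta>) / v n
          \<le> (\<integral>\<^sup>+\<omega>. smoothed c ?x0 s \<Theta> \<delta> (e n) (X \<omega>) \<partial>P) / v n"
        by (rule divide_right_mono_ennreal)
      also have "ennreal (G - \<eta>) * v n * emeasure lborel (cball (0::real^'k) \<delta>) / v n
          = (ennreal (G - \<eta>) * emeasure lborel (cball (0::real^'k) \<delta>)) * v n / v n"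
        by (simp only: ac_simps)
      also have "\<dots> = ennreal (G - \<eta>) * emeasure lborel (cball (0::real^'k) \<delta>)"
        using v[of n] by (intro ennreal_mult_divide_eq) auto
      also have "(\<integral>\<^sup>+\<omega>. smoothed c ?x0 s \<Theta> \<delta> (e n) (X \<omega>) \<partial>P) / v n = (\<integral>\<^sup>+\<omega>. J n \<omega> \<partial>P)"
        unfolding J_def by (rule nn_integral_divide[OF sm(1), symmetric])
      finally show ?thesis .
    qed
    \<comment> \<open>Injectivity and nondegeneracy are assumed where \<open>\<Theta>\<close> is
      positive; all other samples contribute nothing to the integral.\<close>
    have zero: "J n \<omega> = 0" if "\<not> 0 < \<Theta> (X \<omega>)" "\<omega> \<in> space P" for n \<omega>
    proof -
      have "\<Theta> (X \<omega>) = 0" using that \<Theta>(2)[OF XC[OF that(2)]] by simp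
      then show ?thesis by (simp add: J_def smoothed_def)
    qed
    have bound: "J n \<omega> \<le> ennreal (norm u)" if \<omega>: "\<omega> \<in> space P" for n \<omega>
    proof (cases "0 < \<Theta> (X \<omega>)")
      case True
      have "smoothed c ?x0 s \<Theta> \<delta> (e n) (X \<omega>) \<le> ennreal (norm u) * v n"
        unfolding smoothed_def v_def
      proof (rule integral_near_zeros_le[OF A XC[OF \<omega>] c D\<delta> inj_on_subset[OF inj[OF XC[OF \<omega>] True] sub] norm_ge_zero])
        fix y assume "y \<in> cball (0::real^'k) \<delta>"
        then have "y \<in> cball 0 \<delta>0" using sub by blast
        from le[OF XC[OF \<omega>] this] show "\<Theta> (X \<omega>) * jac A g (?q y) (X \<omega>)
            \<le> norm u * \<bar>wedge (chart_differential c (X \<omega>) (disc ?x0 s y)) $ s\<bar>"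
          by (rule order_trans) (simp add: dir_part_def mult_right_mono dir_weight_le)
      qed
      then have "J n \<omega> \<le> ennreal (norm u) * v n / v n" unfolding J_def by (rule divide_right_mono_ennreal)
      then show ?thesis using v[of n] by (simp add: ennreal_mult_divide_eq)
    qed (simp add: zero \<omega>)
    have limsup: "limsup (\<lambda>n. J n \<omega>) \<le> disc_weight c ?x0 s u \<delta> (X \<omega>)" if \<omega>: "\<omega> \<in> space P" for \<omega>
    proof (cases "0 < \<Theta> (X \<omega>)")
      case True
      show ?thesis
      proof (rule ennreal_le_epsilon)
        fix k :: real assume k: "0 < k"
        have inj\<delta>: "inj_on (\<lambda>y. X \<omega> (?q y)) (cball 0 \<delta>)" by (rule inj_on_subset[OF inj[OF XC[OF \<omega>] True] sub])
        obtain \<epsilon>1 where \<epsilon>1: "\<epsilon>1 > 0" "\<And>\<epsilon>. 0 < \<epsilon> \<Longrightarrow> \<epsilon> < \<epsilon>1 \<Longrightarrow>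
           smoothed c ?x0 s \<Theta> \<delta> \<epsilon> (X \<omega>) \<le> (disc_weight c ?x0 s u \<delta> (X \<omega>) + ennreal k) * emeasure lborel (ball (0::real^'k) \<epsilon>)"
          unfolding smoothed_def
          by (rule integral_near_zeros_eventually_le[OF A XC[OF \<omega>] c D\<delta> inj\<delta> _ _ k,
                of "\<lambda>y. \<Theta> (X \<omega>) * jac A g (?q y) (X \<omega>)"])
            (use nz[OF XC[OF \<omega>] True] le[OF XC[OF \<omega>]] sub that in blast)+
        have "\<forall>\<^sub>F n in sequentially. J n \<omega> \<le> disc_weight c ?x0 s u \<delta> (X \<omega>) + ennreal k"
          using order_tendstoD(2)[OF e0 \<epsilon>1(1)]
        proof eventually_elim
          case (elim n)
          then have "J n \<omega> \<le> (disc_weight c ?x0 s u \<delta> (X \<omega>) + ennreal k) * v n / v n"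
            unfolding J_def v_def using e by (intro divide_right_mono_ennreal \<epsilon>1(2))
          then show ?case using v[of n] by (simp add: ennreal_mult_divide_eq)
        qed
        then show "limsup (\<lambda>n. J n \<omega>) \<le> disc_weight c ?x0 s u \<delta> (X \<omega>) + ennreal k"
          by (rule Limsup_bounded)
      qed
    next
      case False
      then have "limsup (\<lambda>n. J n \<omega>) = limsup (\<lambda>n. 0 :: ennreal)" using zero \<omega> by simp
      then show ?thesis by (simp add: Limsup_const)
    qed
    have "ennreal (G - \<eta>) * emeasure lborel (cball (0::real^'k) \<delta>) \<le> limsup (\<lambda>n. \<integral>\<^sup>+\<omega>. J n \<omega> \<partial>P)"
      using int by (intro le_Limsup) auto
    also have "\<dots> \<le> (\<integral>\<^sup>+\<omega>. limsup (\<lambda>n. J n \<omega>) \<partial>P)"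
      by (rule nn_integral_limsup[where w = "\<lambda>_. ennreal (norm u)"])
        (use Jm bound in \<open>auto simp: P.emeasure_space_1\<close>)
    also have "\<dots> \<le> (\<integral>\<^sup>+\<omega>. disc_weight c ?x0 s u \<delta> (X \<omega>) \<partial>P)"
      by (intro nn_integral_mono limsup)
    finally show "ennreal (G - \<eta>) * emeasure lborel (cball (0::real^'k) \<delta>)
      \<le> (\<integral>\<^sup>+\<omega>. disc_weight c ?x0 s u \<delta> (X \<omega>) \<partial>P)" .
  qed
qed

text \<open>Every level below the disc weight is eventually exceeded or attained by the quotients,
  so Fatou's lemma applies. The larger radius \<open>\<delta>'\<close> gives a zero on the boundary
  sphere of the smaller disc a full neighbourhood in the domain of integration.\<close>

lemma expectation_disc_weight_le:
  fixes X :: "'a \<Rightarrow> 'm \<Rightarrow> real^'k::finite" and \<Theta> :: "('m \<Rightarrow> real^'k) \<Rightarrow> real" and p :: 'm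
  assumes zk: "z_KROK A g P X \<rho> \<mu>" and c: "c \<in> A" and p: "p \<in> fst c"
    and \<Theta>: "continuous_map (weak_whitney A) euclideanreal \<Theta>" "\<And>f. f \<in> C1_maps A \<Longrightarrow> 0 \<le> \<Theta> f"
       "\<And>f. f \<in> C1_maps A \<Longrightarrow> \<Theta> f \<le> B"
    and \<delta>0: "\<delta>0 > 0" and D: "disc (snd c p) s ` cball 0 \<delta>0 \<subseteq> snd c ` fst c"
    and ge: "\<And>f y. f \<in> C1_maps A \<Longrightarrow> y \<in> cball 0 \<delta>0 \<Longrightarrow>
       dir_part u s (wedge (chart_differential c f (disc (snd c p) s y)))
        \<le> \<Theta> f * jac A g (chart_inv c (disc (snd c p) s y)) f"
    and \<eta>: "\<eta> > 0"
  obtains \<delta>1 where "\<delta>1 > 0" "\<And>\<delta> \<delta>'. 0 < \<delta> \<Longrightarrow> \<delta> < \<delta>' \<Longrightarrow> \<delta>' < \<delta>1 \<Longrightarrow>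
     (\<integral>\<^sup>+\<omega>. disc_weight c (snd c p) s u \<delta> (X \<omega>) \<partial>P) \<le>
     ennreal (\<rho> p 0 * (\<integral>f. \<Theta> f \<partial>jac_measure A g p (\<mu> p 0)) + \<eta>) * emeasure lborel (cball (0::real^'k) \<delta>')"
proof -
  let ?x0 = "snd c p"
  let ?q = "\<lambda>y. chart_inv c (disc ?x0 s y)"
  define G where "G = \<rho> p 0 * (\<integral>f. \<Theta> f \<partial>jac_measure A g p (\<mu> p 0))"
  have P: "prob_space P" and X: "X \<in> measurable P (borel_C1 A)" using zk unfolding z_KROK_def by auto
  interpret P: prob_space P by (rule P)
  have XC: "X \<omega> \<in> C1_maps A" if "\<omega> \<in> space P" for \<omega>
    using measurable_space[OF X that] by (simp add: space_borel_C1[OF A])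
  obtain U \<epsilon>0 where U: "open U" "p \<in> U" and \<epsilon>0: "\<epsilon>0 > 0"
    and avg: "\<And>q \<epsilon>. q \<in> U \<Longrightarrow> 0 < \<epsilon> \<Longrightarrow> \<epsilon> < \<epsilon>0 \<Longrightarrow>
        (\<integral>\<^sup>+\<omega>. indicator (ball 0 \<epsilon>) (X \<omega> q) * ennreal (\<Theta> (X \<omega>) * jac A g q (X \<omega>)) \<partial>P)
         \<le> ennreal (G + \<eta>) * emeasure lborel (ball (0::real^'k) \<epsilon>)"
    by (rule z_KROK_average[OF A g zk \<Theta> \<eta>, of p, folded G_def], assumption, assumption) (rule that)
  obtain \<delta>1 where \<delta>1: "\<delta>1 > 0" "\<And>y :: real^'k. norm y < \<delta>1 \<Longrightarrow> ?q y \<in> U"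
    using disc_in_nbhd[OF A c p U] by blast
  show ?thesis
  proof (rule that[of "min \<delta>0 \<delta>1", folded G_def])
    show "0 < min \<delta>0 \<delta>1" using \<delta>0 \<delta>1 by simp
    fix \<delta> \<delta>' assume \<delta>: "0 < \<delta>" "\<delta> < \<delta>'" "\<delta>' < min \<delta>0 \<delta>1"
    have \<delta>': "0 \<le> \<delta>'" using \<delta> by simp
    have sub: "cball (0::real^'k) \<delta>' \<subseteq> cball 0 \<delta>0" using \<delta> by auto
    have D\<delta>: "disc ?x0 s ` cball 0 \<delta>' \<subseteq> snd c ` fst c" by (rule subset_trans[OF image_mono[OF sub] D])
    define e where "e n = \<epsilon>0 / (real n + 2)" for n
    have e: "0 < e n" "e n < \<epsilon>0" for n using \<epsilon>0 by (simp_all add: e_def field_simps add_pos_nonneg)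
    have e0: "e \<longlonglongrightarrow> 0" unfolding e_def by real_asymp
    define v where "v n = emeasure lborel (ball (0::real^'k) (e n))" for n
    have v: "v n \<noteq> 0" "v n \<noteq> \<infinity>" for n unfolding v_def using volume_ball e by auto
    define J where "J n \<omega> = smoothed c ?x0 s \<Theta> \<delta>' (e n) (X \<omega>) / v n" for n \<omega>
    note sm = smoothed_measurable_Fubini[OF P X \<Theta>(1) c \<delta>' D\<delta>]
    have Jm: "J n \<in> borel_measurable P" for n
      unfolding J_def using sm(1)[of "e n"] by measurable
    have int: "(\<integral>\<^sup>+\<omega>. J n \<omega> \<partial>P) \<le> ennreal (G + \<eta>) * emeasure lborel (cball (0::real^'k) \<delta>')" for n
    proof -
      have "(\<integral>\<^sup>+\<omega>. smoothed c ?x0 s \<Theta> \<delta>' (e n) (X \<omega>) \<partial>P)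
         \<le> (\<integral>\<^sup>+y. indicator (cball (0::real^'k) \<delta>') y * (ennreal (G + \<eta>) * v n) \<partial>lborel)"
        unfolding sm(2)
      proof (rule nn_integral_mono)
        fix y :: "real^'k"
        show "indicator (cball 0 \<delta>') y *
           (\<integral>\<^sup>+\<omega>. indicator (ball 0 (e n)) (X \<omega> (?q y)) * ennreal (\<Theta> (X \<omega>) * jac A g (?q y) (X \<omega>)) \<partial>P)
           \<le> indicator (cball 0 \<delta>') y * (ennreal (G + \<eta>) * v n)"
        proof (cases "y \<in> cball 0 \<delta>'")
          case True
          then have "?q y \<in> U" using \<delta> by (intro \<delta>1(2)) simp
          then show ?thesis using avg[of "?q y" "e n"] e True by (simp add: v_def)
        qed simp
      qed
      also have "\<dots> = ennreal (G + \<eta>) * v n * emeasure lborel (cball (0::real^'k) \<delta>')"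
        by (rule nn_integral_cball_const)
      finally have "(\<integral>\<^sup>+\<omega>. smoothed c ?x0 s \<Theta> \<delta>' (e n) (X \<omega>) \<partial>P) / v n
          \<le> ennreal (G + \<eta>) * v n * emeasure lborel (cball (0::real^'k) \<delta>') / v n"
        by (rule divide_right_mono_ennreal)
      also have "ennreal (G + \<eta>) * v n * emeasure lborel (cball (0::real^'k) \<delta>') / v n
          = (ennreal (G + \<eta>) * emeasure lborel (cball (0::real^'k) \<delta>')) * v n / v n"
        by (simp only: ac_simps)
      also have "\<dots> = ennreal (G + \<eta>) * emeasure lborel (cball (0::real^'k) \<delta>')"
        using v[of n] by (intro ennreal_mult_divide_eq) auto
      also have "(\<integral>\<^sup>+\<omega>. smoothed c ?x0 s \<Theta> \<delta>' (e n) (X \<omega>) \<partial>P) / v n = (\<integral>\<^sup>+\<omega>. J n \<omega> \<partial>P)"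
        unfolding J_def by (rule nn_integral_divide[OF sm(1), symmetric])
      finally show ?thesis .
    qed
    have liminf: "disc_weight c ?x0 s u \<delta> (X \<omega>) \<le> liminf (\<lambda>n. J n \<omega>)" if \<omega>: "\<omega> \<in> space P" for \<omega>
    proof (rule dense_le)
      fix t assume t: "t < disc_weight c ?x0 s u \<delta> (X \<omega>)"
      then have "t \<noteq> \<infinity>" by auto
      then obtain r where r: "0 \<le> r" "t = ennreal r" by (cases t) auto
      obtain \<epsilon>1 where \<epsilon>1: "\<epsilon>1 > 0" "\<And>\<epsilon>. 0 < \<epsilon> \<Longrightarrow> \<epsilon> < \<epsilon>1 \<Longrightarrow>
           t * emeasure lborel (ball (0::real^'k) \<epsilon>) \<le> smoothed c ?x0 s \<Theta> \<delta>' \<epsilon> (X \<omega>)"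
        unfolding smoothed_def r(2)
        by (rule integral_near_zeros_eventually_ge[OF A XC[OF \<omega>] c D\<delta> \<delta>(2) r(1) t[unfolded r(2)],
              of "\<lambda>y. \<Theta> (X \<omega>) * jac A g (?q y) (X \<omega>)"])
          (use ge[OF XC[OF \<omega>]] sub that in blast)+
      have "\<forall>\<^sub>F n in sequentially. t \<le> J n \<omega>"
        using order_tendstoD(2)[OF e0 \<epsilon>1(1)]
      proof eventually_elim
        case (elim n)
        then have "t * v n / v n \<le> J n \<omega>"
          unfolding J_def v_def using e by (intro divide_right_mono_ennreal \<epsilon>1(2))
        then show ?case using v[of n] by (simp add: ennreal_mult_divide_eq)
      qed
      then show "t \<le> liminf (\<lambda>n. J n \<omega>)" by (rule Liminf_bounded)
    qed
    have "(\<integral>\<^sup>+\<omega>. disc_weight c ?x0 s u \<delta> (X \<omega>) \<partial>P) \<le> (\<integral>\<^sup>+\<omega>. liminf (\<lambda>n. J n \<omega>) \<partial>P)"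
      by (intro nn_integral_mono liminf)
    also have "\<dots> \<le> liminf (\<lambda>n. \<integral>\<^sup>+\<omega>. J n \<omega> \<partial>P)"
      by (rule nn_integral_liminf[OF Jm])
    also have "\<dots> \<le> ennreal (G + \<eta>) * emeasure lborel (cball (0::real^'k) \<delta>')"
      using int by (intro Liminf_le) auto
    finally show "(\<integral>\<^sup>+\<omega>. disc_weight c ?x0 s u \<delta> (X \<omega>) \<partial>P)
      \<le> ennreal (G + \<eta>) * emeasure lborel (cball (0::real^'k) \<delta>')" .
  qed
qed

end

section \<open>Bounded continuous majorants and minorants\<close>

lemma norm_matrix_vector_mult_le:
  fixes M :: "real^'a::finite^'b::finite"
  shows "norm (M *v v) \<le> norm M * norm v"
proof -
  have "norm (M *v v) = L2_set (\<lambda>i. \<bar>M $ i \<bullet> v\<bar>) UNIV"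
    by (simp add: norm_vec_def matrix_vector_mul_component)
  also have "\<dots> \<le> L2_set (\<lambda>i. norm v * norm (M $ i)) UNIV"
    by (rule L2_set_mono) (auto simp: Cauchy_Schwarz_ineq2 mult.commute[of "norm v"])
  also have "\<dots> = norm v * L2_set (\<lambda>i. norm (M $ i)) UNIV"
    by (rule L2_set_right_distrib[symmetric]) simp
  also have "L2_set (\<lambda>i. norm (M $ i)) UNIV = norm M" by (simp add: norm_vec_def[of M])
  finally show ?thesis by (simp add: mult.commute)
qed

text \<open>The smallest singular value. It measures invertibility quantitatively and continuously,
  as a cut-off by a continuous functional requires.\<close>

definition least_stretch :: "real^'k::finite^'k \<Rightarrow> real" where
  "least_stretch L = (INF v\<in>sphere 0 1. norm (L *v v))"

lemma sphere_cart_nonempty: "sphere (0::real^'k::finite) 1 \<noteq> {}"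
proof -
  have "axis undefined 1 \<in> sphere (0::real^'k) 1" by (simp add: norm_axis_1)
  then show ?thesis by blast
qed

lemma least_stretch_le_unit: "norm v = 1 \<Longrightarrow> least_stretch L \<le> norm (L *v v)"
  unfolding least_stretch_def by (rule cINF_lower) (auto intro!: bdd_belowI2[where m = 0])

lemma least_stretch_le: "least_stretch L * norm v \<le> norm (L *v v)"
proof (cases "v = 0")
  case False
  have "least_stretch L \<le> norm (L *v ((1 / norm v) *\<^sub>R v))"
    using False by (intro least_stretch_le_unit) simp
  also have "\<dots> = norm (L *v v) / norm v" by (simp add: matrix_vector_mult_scaleR)
  finally show ?thesis using False by (simp add: field_simps)
qed simp

lemma least_stretch_pos:
  fixes L :: "real^'k::finite^'k"
  assumes "det L \<noteq> 0"
  shows "0 < least_stretch L"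
proof -
  have "continuous_on (sphere 0 1) (\<lambda>v. norm (L *v v))"
    by (intro continuous_on_norm linear_continuous_on matrix_vector_mul_bounded_linear)
  then obtain v where v: "v \<in> sphere 0 1" "\<And>v'. v' \<in> sphere 0 1 \<Longrightarrow> norm (L *v v) \<le> norm (L *v v')"
    using continuous_attains_inf[OF compact_sphere sphere_cart_nonempty] by blast
  have "norm (L *v v) \<le> least_stretch L"
    unfolding least_stretch_def by (rule cINF_greatest[OF sphere_cart_nonempty]) (rule v(2))
  moreover have "L *v v \<noteq> 0"
  proof
    assume "L *v v = 0"
    then have "matrix_inv L *v (L *v v) = 0" by simp
    then have "v = 0" unfolding matrix_vector_mul_assoc matrix_inv_mult(2)[OF assms] by simp
    then show False using v(1) by simp
  qed
  ultimately show ?thesis by (metis less_le_trans zero_less_norm_iff)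
qed

text \<open>For a unit vector \<open>v\<close>, \<open>norm (L *v v)\<close> is 1-Lipschitz in
  \<open>L\<close>; the infimum over \<open>v\<close> inherits this.\<close>

lemma least_stretch_lipschitz: "\<bar>least_stretch L - least_stretch L'\<bar> \<le> norm (L - L')"
proof -
  have "least_stretch L \<le> least_stretch L' + norm (L - L')" for L L' :: "real^'k::finite^'k"
  proof -
    have "least_stretch L - norm (L - L') \<le> least_stretch L'"
      unfolding least_stretch_def[of L']
    proof (rule cINF_greatest[OF sphere_cart_nonempty])
      fix v :: "real^'k" assume "v \<in> sphere 0 1"
      then have v: "norm v = 1" by simp
      have "L *v v = L' *v v + (L - L') *v v" by (simp add: matrix_vector_mult_diff_rdistrib)
      then have "norm (L *v v) \<le> norm (L' *v v) + norm ((L - L') *v v)" by (metis norm_triangle_ineq)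
      also have "norm ((L - L') *v v) \<le> norm (L - L')"
        using norm_matrix_vector_mult_le[of "L - L'" v] v by simp
      finally show "least_stretch L - norm (L - L') \<le> norm (L' *v v)"
        using least_stretch_le_unit[OF v, of L] by simp
    qed
    then show ?thesis by simp
  qed
  from this[of L L'] this[of L' L] show ?thesis by (simp add: norm_minus_commute abs_le_iff)
qed

lemma continuous_on_least_stretch:
  fixes S :: "(real^'k::finite^'k) set"
  shows "continuous_on S least_stretch"
proof (rule continuous_onI)
  fix L :: "real^'k::finite^'k" and e :: real assume "0 < e"
  then show "\<exists>d>0. \<forall>L'\<in>S. dist L' L < d \<longrightarrow> dist (least_stretch L') (least_stretch L) \<le> e"
    using least_stretch_lipschitz[of _ L]
    by (intro exI[of _ e]) (auto simp: dist_norm intro: order_trans[OF _ less_imp_le])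
qed

text \<open>\<open>F\<close> differs from the linear map \<open>L\<close> by a map of Lipschitz
  constant \<open>B\<close>, too small to undo the expansion by at least
  \<open>least_stretch L\<close>.\<close>

lemma inj_on_least_stretch:
  fixes F :: "real^'k::finite \<Rightarrow> real^'k"
  assumes S: "convex S" and d: "\<And>y. y \<in> S \<Longrightarrow> (F has_derivative (*v) (M y)) (at y)"
    and le: "\<And>y. y \<in> S \<Longrightarrow> norm (M y - L) \<le> B" and B: "B < least_stretch L"
  shows "inj_on F S"
proof (rule inj_onI, rule ccontr)
  fix x y assume xy: "x \<in> S" "y \<in> S" "F x = F y" "x \<noteq> y"
  have "norm ((F x - L *v x) - (F y - L *v y)) \<le> B * norm (x - y)"
  proof (rule differentiable_bound[OF S])
    fix z assume z: "z \<in> S"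
    have "((\<lambda>z. F z - L *v z) has_derivative (\<lambda>v. M z *v v - L *v v)) (at z within S)"
      by (rule has_derivative_at_withinI)
        (intro has_derivative_diff d[OF z] bounded_linear_imp_has_derivative matrix_vector_mul_bounded_linear)
    then show "((\<lambda>z. F z - L *v z) has_derivative (*v) (M z - L)) (at z within S)"
      by (simp add: matrix_vector_mult_diff_rdistrib[symmetric, abs_def])
    show "onorm ((*v) (M z - L)) \<le> B"
    proof (rule onorm_le)
      fix v
      have "norm ((M z - L) *v v) \<le> norm (M z - L) * norm v" by (rule norm_matrix_vector_mult_le)
      also have "\<dots> \<le> B * norm v" using le[OF z] by (intro mult_right_mono) auto
      finally show "norm ((M z - L) *v v) \<le> B * norm v" .
    qed
  qed (use xy in auto)
  moreover have "(F x - L *v x) - (F y - L *v y) = - (L *v (x - y))"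
    using xy by (simp add: matrix_vector_mult_diff_distrib)
  ultimately have "norm (L *v (x - y)) \<le> B * norm (x - y)" by simp
  also have "\<dots> < least_stretch L * norm (x - y)" using B xy by simp
  also have "\<dots> \<le> norm (L *v (x - y))" by (rule least_stretch_le)
  finally show False by simp
qed

section \<open>Regularised quotients on shrinking balls\<close>

text \<open>Multiplication by \<open>b 0\<close> settles the degenerate case, since
  \<open>b 0 = 0\<close> forces \<open>a 0 = 0\<close>. Otherwise the regularised quotient is
  continuous in the point and the parameter 1/(n+1) jointly, which bounds the supremum from above;
  its value at the centre is at least \<open>a 0 / b 0\<close> by the mediant inequality.\<close>

lemma SUP_ratio_limit:
  fixes a b :: "'x::euclidean_space \<Rightarrow> real"
  assumes ca: "continuous_on (cball 0 \<delta>) a" and cb: "continuous_on (cball 0 \<delta>) b" and \<delta>: "0 < \<delta>"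
    and a: "\<And>y. y \<in> cball 0 \<delta> \<Longrightarrow> 0 \<le> a y" and ab: "\<And>y. y \<in> cball 0 \<delta> \<Longrightarrow> a y \<le> C * b y"
    and b: "\<And>y. y \<in> cball 0 \<delta> \<Longrightarrow> 0 \<le> b y" and C: "0 < C"
  shows "(\<lambda>n. (SUP y\<in>cball 0 (\<delta> / real (Suc n)). (a y + C / real (Suc n)) / (b y + 1 / real (Suc n))) * b 0) \<longlonglongrightarrow> a 0"
proof -
  define r where "r n y = (a y + C / real (Suc n)) / (b y + 1 / real (Suc n))" for n y
  define S where "S n = (SUP y\<in>cball 0 (\<delta> / real (Suc n)). r n y)" for n
  have sub: "cball (0::'x) (\<delta> / real (Suc n)) \<subseteq> cball 0 \<delta>" for n
    using \<delta> by (intro subset_cball) (simp add: field_simps)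
  have pos: "0 < b y + 1 / real (Suc n)" if "y \<in> cball 0 \<delta>" for y n
    using b[OF that] by (simp add: add_nonneg_pos)
  have rC: "r n y \<le> C" if "y \<in> cball 0 \<delta>" for n y
    using ab[OF that] pos[OF that, of n] by (simp add: r_def divide_le_eq distrib_left)
  have bdd: "bdd_above (r n ` cball 0 (\<delta> / real (Suc n)))" for n
    using rC sub[of n] by (intro bdd_aboveI2[where M = C]) blast
  have zero: "0 \<in> cball (0::'x) (\<delta> / real (Suc n))" for n using \<delta> by simp
  have zero': "0 \<in> cball (0::'x) \<delta>" using \<delta> by simp
  have "(\<lambda>n. S n * b 0) \<longlonglongrightarrow> a 0"
  proof (cases "b 0 = 0")
    case True
    then have "a 0 = 0" using a[OF zero'] ab[OF zero'] by simp
    then show ?thesis using True by simp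
  next
    case False
    then have b0: "0 < b 0" using b[OF zero'] by simp
    have lower: "a 0 / b 0 \<le> S n" for n
    proof -
      have "a 0 * (1 / real (Suc n)) \<le> C * b 0 * (1 / real (Suc n))"
        by (rule mult_right_mono[OF ab[OF zero']]) simp
      then have "a 0 * (b 0 + 1 / real (Suc n)) \<le> (a 0 + C / real (Suc n)) * b 0"
        by (simp add: distrib_left distrib_right mult.commute)
      then have "a 0 / b 0 \<le> r n 0"
        unfolding r_def pos_divide_le_eq[OF b0] times_divide_eq_left pos_le_divide_eq[OF pos[OF zero', of n]] .
      also have "r n 0 \<le> S n" unfolding S_def by (rule cSUP_upper[OF zero bdd])
      finally show ?thesis .
    qed
    have upper: "\<forall>\<^sub>F n in sequentially. S n \<le> a 0 / b 0 + k" if k: "0 < k" for k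
    proof -
      have "continuous (at (0, 0) within (cball 0 \<delta> \<times> UNIV)) (\<lambda>z. (a (fst z) + C * snd z) / (b (fst z) + snd z))"
      proof (intro continuous_at_within_divide continuous_add continuous_mult continuous_const)
        have "continuous_on (cball 0 \<delta> \<times> UNIV) (\<lambda>z :: 'x \<times> real. a (fst z))"
          by (rule continuous_on_compose2[OF ca]) (auto intro: continuous_intros)
        then show "continuous (at (0, 0) within (cball 0 \<delta> \<times> UNIV)) (\<lambda>z :: 'x \<times> real. a (fst z))"
          using zero' by (simp add: continuous_on_eq_continuous_within)
        have "continuous_on (cball 0 \<delta> \<times> UNIV) (\<lambda>z :: 'x \<times> real. b (fst z))"
          by (rule continuous_on_compose2[OF cb]) (auto intro: continuous_intros)
        then show "continuous (at (0, 0) within (cball 0 \<delta> \<times> UNIV)) (\<lambda>z :: 'x \<times> real. b (fst z))"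
          using zero' by (simp add: continuous_on_eq_continuous_within)
      qed (use b0 in \<open>auto intro: continuous_intros\<close>)
      then obtain d where d: "d > 0" "\<And>z. z \<in> cball 0 \<delta> \<times> UNIV \<Longrightarrow> dist z (0, 0) < d \<Longrightarrow>
          dist ((a (fst z) + C * snd z) / (b (fst z) + snd z)) ((a 0 + C * 0) / (b 0 + 0)) < k"
        using k unfolding continuous_within_eps_delta by fastforce
      have "(\<lambda>n. (\<delta> + 1) / real (Suc n)) \<longlonglongrightarrow> 0" by real_asymp
      then have "\<forall>\<^sub>F n in sequentially. (\<delta> + 1) / real (Suc n) < d" by (rule order_tendstoD(2)[OF _ d(1)])
      then show ?thesis
      proof eventually_elim
        case (elim n)
        show ?case
          unfolding S_def
        proof (rule cSUP_least)
          show "cball (0::'x) (\<delta> / real (Suc n)) \<noteq> {}" using zero[of n] by blast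
          fix y :: 'x assume y: "y \<in> cball 0 (\<delta> / real (Suc n))"
          have "dist (y, 1 / real (Suc n)) (0, 0) = norm (y, 1 / real (Suc n))"
            by (simp add: dist_norm)
          also have "\<dots> \<le> norm y + norm (1 / real (Suc n))" by (rule norm_Pair_le)
          also have "\<dots> \<le> (\<delta> + 1) / real (Suc n)" using y by (simp add: add_divide_distrib)
          finally have "dist (y, 1 / real (Suc n)) (0, 0) < d" using elim by linarith
          then have "dist (r n y) (a 0 / b 0) < k"
            using d(2)[of "(y, 1 / real (Suc n))"] y sub[of n] by (auto simp: r_def)
          then show "r n y \<le> a 0 / b 0 + k" by (simp add: dist_real_def)
        qed
      qed
    qed
    have "S \<longlonglongrightarrow> a 0 / b 0"
    proof (rule LIMSEQ_I)
      fix e :: real assume "0 < e"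
      then have "\<forall>\<^sub>F n in sequentially. S n \<le> a 0 / b 0 + e / 2" by (intro upper) simp
      then have "\<forall>\<^sub>F n in sequentially. norm (S n - a 0 / b 0) < e"
      proof eventually_elim
        case (elim n)
        then show ?case using lower[of n] \<open>0 < e\<close> by (simp add: abs_less_iff)
      qed
      then show "\<exists>no. \<forall>n\<ge>no. norm (S n - a 0 / b 0) < e" by (simp add: eventually_sequentially)
    qed
    then have "(\<lambda>n. S n * b 0) \<longlonglongrightarrow> a 0 / b 0 * b 0" by (intro tendsto_mult tendsto_const)
    then show ?thesis using b0 by simp
  qed
  then show ?thesis by (simp add: S_def r_def)
qed

text \<open>Once \<open>m > 0\<close>, the second entry of the minimum tends to infinity near the
  centre, so the cut-off drops out of the limit and the first entry decides, by joint continuity. If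
  \<open>a 0 = 0\<close>, the expression lies between 0 and \<open>a 0\<close>.\<close>

lemma INF_ratio_limit:
  fixes a b d :: "'x::euclidean_space \<Rightarrow> real"
  assumes ca: "continuous_on (cball 0 \<delta>) a" and cb: "continuous_on (cball 0 \<delta>) b" and cd: "continuous_on (cball 0 \<delta>) d"
    and \<delta>: "0 < \<delta>" and d0: "d 0 = 0" and m: "0 < a 0 \<Longrightarrow> 0 < m"
    and a: "\<And>y. y \<in> cball 0 \<delta> \<Longrightarrow> 0 \<le> a y" and ab: "\<And>y. y \<in> cball 0 \<delta> \<Longrightarrow> a y \<le> C * b y"
    and b: "\<And>y. y \<in> cball 0 \<delta> \<Longrightarrow> 0 \<le> b y" and C: "0 < C"
    and bdd: "\<And>n. bdd_below ((\<lambda>y. min (a y / (b y + 1 / real (Suc n))) (real (Suc n) * (m - d y))) ` cball 0 (\<delta> / real (Suc n)))"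
  shows "(\<lambda>n. max 0 (INF y\<in>cball 0 (\<delta> / real (Suc n)). min (a y / (b y + 1 / real (Suc n))) (real (Suc n) * (m - d y))) * b 0)
     \<longlonglongrightarrow> a 0"
proof -
  define r where "r n y = min (a y / (b y + 1 / real (Suc n))) (real (Suc n) * (m - d y))" for n y
  define S where "S n = max 0 (INF y\<in>cball 0 (\<delta> / real (Suc n)). r n y)" for n
  have sub: "cball (0::'x) (\<delta> / real (Suc n)) \<subseteq> cball 0 \<delta>" for n
    using \<delta> by (intro subset_cball) (simp add: field_simps)
  have pos: "0 < b y + 1 / real (Suc n)" if "y \<in> cball 0 \<delta>" for y n
    using b[OF that] by (simp add: add_nonneg_pos)
  have zero: "0 \<in> cball (0::'x) (\<delta> / real (Suc n))" for n using \<delta> by simp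
  have zero': "0 \<in> cball (0::'x) \<delta>" using \<delta> by simp
  have S0: "0 \<le> S n" for n by (simp add: S_def)
  have upper: "S n * b 0 \<le> a 0" for n
  proof -
    have "(INF y\<in>cball 0 (\<delta> / real (Suc n)). r n y) \<le> r n 0"
      by (rule cINF_lower[OF _ zero]) (use bdd[of n] in \<open>simp add: r_def\<close>)
    also have "\<dots> \<le> a 0 / (b 0 + 1 / real (Suc n))" by (simp add: r_def)
    finally have "S n \<le> a 0 / (b 0 + 1 / real (Suc n))"
      unfolding S_def using a[OF zero'] pos[OF zero', of n] by simp
    then have "S n * b 0 \<le> a 0 / (b 0 + 1 / real (Suc n)) * b 0" using b[OF zero'] by (rule mult_right_mono)
    also have "\<dots> \<le> a 0 / (b 0 + 1 / real (Suc n)) * (b 0 + 1 / real (Suc n))"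
      using a[OF zero'] pos[OF zero', of n] by (intro mult_left_mono) auto
    also have "\<dots> = a 0" using pos[OF zero', of n] by simp
    finally show ?thesis .
  qed
  have "(\<lambda>n. S n * b 0) \<longlonglongrightarrow> a 0"
  proof (cases "a 0 = 0")
    case True
    have "(\<lambda>n. S n * b 0) = (\<lambda>n. 0)"
      using upper S0 b[OF zero'] True by (intro ext) (metis antisym mult_nonneg_nonneg)
    then show ?thesis using True by simp
  next
    case False
    then have a0: "0 < a 0" using a[OF zero'] by simp
    then have b0: "0 < b 0" using ab[OF zero'] C b[OF zero'] by (metis less_le less_le_trans mult_zero_right)
    have m0: "0 < m" by (rule m[OF a0])
    have lower: "\<forall>\<^sub>F n in sequentially. a 0 / b 0 - k \<le> S n" if k: "0 < k" for k
    proof -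
      have "continuous (at (0, 0) within (cball 0 \<delta> \<times> UNIV)) (\<lambda>z. a (fst z) / (b (fst z) + snd z))"
      proof (intro continuous_at_within_divide continuous_add)
        have "continuous_on (cball 0 \<delta> \<times> UNIV) (\<lambda>z :: 'x \<times> real. a (fst z))"
          by (rule continuous_on_compose2[OF ca]) (auto intro: continuous_intros)
        then show "continuous (at (0, 0) within (cball 0 \<delta> \<times> UNIV)) (\<lambda>z :: 'x \<times> real. a (fst z))"
          using zero' by (simp add: continuous_on_eq_continuous_within)
        have "continuous_on (cball 0 \<delta> \<times> UNIV) (\<lambda>z :: 'x \<times> real. b (fst z))"
          by (rule continuous_on_compose2[OF cb]) (auto intro: continuous_intros)
        then show "continuous (at (0, 0) within (cball 0 \<delta> \<times> UNIV)) (\<lambda>z :: 'x \<times> real. b (fst z))"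
          using zero' by (simp add: continuous_on_eq_continuous_within)
      qed (use b0 in \<open>auto intro: continuous_intros\<close>)
      then obtain t where t: "t > 0" "\<And>z. z \<in> cball 0 \<delta> \<times> UNIV \<Longrightarrow> dist z (0, 0) < t \<Longrightarrow>
          dist (a (fst z) / (b (fst z) + snd z)) (a 0 / (b 0 + 0)) < k"
        using k unfolding continuous_within_eps_delta by fastforce
      have "continuous (at 0 within cball 0 \<delta>) d"
        using cd zero' by (simp add: continuous_on_eq_continuous_within)
      then obtain t' where t': "t' > 0" "\<And>y. y \<in> cball 0 \<delta> \<Longrightarrow> dist y 0 < t' \<Longrightarrow> dist (d y) (d 0) < m / 2"
        using m0 unfolding continuous_within_eps_delta by (meson half_gt_zero)
      have "(\<lambda>n. (\<delta> + 1) / real (Suc n)) \<longlonglongrightarrow> 0" by real_asymp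
      then have "\<forall>\<^sub>F n in sequentially. (\<delta> + 1) / real (Suc n) < min t t'"
        by (rule order_tendstoD(2)) (use t(1) t'(1) in simp)
      moreover have "\<forall>\<^sub>F n in sequentially. a 0 / b 0 \<le> real (Suc n) * (m / 2)"
      proof -
        have "filterlim (\<lambda>n. real (Suc n) * (m / 2)) at_top sequentially" using m0 by real_asymp
        then show ?thesis unfolding filterlim_at_top by (rule spec)
      qed
      ultimately show ?thesis
      proof eventually_elim
        case (elim n)
        have "a 0 / b 0 - k \<le> (INF y\<in>cball 0 (\<delta> / real (Suc n)). r n y)"
        proof (rule cINF_greatest)
          show "cball (0::'x) (\<delta> / real (Suc n)) \<noteq> {}" using zero[of n] by blast
          fix y :: 'x assume y: "y \<in> cball 0 (\<delta> / real (Suc n))"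
          have yd: "y \<in> cball 0 \<delta>" using y sub[of n] by blast
          have "dist (y, 1 / real (Suc n)) (0, 0) = norm (y, 1 / real (Suc n))"
            by (simp add: dist_norm)
          also have "\<dots> \<le> norm y + norm (1 / real (Suc n))" by (rule norm_Pair_le)
          also have "\<dots> \<le> (\<delta> + 1) / real (Suc n)" using y by (simp add: add_divide_distrib)
          finally have "dist (y, 1 / real (Suc n)) (0, 0) < t" using elim(1) by linarith
          then have 1: "a 0 / b 0 - k \<le> a y / (b y + 1 / real (Suc n))"
            using t(2)[of "(y, 1 / real (Suc n))"] yd by (auto simp: dist_real_def abs_less_iff)
          have "norm y \<le> \<delta> / real (Suc n)" using y by simp
          also have "\<dots> \<le> (\<delta> + 1) / real (Suc n)" by (rule divide_right_mono) auto
          also have "\<dots> < t'" using elim(1) by simp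
          finally have "dist y 0 < t'" by simp
          then have "d y < m / 2" using t'(2)[OF yd] d0 by (simp add: dist_real_def)
          then have "real (Suc n) * (m / 2) \<le> real (Suc n) * (m - d y)" by (intro mult_left_mono) auto
          then have "a 0 / b 0 - k \<le> real (Suc n) * (m - d y)" using elim(2) k by linarith
          with 1 show "a 0 / b 0 - k \<le> r n y" by (simp add: r_def)
        qed
        then show ?case by (simp add: S_def)
      qed
    qed
    have upper': "S n \<le> a 0 / b 0" for n using upper[of n] b0 by (simp add: pos_le_divide_eq)
    have "S \<longlonglongrightarrow> a 0 / b 0"
    proof (rule LIMSEQ_I)
      fix e :: real assume "0 < e"
      then have "\<forall>\<^sub>F n in sequentially. a 0 / b 0 - e / 2 \<le> S n" by (intro lower) simp
      then have "\<forall>\<^sub>F n in sequentially. norm (S n - a 0 / b 0) < e"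
      proof eventually_elim
        case (elim n)
        then show ?case using upper'[of n] \<open>0 < e\<close> by (simp add: abs_less_iff)
      qed
      then show "\<exists>no. \<forall>n\<ge>no. norm (S n - a 0 / b 0) < e" by (simp add: eventually_sequentially)
    qed
    then have "(\<lambda>n. S n * b 0) \<longlonglongrightarrow> a 0 / b 0 * b 0" by (intro tendsto_mult tendsto_const)
    then show ?thesis using b0 by simp
  qed
  then show ?thesis by (simp add: S_def r_def)
qed

context
  fixes A :: "('m::{t2_space,second_countable_topology}, 'n::finite) chart set"
    and g :: "'m \<Rightarrow> real^'n^'n"
  assumes A: "smooth_atlas A" and g: "riemannian_metric A g"
begin

text \<open>At each level \<open>t\<close> the zero sets of regular maps with disc weight above
  \<open>t\<close> form an admissible family, so the hypothesis equates the tails of the two random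
  disc weights.\<close>

lemma expectation_disc_weight_eq:
  fixes X1 :: "'a \<Rightarrow> 'm \<Rightarrow> real^'k::finite" and X2 :: "'b \<Rightarrow> 'm \<Rightarrow> real^'k"
  assumes zk1: "z_KROK A g P1 X1 \<rho>1 \<mu>1" and zk2: "z_KROK A g P2 X2 \<rho>2 \<mu>2"
    and law: "\<And>W. W \<subseteq> Collect (C1_submanifold A) \<Longrightarrow>
           {f \<in> (regular_maps A :: ('m \<Rightarrow> real^'k) set). zero_set f \<in> W} \<in> sets (borel_C1 A) \<Longrightarrow>
           measure P1 {\<omega> \<in> space P1. X1 \<omega> \<in> regular_maps A \<and> zero_set (X1 \<omega>) \<in> W} =
           measure P2 {\<omega> \<in> space P2. X2 \<omega> \<in> regular_maps A \<and> zero_set (X2 \<omega>) \<in> W}"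
    and c: "c \<in> A" and D: "disc x0 s ` cball 0 \<delta> \<subseteq> snd c ` fst c"
  shows "(\<integral>\<^sup>+\<omega>. disc_weight c x0 s u \<delta> (X1 \<omega>) \<partial>P1) = (\<integral>\<^sup>+\<omega>. disc_weight c x0 s u \<delta> (X2 \<omega>) \<partial>P2)"
proof -
  \<comment> \<open>The value 0 off the regular maps, a null event for both fields, makes every
    superlevel set at a level \<open>t \<ge> 0\<close> consist of regular maps.\<close>
  define \<Phi> where "\<Phi> f = (if f \<in> regular_maps A then enn2real (disc_weight c x0 s u \<delta> f) else 0)"
    for f :: "'m \<Rightarrow> real^'k"
  have fin: "disc_weight c x0 s u \<delta> f < \<infinity>" for f :: "'m \<Rightarrow> real^'k"
    using disc_weight_le by (rule order_le_less_trans) simp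
  have less: "t < \<Phi> f \<longleftrightarrow> f \<in> regular_maps A \<and> ennreal t < disc_weight c x0 s u \<delta> f" if "0 \<le> t" for t f
  proof (cases "f \<in> regular_maps A")
    case True
    have "disc_weight c x0 s u \<delta> f = ennreal (\<Phi> f)" using True fin[of f] by (simp add: \<Phi>_def)
    then show ?thesis using True that by (simp add: ennreal_less_iff)
  qed (use that in \<open>simp add: \<Phi>_def\<close>)
  have \<Phi>0: "0 \<le> \<Phi> f" for f by (simp add: \<Phi>_def)
  have sets: "{f \<in> regular_maps A. ennreal t < disc_weight c x0 s u \<delta> f} \<in> sets (borel_C1 A)" if "0 \<le> t" for t
    by (rule sets_disc_weight[OF A that c D])
  have \<Phi>m: "\<Phi> \<in> borel_measurable (borel_C1 A)"
    unfolding borel_measurable_iff_greater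
  proof
    fix t
    show "{f \<in> space (borel_C1 A). t < \<Phi> f} \<in> sets (borel_C1 A)"
    proof (cases "0 \<le> t")
      case True
      have "{f \<in> space (borel_C1 A). t < \<Phi> f} = {f \<in> regular_maps A. ennreal t < disc_weight c x0 s u \<delta> f}"
        unfolding less[OF True] space_borel_C1[OF A] by (auto simp: regular_maps_def)
      then show ?thesis using sets[OF True] by simp
    next
      case False
      then have "{f \<in> space (borel_C1 A). t < \<Phi> f} = space (borel_C1 A)"
        using \<Phi>0 by (auto intro: less_le_trans[of t 0])
      then show ?thesis by simp
    qed
  qed
  have P: "prob_space P1" "prob_space P2" and X: "X1 \<in> measurable P1 (borel_C1 A)" "X2 \<in> measurable P2 (borel_C1 A)"
    and reg: "AE \<omega> in P1. X1 \<omega> \<in> regular_maps A" "AE \<omega> in P2. X2 \<omega> \<in> regular_maps A"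
    using zk1 zk2 unfolding z_KROK_def by auto
  have "(\<integral>\<^sup>+\<omega>. ennreal (\<Phi> (X1 \<omega>)) \<partial>P1) = (\<integral>\<^sup>+\<omega>. ennreal (\<Phi> (X2 \<omega>)) \<partial>P2)"
  proof (rule nn_integral_eq_of_tails[OF P measurable_compose[OF X(1) \<Phi>m] _ measurable_compose[OF X(2) \<Phi>m]])
    fix t :: real assume t: "0 \<le> t"
    define W where "W = zero_set ` {f \<in> (regular_maps A :: ('m \<Rightarrow> real^'k) set). ennreal t < disc_weight c x0 s u \<delta> f}"
    \<comment> \<open>The first direction is the substantial one: a regular map that shares its zero
      set with some regular map of weight above \<open>t\<close> has itself weight above
      \<open>t\<close>.\<close>
    have W: "f \<in> regular_maps A \<and> zero_set f \<in> W \<longleftrightarrow> t < \<Phi> f" for f :: "'m \<Rightarrow> real^'k"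
    proof
      assume f: "f \<in> regular_maps A \<and> zero_set f \<in> W"
      then obtain h where h: "h \<in> regular_maps A" "ennreal t < disc_weight c x0 s u \<delta> h" "zero_set f = zero_set h"
        unfolding W_def by blast
      have "disc_weight c x0 s u \<delta> f = disc_weight c x0 s u \<delta> h"
        using f by (intro disc_weight_same_zero_set[OF A _ h(1,3) c D]) blast
      then show "t < \<Phi> f" using f h(2) by (simp add: less[OF t])
    next
      assume "t < \<Phi> f"
      then show "f \<in> regular_maps A \<and> zero_set f \<in> W" unfolding less[OF t] W_def by blast
    qed
    have "measure P1 {\<omega> \<in> space P1. X1 \<omega> \<in> regular_maps A \<and> zero_set (X1 \<omega>) \<in> W} =
           measure P2 {\<omega> \<in> space P2. X2 \<omega> \<in> regular_maps A \<and> zero_set (X2 \<omega>) \<in> W}"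
    proof (rule law)
      show "W \<subseteq> Collect (C1_submanifold A)"
        unfolding W_def using zero_set_C1_submanifold[OF A] by blast
      have "{f \<in> (regular_maps A :: ('m \<Rightarrow> real^'k) set). zero_set f \<in> W} = {f \<in> regular_maps A. ennreal t < disc_weight c x0 s u \<delta> f}"
        using W less[OF t] by blast
      then show "{f \<in> (regular_maps A :: ('m \<Rightarrow> real^'k) set). zero_set f \<in> W} \<in> sets (borel_C1 A)"
        using sets[OF t] by simp
    qed
    then show "measure P1 {\<omega> \<in> space P1. t < \<Phi> (X1 \<omega>)} = measure P2 {\<omega> \<in> space P2. t < \<Phi> (X2 \<omega>)}"
      unfolding W .
  qed (rule \<Phi>0)+
  moreover have "ennreal (\<Phi> f) = disc_weight c x0 s u \<delta> f" if "f \<in> regular_maps A" for f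
    using that fin[of f] by (simp add: \<Phi>_def)
  then have "(\<integral>\<^sup>+\<omega>. ennreal (\<Phi> (X1 \<omega>)) \<partial>P1) = (\<integral>\<^sup>+\<omega>. disc_weight c x0 s u \<delta> (X1 \<omega>) \<partial>P1)"
     "(\<integral>\<^sup>+\<omega>. ennreal (\<Phi> (X2 \<omega>)) \<partial>P2) = (\<integral>\<^sup>+\<omega>. disc_weight c x0 s u \<delta> (X2 \<omega>) \<partial>P2)"
    using reg by (auto intro!: nn_integral_cong_AE)
  ultimately show ?thesis by simp
qed

lemma dir_part_le_gram_jac:
  assumes c: "c \<in> A" and K: "compact K" "K \<subseteq> snd c ` fst c"
  obtains C where "0 < C"
    "\<And>x (D :: real^'n^'k::finite). x \<in> K \<Longrightarrow> dir_part u s (wedge D) \<le> C * gram_jac (metric_coeffs A g c x) D"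
proof -
  have cG: "compact (metric_coeffs A g c ` K)"
    by (intro compact_continuous_image continuous_on_subset[OF continuous_on_metric_coeffs[OF A g c]] K)
  have pd: "pos_def_matrix G" if "G \<in> metric_coeffs A g c ` K" for G
    using that pos_def_metric_coeffs[OF A g c] K(2) by blast
  obtain C where C: "C > 0"
    "\<And>G (D :: real^'n^'k). G \<in> metric_coeffs A g c ` K \<Longrightarrow> norm (wedge D) \<le> C * gram_jac G D"
    by (rule wedge_le_gram_jac[OF cG pd], assumption) (rule that)
  \<comment> \<open>The added 1 keeps the constant positive when \<open>u = 0\<close>.\<close>
  show ?thesis
  proof (rule that[of "(norm u + 1) * C"])
    show "0 < (norm u + 1) * C" using C(1) by (simp add: add_nonneg_pos)
    fix x and D :: "real^'n^'k" assume "x \<in> K"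
    then have le: "norm (wedge D) \<le> C * gram_jac (metric_coeffs A g c x) D" by (intro C(2)) blast
    have "dir_part u s (wedge D) \<le> norm u * norm (wedge D)" by (rule dir_part_le)
    also have "\<dots> \<le> (norm u + 1) * (C * gram_jac (metric_coeffs A g c x) D)"
      using le by (intro mult_mono) auto
    finally show "dir_part u s (wedge D) \<le> (norm u + 1) * C * gram_jac (metric_coeffs A g c x) D"
      by (simp add: mult.assoc)
  qed
qed

text \<open>Finiteness of the Jacobian measure makes \<open>jac A g p\<close> integrable under
  \<open>\<nu>\<close>, and \<open>C\<close> times it dominates. The limit leads from bounded
  continuous test functionals back to an integral against \<open>\<nu>\<close> itself.\<close>

lemma integral_jac_measure_limit:
  fixes \<nu> :: "('m \<Rightarrow> real^'k::finite) measure" and \<Theta> :: "nat \<Rightarrow> ('m \<Rightarrow> real^'k) \<Rightarrow> real"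
  assumes \<nu>: "sets \<nu> = sets (borel_C1 A)" and fin: "finite_measure (jac_measure A g p \<nu>)"
    and \<Theta>: "\<And>n. continuous_map (weak_whitney A) euclideanreal (\<Theta> n)"
      "\<And>n f. f \<in> C1_maps A \<Longrightarrow> 0 \<le> \<Theta> n f" "\<And>n f. f \<in> C1_maps A \<Longrightarrow> \<Theta> n f \<le> C"
    and lim: "\<And>f. f \<in> C1_maps A \<Longrightarrow> (\<lambda>n. \<Theta> n f * jac A g p f) \<longlonglongrightarrow> h f"
  shows "integrable \<nu> h" and "(\<lambda>n. \<integral>f. \<Theta> n f \<partial>jac_measure A g p \<nu>) \<longlonglongrightarrow> (\<integral>f. h f \<partial>\<nu>)"
proof -
  have sp: "space \<nu> = C1_maps A" using sets_eq_imp_space_eq[OF \<nu>] by (simp add: space_borel_C1[OF A])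
  have m: "\<Phi> \<in> borel_measurable \<nu>" if "continuous_map (weak_whitney A) euclideanreal \<Phi>" for \<Phi>
    using borel_measurable_continuous_map[OF A that] measurable_cong_sets[OF \<nu> refl] by blast
  note [measurable] = m[OF \<Theta>(1)] m[OF continuous_map_jac[OF A g]]
  have intj: "integrable \<nu> (jac A g p)"
  proof (rule integrableI_nonneg)
    have "(\<integral>\<^sup>+f. ennreal (jac A g p f) \<partial>\<nu>) = emeasure (jac_measure A g p \<nu>) (space (jac_measure A g p \<nu>))"
      unfolding jac_measure_def by (subst emeasure_density) (auto intro!: nn_integral_cong simp: indicator_def)
    also have "\<dots> < \<infinity>" using finite_measure.emeasure_finite[OF fin] by (simp add: less_top)
    finally show "(\<integral>\<^sup>+f. ennreal (jac A g p f) \<partial>\<nu>) < \<infinity>" .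
  qed (simp_all add: jac_nonneg[OF A g])
  have eq: "(\<integral>f. \<Theta> n f \<partial>jac_measure A g p \<nu>) = (\<integral>f. \<Theta> n f * jac A g p f \<partial>\<nu>)" for n
    unfolding jac_measure_def by (subst integral_density) (simp_all add: jac_nonneg[OF A g] mult.commute)
  have hm: "h \<in> borel_measurable \<nu>"
    by (rule borel_measurable_LIMSEQ_real[where u = "\<lambda>n f. \<Theta> n f * jac A g p f"]) (use lim sp in auto)
  have w: "integrable \<nu> (\<lambda>f. C * jac A g p f)" using intj by simp
  have b: "AE f in \<nu>. norm (\<Theta> n f * jac A g p f) \<le> C * jac A g p f" for n
    using \<Theta>(2,3) sp by (intro AE_I2) (simp add: abs_mult jac_nonneg[OF A g] mult_right_mono)
  have l: "AE f in \<nu>. (\<lambda>n. \<Theta> n f * jac A g p f) \<longlonglongrightarrow> h f"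
    using lim sp by (intro AE_I2) simp
  show "integrable \<nu> h"
    by (rule integrable_dominated_convergence[OF hm _ w l b]) measurable
  show "(\<lambda>n. \<integral>f. \<Theta> n f \<partial>jac_measure A g p \<nu>) \<longlonglongrightarrow> (\<integral>f. h f \<partial>\<nu>)"
    unfolding eq by (rule integral_dominated_convergence[OF hm _ w l b]) measurable
qed

end

context
  fixes A :: "('m::{t2_space,second_countable_topology}, 'n::finite) chart set"
    and g :: "'m \<Rightarrow> real^'n^'n"
  assumes A: "smooth_atlas A" and g: "riemannian_metric A g"
begin

lemma continuous_on_gram_jac_jet:
  assumes c: "c \<in> A" and K: "K \<subseteq> snd c ` fst c"
  shows "continuous_on (K \<times> (UNIV :: (((real^'k::finite) \<times> (real^'n^'k)) \<times> ((real^'k) \<times> (real^'n^'k))) set))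
     (\<lambda>z. gram_jac (metric_coeffs A g c (fst z)) (snd (fst (snd z))))"
proof (rule continuous_on_gram_jac)
  show "pos_def_matrix (metric_coeffs A g c (fst z))"
    if "z \<in> K \<times> (UNIV :: (((real^'k) \<times> (real^'n^'k)) \<times> ((real^'k) \<times> (real^'n^'k))) set)" for z
    using that K by (intro pos_def_metric_coeffs[OF A g c]) auto
  show "continuous_on (K \<times> (UNIV :: (((real^'k) \<times> (real^'n^'k)) \<times> ((real^'k) \<times> (real^'n^'k))) set)) (\<lambda>z. metric_coeffs A g c (fst z))"
    by (rule continuous_on_compose2[OF continuous_on_metric_coeffs[OF A g c]]) (use K in \<open>auto intro: continuous_intros\<close>)
qed (intro continuous_intros)

lemma continuous_on_dir_part_jet:
  "continuous_on S (\<lambda>z :: (real^'n) \<times> (((real^'k::finite) \<times> (real^'n^'k)) \<times> ((real^'k) \<times> (real^'n^'k))). dir_part u s (wedge (snd (fst (snd z)))))"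
  by (rule continuous_on_compose2[OF continuous_on_dir_part continuous_on_compose2[OF continuous_on_wedge]])
    (auto intro!: continuous_intros)

context
  fixes P :: "'a measure" and X :: "'a \<Rightarrow> 'm \<Rightarrow> real^'k::finite" and \<rho> \<mu> p c
    and u :: "real^('k \<Rightarrow> 'n)" and s :: "'k \<Rightarrow> 'n"
  assumes zk: "z_KROK A g P X \<rho> \<mu>" and c: "c \<in> A" and p: "p \<in> fst c"
begin

lemma disc_limit_setup:
  obtains \<delta> C where "0 < \<delta>" "disc (snd c p) s ` cball 0 \<delta> \<subseteq> snd c ` fst c" "0 < C"
    "\<And>x (D :: real^'n^'k). x \<in> disc (snd c p) s ` cball 0 \<delta> \<Longrightarrow> dir_part u s (wedge D) \<le> C * gram_jac (metric_coeffs A g c x) D"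
proof -
  obtain \<delta> where \<delta>: "\<delta> > 0" "disc (snd c p) s ` cball 0 \<delta> \<subseteq> snd c ` fst c" by (rule disc_radius[OF A c p])
  have cK: "compact (disc (snd c p) s ` cball 0 \<delta>)"
    by (intro compact_continuous_image continuous_on_disc compact_cball)
  obtain C where "C > 0"
    "\<And>x (D :: real^'n^'k). x \<in> disc (snd c p) s ` cball 0 \<delta> \<Longrightarrow> dir_part u s (wedge D) \<le> C * gram_jac (metric_coeffs A g c x) D"
    by (rule dir_part_le_gram_jac[OF A g c cK \<delta>(2)]) (rule that)
  then show ?thesis using that[OF \<delta>] by blast
qed

lemma conditional_law_at_zero: "sets (\<mu> p 0) = sets (borel_C1 A)" "finite_measure (jac_measure A g p (\<mu> p 0))"
  using zk unfolding z_KROK_def regular_conditional_prob_def by auto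

text \<open>By the mediant inequality, \<open>a \<le> C * b\<close> makes \<open>(a + C * e) / (b + e)\<close> a majorant of
  \<open>a / b\<close> that stays bounded and continuous where \<open>b\<close> vanishes.\<close>

lemma expectation_disc_weight_upper:
  assumes \<kappa>: "0 < \<kappa>"
  shows "integrable (\<mu> p 0) (\<lambda>f. dir_part u s (wedge (chart_differential c f (snd c p))))"
    and "\<exists>\<delta>1>0. \<forall>\<delta> \<delta>'. 0 < \<delta> \<longrightarrow> \<delta> < \<delta>' \<longrightarrow> \<delta>' < \<delta>1 \<longrightarrow>
     (\<integral>\<^sup>+\<omega>. disc_weight c (snd c p) s u \<delta> (X \<omega>) \<partial>P) \<le>
     ennreal (\<rho> p 0 * (\<integral>f. dir_part u s (wedge (chart_differential c f (snd c p))) \<partial>\<mu> p 0) + \<kappa>) * emeasure lborel (cball (0::real^'k) \<delta>')"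
proof -
  let ?x0 = "snd c p"
  let ?h = "\<lambda>f. dir_part u s (wedge (chart_differential c f ?x0))"
  obtain \<delta> C where \<delta>: "0 < \<delta>" and D: "disc ?x0 s ` cball 0 \<delta> \<subseteq> snd c ` fst c" and C: "0 < C"
    and le: "\<And>x (D :: real^'n^'k). x \<in> disc ?x0 s ` cball 0 \<delta> \<Longrightarrow> dir_part u s (wedge D) \<le> C * gram_jac (metric_coeffs A g c x) D"
    by (rule disc_limit_setup) (rule that)
  define a where "a f y = dir_part u s (wedge (chart_differential c f (disc ?x0 s y)))" for f :: "'m \<Rightarrow> real^'k" and y
  define b where "b f y = gram_jac (metric_coeffs A g c (disc ?x0 s y)) (chart_differential c f (disc ?x0 s y))" for f :: "'m \<Rightarrow> real^'k" and y
  have yU: "disc ?x0 s y \<in> snd c ` fst c" if "y \<in> cball 0 \<delta>" for y by (rule subsetD[OF D imageI[OF that]])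
  have b_jac: "jac A g (chart_inv c (disc ?x0 s y)) f = b f y" if "f \<in> C1_maps A" "y \<in> cball 0 \<delta>" for f y
    unfolding b_def by (rule jac_disc[OF A g that(1) c yU[OF that(2)]])
  have ca: "continuous_on (cball 0 \<delta>) (a f)" if "f \<in> C1_maps A" for f
    unfolding a_def[abs_def]
    by (rule continuous_on_compose2[OF continuous_on_dir_part continuous_on_disc_wedge[OF A that c D]]) simp
  have cb: "continuous_on (cball 0 \<delta>) (b f)" if "f \<in> C1_maps A" for f
    by (rule continuous_on_eq[OF continuous_on_jac_disc[OF A g that c D] b_jac[OF that]])
  have a0: "0 \<le> a f y" for f y by (simp add: a_def)
  have b0: "0 \<le> b f y" if "y \<in> cball 0 \<delta>" for f y
    unfolding b_def by (intro gram_jac_nonneg pos_def_metric_coeffs[OF A g c yU[OF that]])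
  have ab: "a f y \<le> C * b f y" if "y \<in> cball 0 \<delta>" for f y
    unfolding a_def b_def by (intro le imageI that)
  \<comment> \<open>The disc shrinks together with the regularising parameter, so that in the limit
    only the jet at the centre counts.\<close>
  define \<delta>n where "\<delta>n n = \<delta> / real (Suc n)" for n
  have \<delta>n: "0 < \<delta>n n" "cball (0::real^'k) (\<delta>n n) \<subseteq> cball 0 \<delta>" for n
    using \<delta> unfolding \<delta>n_def by (simp, intro subset_cball) (simp add: field_simps)
  have Dn: "disc ?x0 s ` cball 0 (\<delta>n n) \<subseteq> snd c ` fst c" for n
    by (rule subset_trans[OF image_mono[OF \<delta>n(2)] D])
  define R where "R n x j j' = (dir_part u s (wedge (snd j)) + C / real (Suc n)) / (gram_jac (metric_coeffs A g c x) (snd j) + 1 / real (Suc n))"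
    for n x and j j' :: "(real^'k) \<times> (real^'n^'k)"
  define \<Theta> where "\<Theta> n f = (SUP x\<in>disc ?x0 s ` cball 0 (\<delta>n n). R n x (chart_jet c f x) (chart_jet c f ?x0))" for n f
  have \<Theta>: "\<Theta> n f = (SUP y\<in>cball 0 (\<delta>n n). (a f y + C / real (Suc n)) / (b f y + 1 / real (Suc n)))" for n f
    by (simp add: \<Theta>_def R_def a_def b_def chart_jet_def image_image)
  have pos: "0 < b f y + 1 / real (Suc n)" if "y \<in> cball 0 (\<delta>n n)" for f y n
    using b0[of y f] that \<delta>n(2)[of n] by (intro add_nonneg_pos) auto
  have r_le: "(a f y + C / real (Suc n)) / (b f y + 1 / real (Suc n)) \<le> C" if "y \<in> cball 0 (\<delta>n n)" for f y n
  proof -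
    have "a f y \<le> C * b f y" using that \<delta>n(2)[of n] by (intro ab) auto
    then show ?thesis unfolding pos_divide_le_eq[OF pos[OF that]] by (simp add: distrib_left)
  qed
  have bdd: "bdd_above ((\<lambda>y. (a f y + C / real (Suc n)) / (b f y + 1 / real (Suc n))) ` cball 0 (\<delta>n n))" for f n
    using r_le by (intro bdd_aboveI2)
  have zero: "0 \<in> cball (0::real^'k) (\<delta>n n)" for n using \<delta>n(1)[of n] by simp
  have cont: "continuous_map (weak_whitney A) euclideanreal (\<Theta> n)" for n
    unfolding \<Theta>_def[abs_def]
  proof (rule continuous_map_SUP_jet[OF A c _ Dn])
    show "compact (disc ?x0 s ` cball 0 (\<delta>n n))"
      by (intro compact_continuous_image continuous_on_disc compact_cball)
    show "?x0 \<in> disc ?x0 s ` cball 0 (\<delta>n n)" using imageI[OF zero[of n], of "disc ?x0 s"] by simp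
    show "continuous_on (disc ?x0 s ` cball 0 (\<delta>n n) \<times> UNIV) (\<lambda>(x, j, j'). R n x j j')"
      unfolding R_def split_beta
    proof (intro continuous_on_divide continuous_on_add continuous_on_const continuous_on_dir_part_jet continuous_on_gram_jac_jet[OF c Dn])
      show "\<forall>z\<in>disc ?x0 s ` cball 0 (\<delta>n n) \<times> (UNIV :: (((real^'k) \<times> (real^'n^'k)) \<times> ((real^'k) \<times> (real^'n^'k))) set). gram_jac (metric_coeffs A g c (fst z)) (snd (fst (snd z)) :: real^'n^'k) + 1 / real (Suc n) \<noteq> 0"
      proof
        fix z :: "(real^'n) \<times> ((real^'k) \<times> (real^'n^'k)) \<times> ((real^'k) \<times> (real^'n^'k))"
        assume "z \<in> disc ?x0 s ` cball 0 (\<delta>n n) \<times> UNIV"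
        then have "fst z \<in> snd c ` fst c" using Dn[of n] by auto
        then have "0 \<le> gram_jac (metric_coeffs A g c (fst z)) (snd (fst (snd z)))"
          by (intro gram_jac_nonneg pos_def_metric_coeffs[OF A g c])
        moreover have "0 < 1 / real (Suc n)" by simp
        ultimately show "gram_jac (metric_coeffs A g c (fst z)) (snd (fst (snd z))) + 1 / real (Suc n) \<noteq> 0" by linarith
      qed
    qed simp_all
  qed
  have \<Theta>ge: "(a f y + C / real (Suc n)) / (b f y + 1 / real (Suc n)) \<le> \<Theta> n f" if "y \<in> cball 0 (\<delta>n n)" for f y n
    unfolding \<Theta> by (rule cSUP_upper[OF that bdd])
  have \<Theta>0: "0 \<le> \<Theta> n f" for n f
  proof -
    have "0 \<le> (a f 0 + C / real (Suc n)) / (b f 0 + 1 / real (Suc n))"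
      using a0[of f 0] pos[OF zero, of f n] C by (intro divide_nonneg_nonneg) auto
    then show ?thesis using \<Theta>ge[OF zero, of f n] by linarith
  qed
  have \<Theta>C: "\<Theta> n f \<le> C" for n f
    unfolding \<Theta> by (rule cSUP_least) (use zero[of n] r_le in blast)+
  \<comment> \<open>The regularised quotient lies above \<open>a / b\<close> at each point of the
    disc, and the supremum above the quotient. Stated as a product, the bound also covers points
    with \<open>b f y = 0\<close>.\<close>
  have maj: "a f y \<le> \<Theta> n f * b f y" if y: "y \<in> cball 0 (\<delta>n n)" for f y n
  proof -
    let ?e = "1 / real (Suc n)"
    have yd: "y \<in> cball 0 \<delta>" using y \<delta>n(2) by blast
    have "a f y * ?e \<le> C * b f y * ?e" by (rule mult_right_mono[OF ab[OF yd]]) simp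
    then have "a f y * (b f y + ?e) \<le> (a f y + C / real (Suc n)) * b f y"
      by (simp add: distrib_left distrib_right mult.commute)
    then have "a f y \<le> (a f y + C / real (Suc n)) / (b f y + ?e) * b f y"
      unfolding times_divide_eq_left pos_le_divide_eq[OF pos[OF y]] .
    also have "\<dots> \<le> \<Theta> n f * b f y" by (rule mult_right_mono[OF \<Theta>ge[OF y] b0[OF yd]])
    finally show ?thesis .
  qed
  have jp: "jac A g p f = b f 0" if "f \<in> C1_maps A" for f
    using b_jac[OF that, of 0] \<delta> by (simp add: chart_inv_left[OF A c p])
  have lim: "(\<lambda>n. \<Theta> n f * jac A g p f) \<longlonglongrightarrow> ?h f" if f: "f \<in> C1_maps A" for f
  proof -
    have "(\<lambda>n. \<Theta> n f * b f 0) \<longlonglongrightarrow> a f 0"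
      unfolding \<Theta> \<delta>n_def by (rule SUP_ratio_limit[OF ca[OF f] cb[OF f] \<delta> a0 ab b0 C])
    then show ?thesis unfolding jp[OF f] by (simp add: a_def)
  qed
  note L = integral_jac_measure_limit[OF A g conditional_law_at_zero cont \<Theta>0 \<Theta>C lim]
  show "integrable (\<mu> p 0) ?h" by (rule L(1))
  have "(\<lambda>n. \<rho> p 0 * (\<integral>f. \<Theta> n f \<partial>jac_measure A g p (\<mu> p 0))) \<longlonglongrightarrow> \<rho> p 0 * (\<integral>f. ?h f \<partial>\<mu> p 0)"
    by (intro tendsto_mult tendsto_const L(2))
  \<comment> \<open>Half of \<open>\<kappa>\<close> is spent on the choice of \<open>n\<close>, the
    other half on the local average in \<open>expectation_disc_weight_le\<close>.\<close>
  from order_tendstoD(2)[OF this, of "\<rho> p 0 * (\<integral>f. ?h f \<partial>\<mu> p 0) + \<kappa> / 2"] \<kappa>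
  obtain n where n: "\<rho> p 0 * (\<integral>f. \<Theta> n f \<partial>jac_measure A g p (\<mu> p 0)) < \<rho> p 0 * (\<integral>f. ?h f \<partial>\<mu> p 0) + \<kappa> / 2"
    by (auto simp: eventually_sequentially)
  have \<kappa>2: "0 < \<kappa> / 2" using \<kappa> by simp
  have ge: "dir_part u s (wedge (chart_differential c f (disc ?x0 s y)))
        \<le> \<Theta> n f * jac A g (chart_inv c (disc ?x0 s y)) f" if "f \<in> C1_maps A" "y \<in> cball 0 (\<delta>n n)" for f y
  proof -
    have yd: "y \<in> cball 0 \<delta>" using that(2) \<delta>n(2) by blast
    show ?thesis using maj[OF that(2), of f] unfolding b_jac[OF that(1) yd] a_def .
  qed
  obtain \<delta>1 where \<delta>1: "\<delta>1 > 0" "\<And>\<delta> \<delta>'. 0 < \<delta> \<Longrightarrow> \<delta> < \<delta>' \<Longrightarrow> \<delta>' < \<delta>1 \<Longrightarrow>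
     (\<integral>\<^sup>+\<omega>. disc_weight c ?x0 s u \<delta> (X \<omega>) \<partial>P) \<le>
     ennreal (\<rho> p 0 * (\<integral>f. \<Theta> n f \<partial>jac_measure A g p (\<mu> p 0)) + \<kappa> / 2) * emeasure lborel (cball (0::real^'k) \<delta>')"
    using expectation_disc_weight_le[OF A g zk c p cont \<Theta>0 \<Theta>C \<delta>n(1) Dn ge \<kappa>2] by blast
  show "\<exists>\<delta>1>0. \<forall>\<delta> \<delta>'. 0 < \<delta> \<longrightarrow> \<delta> < \<delta>' \<longrightarrow> \<delta>' < \<delta>1 \<longrightarrow>
     (\<integral>\<^sup>+\<omega>. disc_weight c ?x0 s u \<delta> (X \<omega>) \<partial>P) \<le>
     ennreal (\<rho> p 0 * (\<integral>f. ?h f \<partial>\<mu> p 0) + \<kappa>) * emeasure lborel (cball (0::real^'k) \<delta>')"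
  proof (intro exI[of _ \<delta>1] conjI allI impI \<delta>1(1))
    fix \<delta> \<delta>' assume "0 < \<delta>" "\<delta> < \<delta>'" "\<delta>' < \<delta>1"
    note \<delta>1(2)[OF this]
    also have "ennreal (\<rho> p 0 * (\<integral>f. \<Theta> n f \<partial>jac_measure A g p (\<mu> p 0)) + \<kappa> / 2) * emeasure lborel (cball (0::real^'k) \<delta>')
       \<le> ennreal (\<rho> p 0 * (\<integral>f. ?h f \<partial>\<mu> p 0) + \<kappa>) * emeasure lborel (cball (0::real^'k) \<delta>')"
      using n by (intro mult_right_mono ennreal_leI) auto
    finally show "(\<integral>\<^sup>+\<omega>. disc_weight c ?x0 s u \<delta> (X \<omega>) \<partial>P) \<le>
     ennreal (\<rho> p 0 * (\<integral>f. ?h f \<partial>\<mu> p 0) + \<kappa>) * emeasure lborel (cball (0::real^'k) \<delta>')" .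
  qed
qed

text \<open>The minorant is cut off by the least stretch of the derivative at the centre, so that it
  is positive only on maps that are injective on the disc.\<close>

lemma expectation_disc_weight_lower:
  assumes \<kappa>: "0 < \<kappa>"
  shows "\<exists>\<delta>1>0. \<forall>\<delta>. 0 < \<delta> \<longrightarrow> \<delta> < \<delta>1 \<longrightarrow>
     ennreal (\<rho> p 0 * (\<integral>f. dir_part u s (wedge (chart_differential c f (snd c p))) \<partial>\<mu> p 0) - \<kappa>) * emeasure lborel (cball (0::real^'k) \<delta>)
     \<le> (\<integral>\<^sup>+\<omega>. disc_weight c (snd c p) s u \<delta> (X \<omega>) \<partial>P)"
proof -
  let ?x0 = "snd c p"
  let ?h = "\<lambda>f. dir_part u s (wedge (chart_differential c f ?x0))"
  obtain \<delta> C where \<delta>: "0 < \<delta>" and D: "disc ?x0 s ` cball 0 \<delta> \<subseteq> snd c ` fst c" and C: "0 < C"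
    and le: "\<And>x (D :: real^'n^'k). x \<in> disc ?x0 s ` cball 0 \<delta> \<Longrightarrow> dir_part u s (wedge D) \<le> C * gram_jac (metric_coeffs A g c x) D"
    by (rule disc_limit_setup) (rule that)
  define a where "a f y = dir_part u s (wedge (chart_differential c f (disc ?x0 s y)))" for f :: "'m \<Rightarrow> real^'k" and y
  define b where "b f y = gram_jac (metric_coeffs A g c (disc ?x0 s y)) (chart_differential c f (disc ?x0 s y))" for f :: "'m \<Rightarrow> real^'k" and y
  define M where "M f y = column_minor s (chart_differential c f (disc ?x0 s y))" for f :: "'m \<Rightarrow> real^'k" and y
  have yU: "disc ?x0 s y \<in> snd c ` fst c" if "y \<in> cball 0 \<delta>" for y by (rule subsetD[OF D imageI[OF that]])
  have b_jac: "jac A g (chart_inv c (disc ?x0 s y)) f = b f y" if "f \<in> C1_maps A" "y \<in> cball 0 \<delta>" for f y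
    unfolding b_def by (rule jac_disc[OF A g that(1) c yU[OF that(2)]])
  have ca: "continuous_on (cball 0 \<delta>) (a f)" if "f \<in> C1_maps A" for f
    unfolding a_def[abs_def]
    by (rule continuous_on_compose2[OF continuous_on_dir_part continuous_on_disc_wedge[OF A that c D]]) simp
  have cb: "continuous_on (cball 0 \<delta>) (b f)" if "f \<in> C1_maps A" for f
    by (rule continuous_on_eq[OF continuous_on_jac_disc[OF A g that c D] b_jac[OF that]])
  have cM: "continuous_on (cball 0 \<delta>) (M f)" if "f \<in> C1_maps A" for f
    unfolding M_def[abs_def]
    by (rule continuous_on_compose2[OF continuous_on_column_minor[of UNIV] continuous_on_disc_differential[OF A that c D]]) simp
  have a0: "0 \<le> a f y" for f y by (simp add: a_def)
  have b0: "0 \<le> b f y" if "y \<in> cball 0 \<delta>" for f y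
    unfolding b_def by (intro gram_jac_nonneg pos_def_metric_coeffs[OF A g c yU[OF that]])
  have ab: "a f y \<le> C * b f y" if "y \<in> cball 0 \<delta>" for f y
    unfolding a_def b_def by (intro le imageI that)
  define \<delta>n where "\<delta>n n = \<delta> / real (Suc n)" for n
  have \<delta>n: "0 < \<delta>n n" "cball (0::real^'k) (\<delta>n n) \<subseteq> cball 0 \<delta>" for n
    using \<delta> unfolding \<delta>n_def by (simp, intro subset_cball) (simp add: field_simps)
  have Dn: "disc ?x0 s ` cball 0 (\<delta>n n) \<subseteq> snd c ` fst c" for n
    by (rule subset_trans[OF image_mono[OF \<delta>n(2)] D])
  \<comment> \<open>The sign is reversed because \<open>continuous_map_SUP_jet\<close> concerns
    suprema; \<open>\<Theta>\<close> negates once more and so contains an infimum.\<close>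
  define R where "R n x j j' = - min (dir_part u s (wedge (snd j)) / (gram_jac (metric_coeffs A g c x) (snd j) + 1 / real (Suc n)))
       (real (Suc n) * (least_stretch (column_minor s (snd j')) - norm (column_minor s (snd j) - column_minor s (snd j'))))"
    for n x and j j' :: "(real^'k) \<times> (real^'n^'k)"
  define r where "r n f y = min (a f y / (b f y + 1 / real (Suc n))) (real (Suc n) * (least_stretch (M f 0) - norm (M f y - M f 0)))" for n f y
  define \<Theta>0 where "\<Theta>0 n f = (SUP x\<in>disc ?x0 s ` cball 0 (\<delta>n n). R n x (chart_jet c f x) (chart_jet c f ?x0))" for n f
  define \<Theta> where "\<Theta> n f = max 0 (- \<Theta>0 n f)" for n f
  have \<Theta>: "\<Theta> n f = max 0 (INF y\<in>cball 0 (\<delta>n n). r n f y)" for n f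
    by (simp add: \<Theta>_def \<Theta>0_def R_def r_def a_def b_def M_def chart_jet_def image_image Inf_real_def)
  have zero: "0 \<in> cball (0::real^'k) (\<delta>n n)" for n using \<delta>n(1)[of n] by simp
  have zero': "0 \<in> cball (0::real^'k) \<delta>" using \<delta> by simp
  have pos: "0 < b f y + 1 / real (Suc n)" if "y \<in> cball 0 (\<delta>n n)" for f y n
    using b0[of y f] that \<delta>n(2)[of n] by (intro add_nonneg_pos) auto
  have cont0: "continuous_map (weak_whitney A) euclideanreal (\<Theta>0 n)" for n
    unfolding \<Theta>0_def[abs_def]
  proof (rule continuous_map_SUP_jet[OF A c _ Dn])
    show "compact (disc ?x0 s ` cball 0 (\<delta>n n))"
      by (intro compact_continuous_image continuous_on_disc compact_cball)
    show "?x0 \<in> disc ?x0 s ` cball 0 (\<delta>n n)" using imageI[OF zero[of n], of "disc ?x0 s"] by simp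
    have cm: "continuous_on S (\<lambda>z :: (real^'n) \<times> ((real^'k) \<times> (real^'n^'k)) \<times> ((real^'k) \<times> (real^'n^'k)). column_minor s (snd (fst (snd z))))"
      "continuous_on S (\<lambda>z :: (real^'n) \<times> ((real^'k) \<times> (real^'n^'k)) \<times> ((real^'k) \<times> (real^'n^'k)). column_minor s (snd (snd (snd z))))" for S
      by (rule continuous_on_compose2[OF continuous_on_column_minor[of UNIV]]; auto intro!: continuous_intros)+
    have cl: "continuous_on S (\<lambda>z :: (real^'n) \<times> ((real^'k) \<times> (real^'n^'k)) \<times> ((real^'k) \<times> (real^'n^'k)). least_stretch (column_minor s (snd (snd (snd z)))))" for S
      by (rule continuous_on_compose2[OF continuous_on_least_stretch[of UNIV] cm(2)]) simp
    show "continuous_on (disc ?x0 s ` cball 0 (\<delta>n n) \<times> UNIV) (\<lambda>(x, j, j'). R n x j j')"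
      unfolding R_def split_beta
    proof (intro continuous_on_minus continuous_on_min continuous_on_mult continuous_on_diff continuous_on_norm cm cl
        continuous_on_divide continuous_on_add continuous_on_const continuous_on_dir_part_jet continuous_on_gram_jac_jet[OF c Dn])
      show "\<forall>z\<in>disc ?x0 s ` cball 0 (\<delta>n n) \<times> (UNIV :: (((real^'k) \<times> (real^'n^'k)) \<times> ((real^'k) \<times> (real^'n^'k))) set). gram_jac (metric_coeffs A g c (fst z)) (snd (fst (snd z)) :: real^'n^'k) + 1 / real (Suc n) \<noteq> 0"
      proof
        fix z :: "(real^'n) \<times> ((real^'k) \<times> (real^'n^'k)) \<times> ((real^'k) \<times> (real^'n^'k))"
        assume "z \<in> disc ?x0 s ` cball 0 (\<delta>n n) \<times> UNIV"
        then have "fst z \<in> snd c ` fst c" using Dn[of n] by auto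
        then have "0 \<le> gram_jac (metric_coeffs A g c (fst z)) (snd (fst (snd z)))"
          by (intro gram_jac_nonneg pos_def_metric_coeffs[OF A g c])
        moreover have "0 < 1 / real (Suc n)" by simp
        ultimately show "gram_jac (metric_coeffs A g c (fst z)) (snd (fst (snd z))) + 1 / real (Suc n) \<noteq> 0" by linarith
      qed
    qed simp_all
  qed
  have cont: "continuous_map (weak_whitney A) euclideanreal (\<Theta> n)" for n
    unfolding \<Theta>_def[abs_def] by (intro continuous_map_real_max continuous_map_minus cont0) simp
  have bdd: "bdd_below (r n f ` cball 0 (\<delta>n n))" if f: "f \<in> C1_maps A" for n f
  proof -
    have "continuous_on (cball 0 (\<delta>n n)) (r n f)"
      unfolding r_def[abs_def]
    proof (intro continuous_on_min continuous_on_mult continuous_on_diff continuous_on_norm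
        continuous_on_divide continuous_on_add continuous_on_const)
      show "\<forall>y\<in>cball 0 (\<delta>n n). b f y + 1 / real (Suc n) \<noteq> 0" using pos by (metis less_irrefl)
    qed (rule continuous_on_subset[OF ca[OF f] \<delta>n(2)] continuous_on_subset[OF cb[OF f] \<delta>n(2)]
        continuous_on_subset[OF cM[OF f] \<delta>n(2)] | simp)+
    then have "compact (r n f ` cball 0 (\<delta>n n))" by (intro compact_continuous_image compact_cball)
    then show ?thesis by (intro bounded_imp_bdd_below compact_imp_bounded)
  qed
  have \<Theta>pos: "0 \<le> \<Theta> n f" for n f by (simp add: \<Theta>_def)
  have \<Theta>le: "\<Theta> n f \<le> r n f y" if "f \<in> C1_maps A" "0 < \<Theta> n f" "y \<in> cball 0 (\<delta>n n)" for n f y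
  proof -
    have "\<Theta> n f = (INF y\<in>cball 0 (\<delta>n n). r n f y)" using that(2) unfolding \<Theta> by (simp add: max_def split: if_splits)
    also have "\<dots> \<le> r n f y" by (rule cINF_lower[OF bdd[OF that(1)] that(3)])
    finally show ?thesis .
  qed
  have r_min: "\<Theta> n f * b f y \<le> a f y" if f: "f \<in> C1_maps A" and y: "y \<in> cball 0 (\<delta>n n)" for n f y
  proof (cases "0 < \<Theta> n f")
    case True
    have yd: "y \<in> cball 0 \<delta>" using y \<delta>n(2) by blast
    have "\<Theta> n f \<le> a f y / (b f y + 1 / real (Suc n))" using \<Theta>le[OF f True y] by (simp add: r_def)
    then have "\<Theta> n f * (b f y + 1 / real (Suc n)) \<le> a f y" unfolding pos_le_divide_eq[OF pos[OF y]] .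
    moreover have "\<Theta> n f * b f y \<le> \<Theta> n f * (b f y + 1 / real (Suc n))"
      by (rule mult_left_mono[OF _ \<Theta>pos]) simp
    ultimately show ?thesis by linarith
  next
    case False
    then have "\<Theta> n f = 0" using \<Theta>pos[of n f] by linarith
    then show ?thesis using a0 by simp
  qed
  have \<Theta>C: "\<Theta> n f \<le> C" if f: "f \<in> C1_maps A" for n f
  proof (cases "0 < \<Theta> n f")
    case True
    have "\<Theta> n f \<le> a f 0 / (b f 0 + 1 / real (Suc n))" using \<Theta>le[OF f True zero] by (simp add: r_def)
    also have "\<dots> \<le> C"
    proof -
      have "0 \<le> C / real (Suc n)" using C by simp
      then have "a f 0 \<le> C * (b f 0 + 1 / real (Suc n))" using ab[OF zero', of f] by (simp add: distrib_left)
      then show ?thesis unfolding pos_divide_le_eq[OF pos[OF zero]] .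
    qed
    finally show ?thesis .
  next
    case False
    then show ?thesis using C by linarith
  qed
  have apos: "0 < a f y" if f: "f \<in> C1_maps A" and t: "0 < \<Theta> n f" and y: "y \<in> cball 0 (\<delta>n n)" for n f y
  proof -
    have "0 < a f y / (b f y + 1 / real (Suc n))" using \<Theta>le[OF f t y] t by (simp add: r_def)
    then have "a f y \<noteq> 0" by auto
    then show ?thesis using a0[of f y] by linarith
  qed
  have inj: "inj_on (\<lambda>y. f (chart_inv c (disc ?x0 s y))) (cball 0 (\<delta>n n))" if f: "f \<in> C1_maps A" and t: "0 < \<Theta> n f" for n f
  proof (rule inj_on_least_stretch[where M = "M f" and L = "M f 0"])
    show "convex (cball (0::real^'k) (\<delta>n n))" by simp
    show "((\<lambda>y. f (chart_inv c (disc ?x0 s y))) has_derivative (*v) (M f y)) (at y)" if "y \<in> cball 0 (\<delta>n n)" for y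
    proof -
      have "y \<in> cball 0 \<delta>" using that \<delta>n(2) by blast
      from disc_fun_has_derivative[OF A f c yU[OF this]] show ?thesis unfolding M_def .
    qed
    \<comment> \<open>Positivity of \<open>\<Theta> n f\<close> leaves a gap of
      \<open>\<Theta> n f / real (Suc n)\<close> between the variation of the derivative and the
      least stretch at the centre.\<close>
    show "norm (M f y - M f 0) \<le> least_stretch (M f 0) - \<Theta> n f / real (Suc n)" if y: "y \<in> cball 0 (\<delta>n n)" for y
    proof -
      have "\<Theta> n f \<le> real (Suc n) * (least_stretch (M f 0) - norm (M f y - M f 0))" using \<Theta>le[OF f t y] by (simp add: r_def)
      then have "\<Theta> n f / real (Suc n) \<le> least_stretch (M f 0) - norm (M f y - M f 0)"
        by (simp add: pos_divide_le_eq mult.commute del: of_nat_Suc)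
      then show ?thesis by linarith
    qed
    show "least_stretch (M f 0) - \<Theta> n f / real (Suc n) < least_stretch (M f 0)" using t by simp
  qed
  have jp: "jac A g p f = b f 0" if "f \<in> C1_maps A" for f
    using b_jac[OF that zero'] by (simp add: chart_inv_left[OF A c p])
  have lim: "(\<lambda>n. \<Theta> n f * jac A g p f) \<longlonglongrightarrow> ?h f" if f: "f \<in> C1_maps A" for f
  proof -
    have "(\<lambda>n. \<Theta> n f * b f 0) \<longlonglongrightarrow> a f 0"
      unfolding \<Theta> \<delta>n_def r_def
    proof (rule INF_ratio_limit[OF ca[OF f] cb[OF f] _ \<delta> _ _ a0 ab b0 C])
      show "continuous_on (cball 0 \<delta>) (\<lambda>y. norm (M f y - M f 0))"
        by (intro continuous_intros cM[OF f])
      show "norm (M f 0 - M f 0) = 0" by simp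
      \<comment> \<open>A positive \<open>dir_part\<close> at the centre forces its minor, the
        determinant of \<open>M f 0\<close>, to be nonzero.\<close>
      show "0 < least_stretch (M f 0)" if "0 < a f 0"
      proof -
        have "det (M f 0) \<noteq> 0" using that by (auto simp: a_def M_def det_column_minor dir_part_def)
        then show ?thesis by (rule least_stretch_pos)
      qed
      show "bdd_below ((\<lambda>y. min (a f y / (b f y + 1 / real (Suc n))) (real (Suc n) * (least_stretch (M f 0) - norm (M f y - M f 0)))) ` cball 0 (\<delta> / real (Suc n)))" for n
        using bdd[OF f, of n] by (simp add: r_def[abs_def] \<delta>n_def)
    qed
    then show ?thesis unfolding jp[OF f] by (simp add: a_def)
  qed
  note L = integral_jac_measure_limit(2)[OF A g conditional_law_at_zero cont \<Theta>pos \<Theta>C lim]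
  have "(\<lambda>n. \<rho> p 0 * (\<integral>f. \<Theta> n f \<partial>jac_measure A g p (\<mu> p 0))) \<longlonglongrightarrow> \<rho> p 0 * (\<integral>f. ?h f \<partial>\<mu> p 0)"
    by (intro tendsto_mult tendsto_const L)
  from order_tendstoD(1)[OF this, of "\<rho> p 0 * (\<integral>f. ?h f \<partial>\<mu> p 0) - \<kappa> / 2"] \<kappa>
  obtain n where n: "\<rho> p 0 * (\<integral>f. ?h f \<partial>\<mu> p 0) - \<kappa> / 2 < \<rho> p 0 * (\<integral>f. \<Theta> n f \<partial>jac_measure A g p (\<mu> p 0))"
    by (auto simp: eventually_sequentially)
  have \<kappa>2: "0 < \<kappa> / 2" using \<kappa> by simp
  have minor: "\<Theta> n f * jac A g (chart_inv c (disc ?x0 s y)) f \<le> dir_part u s (wedge (chart_differential c f (disc ?x0 s y)))"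
    if "f \<in> C1_maps A" "y \<in> cball 0 (\<delta>n n)" for f y
  proof -
    have yd: "y \<in> cball 0 \<delta>" using that(2) \<delta>n(2) by blast
    show ?thesis using r_min[OF that] unfolding b_jac[OF that(1) yd] a_def .
  qed
  have nz: "wedge (chart_differential c f (disc ?x0 s y)) \<noteq> 0"
    if "f \<in> C1_maps A" "0 < \<Theta> n f" "y \<in> cball 0 (\<delta>n n)" for f y
    using apos[OF that] by (auto simp: a_def dir_part_def)
  obtain \<delta>1 where \<delta>1: "\<delta>1 > 0" "\<And>\<delta>. 0 < \<delta> \<Longrightarrow> \<delta> < \<delta>1 \<Longrightarrow>
     ennreal (\<rho> p 0 * (\<integral>f. \<Theta> n f \<partial>jac_measure A g p (\<mu> p 0)) - \<kappa> / 2) * emeasure lborel (cball (0::real^'k) \<delta>)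
     \<le> (\<integral>\<^sup>+\<omega>. disc_weight c ?x0 s u \<delta> (X \<omega>) \<partial>P)"
    using expectation_disc_weight_ge[OF A g zk c p cont \<Theta>pos \<Theta>C \<delta>n(1) Dn minor inj nz \<kappa>2] by blast
  show ?thesis
  proof (intro exI[of _ \<delta>1] conjI allI impI \<delta>1(1))
    fix \<delta> assume "0 < \<delta>" "\<delta> < \<delta>1"
    have "ennreal (\<rho> p 0 * (\<integral>f. ?h f \<partial>\<mu> p 0) - \<kappa>) * emeasure lborel (cball (0::real^'k) \<delta>)
      \<le> ennreal (\<rho> p 0 * (\<integral>f. \<Theta> n f \<partial>jac_measure A g p (\<mu> p 0)) - \<kappa> / 2) * emeasure lborel (cball (0::real^'k) \<delta>)"
      using n by (intro mult_right_mono ennreal_leI) auto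
    also note \<delta>1(2)[OF \<open>0 < \<delta>\<close> \<open>\<delta> < \<delta>1\<close>]
    finally show "ennreal (\<rho> p 0 * (\<integral>f. ?h f \<partial>\<mu> p 0) - \<kappa>) * emeasure lborel (cball (0::real^'k) \<delta>)
      \<le> (\<integral>\<^sup>+\<omega>. disc_weight c ?x0 s u \<delta> (X \<omega>) \<partial>P)" .
  qed
qed

end

end

section \<open>Comparison of the two fields\<close>

lemma le_of_perturbed_le:
  fixes x y :: real
  assumes "\<And>t. 0 < t \<Longrightarrow> x - t \<le> (y + t) * (1 + t) ^ k"
  shows "x \<le> y"
proof -
  have "((\<lambda>t. (y + t) * (1 + t) ^ k + t) \<longlongrightarrow> (y + 0) * (1 + 0) ^ k + 0) (at_right 0)"
    by (intro tendsto_intros)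
  then have lim: "((\<lambda>t. (y + t) * (1 + t) ^ k + t) \<longlongrightarrow> y) (at_right 0)" by simp
  have "\<forall>\<^sub>F t in at_right 0. x \<le> (y + t) * (1 + t) ^ k + t"
    using eventually_at_right_less[of "0::real"]
  proof eventually_elim
    case (elim t)
    then show ?case using assms[of t] by simp
  qed
  then show ?thesis by (rule tendsto_lowerbound[OF lim]) simp
qed

lemma volume_cball_scaled_le:
  fixes a b :: real
  assumes le: "ennreal a * emeasure lborel (cball (0::real^'k::finite) r) \<le> ennreal b * emeasure lborel (cball (0::real^'k) (l * r))"
    and r: "0 < r" and l: "0 < l" and b: "0 \<le> b"
  shows "a \<le> b * l ^ CARD('k)"
proof (cases "0 \<le> a")
  case True
  let ?\<beta> = "unit_ball_vol (real CARD('k))"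
  have \<beta>: "0 < ?\<beta>" by (rule unit_ball_vol_pos) simp
  have "ennreal (a * (?\<beta> * r ^ CARD('k))) \<le> ennreal (b * (?\<beta> * (l * r) ^ CARD('k)))"
    using le r l b True \<beta> by (simp add: emeasure_cball ennreal_mult)
  then have "a * (?\<beta> * r ^ CARD('k)) \<le> b * (?\<beta> * (l * r) ^ CARD('k))"
    using b \<beta> l r by (subst (asm) ennreal_le_iff) auto
  also have "\<dots> = (b * l ^ CARD('k)) * (?\<beta> * r ^ CARD('k))" by (simp add: power_mult_distrib)
  finally show ?thesis using \<beta> r by (simp add: mult_le_cancel_right_pos)
next
  case False
  have "0 \<le> b * l ^ CARD('k)" using b l by simp
  then show ?thesis using False by linarith
qed

text \<open>The lower bound for the first field on a disc of radius \<open>\<delta>\<close>, the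
  equality of the two expectations there, and the upper bound for the second field with radius
  \<open>(1 + t) * \<delta>\<close> are chained. The additive errors and the volume ratio vanish
  with \<open>t\<close>.\<close>

lemma weighted_expectation_le:
  fixes A :: "('m::{t2_space,second_countable_topology}, 'n::finite) chart set"
    and X1 :: "'a \<Rightarrow> 'm \<Rightarrow> real^'k::finite" and X2 :: "'b \<Rightarrow> 'm \<Rightarrow> real^'k"
  assumes A: "smooth_atlas A" and g: "riemannian_metric A g"
    and zk1: "z_KROK A g P1 X1 \<rho>1 \<mu>1" and zk2: "z_KROK A g P2 X2 \<rho>2 \<mu>2"
    and law: "\<And>W. W \<subseteq> Collect (C1_submanifold A) \<Longrightarrow>
           {f \<in> (regular_maps A :: ('m \<Rightarrow> real^'k) set). zero_set f \<in> W} \<in> sets (borel_C1 A) \<Longrightarrow>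
           measure P1 {\<omega> \<in> space P1. X1 \<omega> \<in> regular_maps A \<and> zero_set (X1 \<omega>) \<in> W} =
           measure P2 {\<omega> \<in> space P2. X2 \<omega> \<in> regular_maps A \<and> zero_set (X2 \<omega>) \<in> W}"
  shows "\<rho>1 p 0 * (\<integral>f. dir_part u s (wedge (differential A f p)) \<partial>\<mu>1 p 0)
     \<le> \<rho>2 p 0 * (\<integral>f. dir_part u s (wedge (differential A f p)) \<partial>\<mu>2 p 0)"
proof -
  define c where "c = chart_at A p"
  have c: "c \<in> A" "p \<in> fst c" unfolding c_def by (rule chart_at_in[OF A])+
  have diff: "differential A f p = chart_differential c f (snd c p)" for f :: "'m \<Rightarrow> real^'k"
    by (simp add: differential_eq c_def)
  define G1 where "G1 = \<rho>1 p 0 * (\<integral>f. dir_part u s (wedge (chart_differential c f (snd c p))) \<partial>\<mu>1 p 0)"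
  define G2 where "G2 = \<rho>2 p 0 * (\<integral>f. dir_part u s (wedge (chart_differential c f (snd c p))) \<partial>\<mu>2 p 0)"
  have "0 \<le> \<rho>2 p 0" using zk2 unfolding z_KROK_def by blast
  \<comment> \<open>Nonnegativity keeps the passage from \<open>ennreal\<close> back to real numbers
    faithful for the upper bound.\<close>
  then have G2: "0 \<le> G2" unfolding G2_def by (intro mult_nonneg_nonneg integral_nonneg_AE AE_I2) auto
  have "G1 \<le> G2"
  proof (rule le_of_perturbed_le)
    fix t :: real assume t: "0 < t"
    obtain \<delta>1 where \<delta>1: "\<delta>1 > 0" "\<And>\<delta>. 0 < \<delta> \<Longrightarrow> \<delta> < \<delta>1 \<Longrightarrow>
        ennreal (G1 - t) * emeasure lborel (cball (0::real^'k) \<delta>) \<le> (\<integral>\<^sup>+\<omega>. disc_weight c (snd c p) s u \<delta> (X1 \<omega>) \<partial>P1)"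
      using expectation_disc_weight_lower[OF A g zk1 c t, where u = u and s = s] unfolding G1_def by blast
    obtain \<delta>2 where \<delta>2: "\<delta>2 > 0" "\<And>\<delta> \<delta>'. 0 < \<delta> \<Longrightarrow> \<delta> < \<delta>' \<Longrightarrow> \<delta>' < \<delta>2 \<Longrightarrow>
        (\<integral>\<^sup>+\<omega>. disc_weight c (snd c p) s u \<delta> (X2 \<omega>) \<partial>P2) \<le> ennreal (G2 + t) * emeasure lborel (cball (0::real^'k) \<delta>')"
      using expectation_disc_weight_upper(2)[OF A g zk2 c t, where u = u and s = s] unfolding G2_def by blast
    obtain \<delta>3 where \<delta>3: "\<delta>3 > 0" "disc (snd c p) s ` cball 0 \<delta>3 \<subseteq> snd c ` fst c"
      using disc_radius[OF A c, where s = s] by metis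
    define m where "m = min (min \<delta>1 \<delta>2) \<delta>3"
    have m: "0 < m" "m \<le> \<delta>1" "m \<le> \<delta>2" "m \<le> \<delta>3" using \<delta>1(1) \<delta>2(1) \<delta>3(1) by (simp_all add: m_def)
    \<comment> \<open>Chosen so that the larger radius \<open>(1 + t) * \<delta>\<close> equals
      \<open>m / 2\<close>, below all three thresholds.\<close>
    define \<delta> where "\<delta> = m / 2 * inverse (1 + t)"
    have \<delta>: "0 < \<delta>" using m t by (simp add: \<delta>_def)
    have l: "(1 + t) * \<delta> = m / 2"
    proof -
      have "(1 + t) * \<delta> = m / 2 * ((1 + t) * inverse (1 + t))" by (simp only: \<delta>_def ac_simps)
      also have "(1 + t) * inverse (1 + t) = 1" by (rule right_inverse) (use t in simp)
      finally show ?thesis by simp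
    qed
    have lt: "\<delta> < (1 + t) * \<delta>" using \<delta> t by (simp add: distrib_right)
    have b: "\<delta> < \<delta>1" "(1 + t) * \<delta> < \<delta>2" "\<delta> < \<delta>3" using l lt m by linarith+
    have D: "disc (snd c p) s ` cball 0 \<delta> \<subseteq> snd c ` fst c"
    proof -
      have "cball (0::real^'k) \<delta> \<subseteq> cball 0 \<delta>3" using b(3) by (intro subset_cball) simp
      then show ?thesis by (rule subset_trans[OF image_mono \<delta>3(2)])
    qed
    have "ennreal (G1 - t) * emeasure lborel (cball (0::real^'k) \<delta>) \<le> (\<integral>\<^sup>+\<omega>. disc_weight c (snd c p) s u \<delta> (X1 \<omega>) \<partial>P1)"
      by (rule \<delta>1(2)[OF \<delta> b(1)])
    also have "\<dots> = (\<integral>\<^sup>+\<omega>. disc_weight c (snd c p) s u \<delta> (X2 \<omega>) \<partial>P2)"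
      by (rule expectation_disc_weight_eq[OF A g zk1 zk2 law c(1) D])
    also have "\<dots> \<le> ennreal (G2 + t) * emeasure lborel (cball (0::real^'k) ((1 + t) * \<delta>))"
      by (rule \<delta>2(2)[OF \<delta> lt b(2)])
    finally show "G1 - t \<le> (G2 + t) * (1 + t) ^ CARD('k)"
      by (rule volume_cball_scaled_le) (use \<delta> t G2 in auto)
  qed
  then show ?thesis unfolding G1_def G2_def diff .
qed

text \<open>\<open>dir_part\<close> is integrable as a limit dominated by a multiple of the
  Jacobian, and summation over the directions transfers this to
  \<open>\<bar>w \<bullet> u\<bar>\<close>.\<close>

lemma integrable_wedge_inner:
  fixes A :: "('m::{t2_space,second_countable_topology}, 'n::finite) chart set"
    and X :: "'a \<Rightarrow> 'm \<Rightarrow> real^'k::finite"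
  assumes A: "smooth_atlas A" and g: "riemannian_metric A g" and zk: "z_KROK A g P X \<rho> \<mu>"
  shows "integrable (\<mu> p 0) (\<lambda>f. dir_part u s (wedge (differential A f p)))"
    and "integrable (\<mu> p 0) (\<lambda>f. wedge (differential A f p) \<bullet> u)"
proof -
  define c where "c = chart_at A p"
  have c: "c \<in> A" "p \<in> fst c" unfolding c_def by (rule chart_at_in[OF A])+
  have diff: "differential A f p = chart_differential c f (snd c p)" for f :: "'m \<Rightarrow> real^'k"
    by (simp add: differential_eq c_def)
  have dp: "integrable (\<mu> p 0) (\<lambda>f. dir_part u s (wedge (differential A f p)))" for s
    unfolding diff by (rule expectation_disc_weight_upper(1)[OF A g zk c, of 1]) simp
  then show "integrable (\<mu> p 0) (\<lambda>f. dir_part u s (wedge (differential A f p)))" .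
  have sets: "sets (\<mu> p 0) = sets (borel_C1 A)"
    using zk unfolding z_KROK_def regular_conditional_prob_def by auto
  have "continuous_map (weak_whitney A) euclideanreal (\<lambda>f :: 'm \<Rightarrow> real^'k. wedge (snd (chart_jet c f (snd c p))) \<bullet> u)"
  proof (rule continuous_map_jet[OF A c(1), where R = "\<lambda>j. wedge (snd j) \<bullet> u"])
    show "continuous_on UNIV (\<lambda>j :: (real^'k) \<times> (real^'n^'k). wedge (snd j) \<bullet> u)"
      by (intro continuous_intros continuous_on_compose2[OF continuous_on_wedge]) auto
  qed (use c in auto)
  from borel_measurable_continuous_map[OF A this]
  have m: "(\<lambda>f. wedge (differential A f p) \<bullet> u) \<in> borel_measurable (\<mu> p 0)"
    unfolding measurable_cong_sets[OF sets refl] by (simp add: chart_jet_def diff)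
  have "integrable (\<mu> p 0) (\<lambda>f. \<Sum>s\<in>UNIV. dir_part u s (wedge (differential A f p)))"
    by (intro Bochner_Integration.integrable_sum dp)
  then have "integrable (\<mu> p 0) (\<lambda>f. \<bar>wedge (differential A f p) \<bullet> u\<bar>)" by (simp add: sum_dir_part)
  then show "integrable (\<mu> p 0) (\<lambda>f. wedge (differential A f p) \<bullet> u)"
    using m by (simp add: integrable_abs_iff)
qed

text \<open>Exchanging the two fields gives the reverse inequality in each direction, and
  \<open>sum_dir_part\<close> adds the directions up.\<close>

lemma abs_expectation_eq:
  fixes A :: "('m::{t2_space,second_countable_topology}, 'n::finite) chart set"
    and X1 :: "'a \<Rightarrow> 'm \<Rightarrow> real^'k::finite" and X2 :: "'b \<Rightarrow> 'm \<Rightarrow> real^'k"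
  assumes A: "smooth_atlas A" and g: "riemannian_metric A g"
    and zk1: "z_KROK A g P1 X1 \<rho>1 \<mu>1" and zk2: "z_KROK A g P2 X2 \<rho>2 \<mu>2"
    and law: "\<And>W. W \<subseteq> Collect (C1_submanifold A) \<Longrightarrow>
           {f \<in> (regular_maps A :: ('m \<Rightarrow> real^'k) set). zero_set f \<in> W} \<in> sets (borel_C1 A) \<Longrightarrow>
           measure P1 {\<omega> \<in> space P1. X1 \<omega> \<in> regular_maps A \<and> zero_set (X1 \<omega>) \<in> W} =
           measure P2 {\<omega> \<in> space P2. X2 \<omega> \<in> regular_maps A \<and> zero_set (X2 \<omega>) \<in> W}"
  shows "\<rho>1 p 0 * (\<integral>f. \<bar>wedge (differential A f p) \<bullet> u\<bar> \<partial>\<mu>1 p 0)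
     = \<rho>2 p 0 * (\<integral>f. \<bar>wedge (differential A f p) \<bullet> u\<bar> \<partial>\<mu>2 p 0)"
proof -
  have eq: "\<rho>1 p 0 * (\<integral>f. dir_part u s (wedge (differential A f p)) \<partial>\<mu>1 p 0)
     = \<rho>2 p 0 * (\<integral>f. dir_part u s (wedge (differential A f p)) \<partial>\<mu>2 p 0)" for s
    by (rule antisym) (rule weighted_expectation_le[OF A g zk1 zk2 law] weighted_expectation_le[OF A g zk2 zk1 law[symmetric]]; assumption)+
  have s1: "(\<integral>f. \<bar>wedge (differential A f p) \<bullet> u\<bar> \<partial>\<mu>1 p 0) = (\<Sum>s\<in>UNIV. \<integral>f. dir_part u s (wedge (differential A f p)) \<partial>\<mu>1 p 0)"
    unfolding sum_dir_part[symmetric]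
    by (rule Bochner_Integration.integral_sum) (rule integrable_wedge_inner(1)[OF A g zk1])
  have s2: "(\<integral>f. \<bar>wedge (differential A f p) \<bullet> u\<bar> \<partial>\<mu>2 p 0) = (\<Sum>s\<in>UNIV. \<integral>f. dir_part u s (wedge (differential A f p)) \<partial>\<mu>2 p 0)"
    unfolding sum_dir_part[symmetric]
    by (rule Bochner_Integration.integral_sum) (rule integrable_wedge_inner(1)[OF A g zk2])
  show ?thesis unfolding s1 s2 sum_distrib_left eq ..
qed

section \<open>Zonoids\<close>

lemma subspace_alt_tensors: "subspace (alt_tensors :: (real^('k::finite \<Rightarrow> 'n::finite)) set)"
  unfolding subspace_def alt_tensors_def by (auto simp: distrib_left mult.left_commute)

lemma wedge_alt_tensors: "wedge D \<in> alt_tensors"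
  unfolding alt_tensors_def
proof (intro CollectI conjI allI impI)
  fix s :: "'a \<Rightarrow> 'b" assume "\<not> inj s"
  then obtain i j where ij: "i \<noteq> j" "s i = s j" by (auto simp: inj_def)
  have "column i (\<chi> i j. D $ i $ s j) = column j (\<chi> i j. D $ i $ s j)"
    using ij by (simp add: column_def vec_eq_iff)
  then show "wedge D $ s = 0" unfolding wedge_nth by (rule det_identical_columns[OF ij(1)])
next
  fix s :: "'a \<Rightarrow> 'b" and \<pi> :: "'a \<Rightarrow> 'a" assume "\<pi> permutes UNIV"
  from det_permute_columns[OF this, of "\<chi> i j. D $ i $ s j"]
  show "wedge D $ (s \<circ> \<pi>) = of_int (sign \<pi>) * wedge D $ s" by (simp add: wedge_nth)
qed

text \<open>A translation amounts to one further summand, the degenerate segment from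
  \<open>d\<close> to \<open>d\<close>.\<close>

lemma zonotope_translate:
  fixes a b :: "nat \<Rightarrow> 'a::euclidean_space"
  shows "zonotope (Suc N) (a(N := d)) (b(N := d)) = (\<lambda>x. d + x) ` zonotope N a b"
proof (intro set_eqI iffI)
  fix y assume "y \<in> zonotope (Suc N) (a(N := d)) (b(N := d))"
  then obtain x where x: "y = (\<Sum>i<Suc N. x i)" "\<And>i. i < Suc N \<Longrightarrow> x i \<in> closed_segment ((a(N := d)) i) ((b(N := d)) i)"
    unfolding zonotope_def by blast
  have "x N = d" using x(2)[of N] by simp
  then have "y = d + (\<Sum>i<N. x i)" using x(1) by (simp add: add.commute)
  moreover have "(\<Sum>i<N. x i) \<in> zonotope N a b"
    unfolding zonotope_def
  proof (intro CollectI exI conjI allI impI)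
    fix i assume "i < N"
    then show "x i \<in> closed_segment (a i) (b i)" using x(2)[of i] by simp
  qed simp
  ultimately show "y \<in> (\<lambda>x. d + x) ` zonotope N a b" by blast
next
  fix y assume "y \<in> (\<lambda>x. d + x) ` zonotope N a b"
  then obtain x where x: "y = d + (\<Sum>i<N. x i)" "\<And>i. i < N \<Longrightarrow> x i \<in> closed_segment (a i) (b i)"
    unfolding zonotope_def by blast
  show "y \<in> zonotope (Suc N) (a(N := d)) (b(N := d))"
    unfolding zonotope_def
  proof (intro CollectI exI[of _ "x(N := d)"] conjI allI impI)
    show "y = (\<Sum>i<Suc N. (x(N := d)) i)" using x(1) by (simp add: add.commute)
    fix i assume "i < Suc N"
    then show "(x(N := d)) i \<in> closed_segment ((a(N := d)) i) ((b(N := d)) i)" using x(2)[of i] by auto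
  qed
qed

lemma zonoid_translate:
  fixes K :: "'a::euclidean_space set"
  assumes "zonoid K"
  shows "zonoid ((\<lambda>x. d + x) ` K)"
proof -
  obtain N and a b :: "nat \<Rightarrow> nat \<Rightarrow> 'a" where lim: "hausdorff_limit (\<lambda>n. zonotope (N n) (a n) (b n)) K"
    using assms unfolding zonoid_def by blast
  have "hausdorff_limit (\<lambda>n. (\<lambda>x. d + x) ` zonotope (N n) (a n) (b n)) ((\<lambda>x. d + x) ` K)"
    using lim unfolding hausdorff_limit_def by (simp add: dist_add_cancel)
  then have "hausdorff_limit (\<lambda>n. zonotope (Suc (N n)) ((a n)(N n := d)) ((b n)(N n := d))) ((\<lambda>x. d + x) ` K)"
    by (simp only: zonotope_translate)
  moreover have "compact ((\<lambda>x. d + x) ` K)" "convex ((\<lambda>x. d + x) ` K)" "(\<lambda>x. d + x) ` K \<noteq> {}"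
    using assms unfolding zonoid_def by (auto intro: compact_translation convex_translation)
  ultimately show ?thesis
    unfolding zonoid_def
    by (intro conjI exI[of _ "\<lambda>n. Suc (N n)"] exI[of _ "\<lambda>n. (a n)(N n := d)"] exI[of _ "\<lambda>n. (b n)(N n := d)"]) auto
qed

lemma pairing_add_left: "pairing (v + w) u = pairing v u + pairing w u"
  by (simp add: pairing_def inner_add_left add_divide_distrib)

lemma bdd_above_pairing: "compact K \<Longrightarrow> bdd_above ((\<lambda>w. pairing w u) ` K)"
  unfolding pairing_def
  by (intro bounded_imp_bdd_above compact_imp_bounded compact_continuous_image continuous_intros) auto

lemma support_fun_translate:
  assumes K: "compact K" "K \<noteq> {}"
  shows "support_fun ((\<lambda>x. d + x) ` K) u = pairing d u + support_fun K u"
proof (rule antisym)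
  show "support_fun ((\<lambda>x. d + x) ` K) u \<le> pairing d u + support_fun K u"
    unfolding support_fun_def image_image pairing_add_left
    by (rule cSUP_least[OF K(2)]) (use cSUP_upper[OF _ bdd_above_pairing[OF K(1)]] in simp)
  have "support_fun K u \<le> support_fun ((\<lambda>x. d + x) ` K) u - pairing d u"
    unfolding support_fun_def
  proof (rule cSUP_least[OF K(2)])
    fix w assume w: "w \<in> K"
    have "pairing (d + w) u \<le> (SUP v\<in>(\<lambda>x. d + x) ` K. pairing v u)"
      by (rule cSUP_upper) (use w bdd_above_pairing[OF compact_translation[OF K(1)]] in auto)
    then show "pairing w u \<le> (SUP v\<in>(\<lambda>x. d + x) ` K. pairing v u) - pairing d u"
      by (simp add: pairing_add_left)
  qed
  then show "pairing d u + support_fun K u \<le> support_fun ((\<lambda>x. d + x) ` K) u" by simp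
qed

text \<open>A point of \<open>L\<close> outside \<open>K\<close> is strictly separated from
  \<open>K\<close> by a hyperplane. Since support functions are compared on alternating tensors
  only, the normal is replaced by its orthogonal projection to that subspace, which has the same
  inner products with both sets.\<close>

lemma support_fun_subset:
  assumes K: "compact K" "convex K" "K \<noteq> {}" and L: "compact L" "L \<subseteq> alt_tensors"
    and KA: "K \<subseteq> alt_tensors"
    and eq: "\<And>u. u \<in> alt_tensors \<Longrightarrow> support_fun K u = support_fun L u"
  shows "L \<subseteq> K"
proof
  fix x assume x: "x \<in> L"
  show "x \<in> K"
  proof (rule ccontr)
    assume "x \<notin> K"
    then obtain a b where ab: "a \<bullet> x < b" "\<And>y. y \<in> K \<Longrightarrow> b < a \<bullet> y"
      using separating_hyperplane_closed_point[OF K(2) compact_imp_closed[OF K(1)]] by blast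
    obtain v z where v: "v \<in> span alt_tensors" and z: "\<And>w. w \<in> span alt_tensors \<Longrightarrow> orthogonal z w" and a: "a = v + z"
      using orthogonal_subspace_decomp_exists[of alt_tensors a] by blast
    have vA: "v \<in> alt_tensors" using v span_eq_iff[of alt_tensors] subspace_alt_tensors by blast
    have av: "a \<bullet> w = v \<bullet> w" if "w \<in> alt_tensors" for w
      using z[OF span_base[OF that]] by (simp add: a inner_add_left orthogonal_def)
    \<comment> \<open>The separation puts \<open>K\<close> on the side of larger values, while a
      support function is a supremum; hence the sign.\<close>
    let ?u = "- v"
    have uA: "?u \<in> alt_tensors" using subspace_alt_tensors vA by (rule subspace_neg)
    let ?f = "fact CARD('a) :: real"
    have f: "0 < ?f" by simp
    have p: "pairing w ?u = - (a \<bullet> w) / ?f" if "w \<in> alt_tensors" for w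
      using av[OF that] by (simp add: pairing_def inner_commute)
    have "support_fun K ?u \<le> - b / ?f"
      unfolding support_fun_def
    proof (rule cSUP_least[OF K(3)])
      fix w assume w: "w \<in> K"
      then have "pairing w ?u = - (a \<bullet> w) / ?f" using KA p by blast
      also have "\<dots> \<le> - b / ?f" using ab(2)[OF w] by (intro divide_right_mono) auto
      finally show "pairing w ?u \<le> - b / ?f" .
    qed
    also have "\<dots> < - (a \<bullet> x) / ?f" using ab(1) by (intro divide_strict_right_mono) auto
    also have "\<dots> = pairing x ?u" using p x L(2) by auto
    also have "\<dots> \<le> support_fun L ?u"
      unfolding support_fun_def by (rule cSUP_upper[OF x bdd_above_pairing[OF L(1)]])
    finally show False using eq[OF uA] by simp
  qed
qed

text \<open>A set and its translate have the same translates, so both descriptions select among the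
  same candidates.\<close>

lemma centered_translate: "centered ((\<lambda>x. d + x) ` K) = centered K"
proof -
  have "(\<exists>c. L = (\<lambda>x. c + x) ` (\<lambda>x. d + x) ` K) \<longleftrightarrow> (\<exists>c. L = (\<lambda>x. c + x) ` K)" for L
  proof
    assume "\<exists>c. L = (\<lambda>x. c + x) ` (\<lambda>x. d + x) ` K"
    then obtain c where "L = (\<lambda>x. (c + d) + x) ` K" by (auto simp: image_image add.assoc)
    then show "\<exists>c. L = (\<lambda>x. c + x) ` K" by blast
  next
    assume "\<exists>c. L = (\<lambda>x. c + x) ` K"
    then obtain c where "L = (\<lambda>x. c + x) ` K" by blast
    then have "L = (\<lambda>x. (c - d) + x) ` (\<lambda>x. d + x) ` K" by (simp add: image_image)
    then show "\<exists>c. L = (\<lambda>x. c + x) ` (\<lambda>x. d + x) ` K" by blast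
  qed
  then show ?thesis by (simp add: centered_def)
qed

text \<open>A convex body is determined by its support function, so each description has at most one
  solution, and translation by \<open>d\<close> carries solutions for \<open>h2\<close> to solutions
  for \<open>h1\<close>. If there are none, the two predicates are both identically false and the
  definite descriptions coincide.\<close>

lemma centered_The_eq:
  fixes h1 h2 :: "real^('k::finite \<Rightarrow> 'n::finite) \<Rightarrow> real"
  assumes d: "d \<in> alt_tensors" and h: "\<And>u. u \<in> alt_tensors \<Longrightarrow> h1 u = pairing d u + h2 u"
  shows "centered (THE K. zonoid K \<and> K \<subseteq> alt_tensors \<and> (\<forall>u\<in>alt_tensors. support_fun K u = h1 u))
    = centered (THE K. zonoid K \<and> K \<subseteq> alt_tensors \<and> (\<forall>u\<in>alt_tensors. support_fun K u = h2 u))"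
proof -
  define Q where "Q h K \<longleftrightarrow> zonoid K \<and> K \<subseteq> alt_tensors \<and> (\<forall>u\<in>alt_tensors. support_fun K u = h u)"
    for h and K :: "(real^('k \<Rightarrow> 'n)) set"
  have unique: "K = L" if "Q h K" "Q h L" for h K L
  proof -
    have sub: "L \<subseteq> K" if "Q h K" "Q h L" for K L
    proof (rule support_fun_subset)
      show "compact K" "convex K" "K \<noteq> {}" "compact L" "L \<subseteq> alt_tensors" "K \<subseteq> alt_tensors"
        using that unfolding Q_def zonoid_def by blast+
      show "support_fun K u = support_fun L u" if "u \<in> alt_tensors" for u
        using \<open>Q h K\<close> \<open>Q h L\<close> that unfolding Q_def by simp
    qed
    show ?thesis by (rule antisym[OF sub[OF that(2,1)] sub[OF that]])
  qed
  have trans: "Q h1' ((\<lambda>x. e + x) ` K)"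
    if "e \<in> alt_tensors" "\<And>u. u \<in> alt_tensors \<Longrightarrow> h1' u = pairing e u + h2' u" "Q h2' K" for h1' h2' e K
    unfolding Q_def
  proof (intro conjI ballI)
    show "zonoid ((\<lambda>x. e + x) ` K)" by (rule zonoid_translate) (use that(3) in \<open>simp add: Q_def\<close>)
    show "(\<lambda>x. e + x) ` K \<subseteq> alt_tensors"
      using that(1,3) subspace_add[OF subspace_alt_tensors] unfolding Q_def by blast
    fix u :: "real^('k \<Rightarrow> 'n)" assume u: "u \<in> alt_tensors"
    have K: "compact K" "K \<noteq> {}" "support_fun K u = h2' u"
      using that(3) u unfolding Q_def zonoid_def by blast+
    show "support_fun ((\<lambda>x. e + x) ` K) u = h1' u"
      unfolding support_fun_translate[OF K(1,2)] K(3) that(2)[OF u] ..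
  qed
  show ?thesis
    unfolding Q_def[symmetric]
  proof (cases "\<exists>K. Q h2 K")
    case True
    then obtain K where K: "Q h2 K" by blast
    have K': "Q h1 ((\<lambda>x. d + x) ` K)" by (rule trans[OF d h K])
    have "(THE K. Q h2 K) = K" by (rule the_equality, rule K, erule unique[OF _ K])
    moreover have "(THE K. Q h1 K) = (\<lambda>x. d + x) ` K" by (rule the_equality, rule K', erule unique[OF _ K'])
    ultimately show "centered (THE K. Q h1 K) = centered (THE K. Q h2 K)" by (simp add: centered_translate)
  next
    case False
    have "\<not> Q h1 K" for K
    proof
      assume K: "Q h1 K"
      have "Q h2 ((\<lambda>x. - d + x) ` K)"
      proof (rule trans[OF _ _ K])
        show "- d \<in> alt_tensors" by (rule subspace_neg[OF subspace_alt_tensors d])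
        show "h2 u = pairing (- d) u + h1 u" if "u \<in> alt_tensors" for u
          using h[OF that] by (simp add: pairing_def)
      qed
      with False show False by blast
    qed
    then have "Q h1 = Q h2" using False by (intro ext) blast
    then show "centered (THE K. Q h1 K) = centered (THE K. Q h2 K)" by simp
  qed
qed

text \<open>As max 0 t = (|t| + t) / 2, the function splits into a linear and an even part. The
  linear part is the pairing with half the density times the mean wedge; the factorial is the
  normalisation in \<open>pairing\<close>.\<close>

lemma support_expectation:
  fixes A :: "('m::{t2_space,second_countable_topology}, 'n::finite) chart set"
    and X :: "'a \<Rightarrow> 'm \<Rightarrow> real^'k::finite"
  assumes A: "smooth_atlas A" and g: "riemannian_metric A g" and zk: "z_KROK A g P X \<rho> \<mu>"
  obtains e where "e \<in> alt_tensors"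
    "\<And>u. \<rho> p 0 * (\<integral>f. max 0 (pairing (wedge (differential A f p)) u) \<partial>\<mu> p 0)
      = pairing e u + (\<rho> p 0 * (\<integral>f. \<bar>wedge (differential A f p) \<bullet> u\<bar> \<partial>\<mu> p 0)) / (2 * fact CARD('k))"
proof -
  let ?w = "\<lambda>f :: 'm \<Rightarrow> real^'k. wedge (differential A f p)"
  note int = integrable_wedge_inner(2)[OF A g zk]
  define e where "e = (\<chi> s. \<rho> p 0 / 2 * (\<integral>f. ?w f $ s \<partial>\<mu> p 0))"
  have int_s: "integrable (\<mu> p 0) (\<lambda>f. ?w f $ s)" for s
    using int[of p "axis s 1"] by (simp add: inner_axis)
  have "e \<in> alt_tensors"
    unfolding alt_tensors_def
  proof (intro CollectI conjI allI impI)
    fix s :: "'k \<Rightarrow> 'n" assume "\<not> inj s"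
    then have "?w f $ s = 0" for f using wedge_alt_tensors[of "differential A f p"] by (simp add: alt_tensors_def)
    then show "e $ s = 0" by (simp add: e_def)
  next
    fix s :: "'k \<Rightarrow> 'n" and \<pi> :: "'k \<Rightarrow> 'k" assume "\<pi> permutes UNIV"
    then have "?w f $ (s \<circ> \<pi>) = of_int (sign \<pi>) * ?w f $ s" for f
      using wedge_alt_tensors[of "differential A f p"] by (simp add: alt_tensors_def)
    then show "e $ (s \<circ> \<pi>) = of_int (sign \<pi>) * e $ s" by (simp add: e_def)
  qed
  moreover have "\<rho> p 0 * (\<integral>f. max 0 (pairing (?w f) u) \<partial>\<mu> p 0)
      = pairing e u + (\<rho> p 0 * (\<integral>f. \<bar>?w f \<bullet> u\<bar> \<partial>\<mu> p 0)) / (2 * fact CARD('k))" for u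
  proof -
    have max: "max 0 (pairing (?w f) u) = (\<bar>?w f \<bullet> u\<bar> + ?w f \<bullet> u) * (1 / (2 * fact CARD('k)))" for f
    proof -
      have "max 0 t = (\<bar>t\<bar> + t) / 2" for t :: real by (simp add: max_def)
      then show ?thesis by (simp add: pairing_def abs_divide add_divide_distrib)
    qed
    have "(\<integral>f. max 0 (pairing (?w f) u) \<partial>\<mu> p 0)
       = ((\<integral>f. \<bar>?w f \<bullet> u\<bar> \<partial>\<mu> p 0) + (\<integral>f. ?w f \<bullet> u \<partial>\<mu> p 0)) * (1 / (2 * fact CARD('k)))"
      unfolding max using int[of p u] by simp
    moreover have "\<rho> p 0 / 2 * (\<integral>f. ?w f \<bullet> u \<partial>\<mu> p 0) = e \<bullet> u"
    proof -
      have "(\<integral>f. ?w f \<bullet> u \<partial>\<mu> p 0) = (\<Sum>s\<in>UNIV. (\<integral>f. ?w f $ s \<partial>\<mu> p 0) * u $ s)"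
        unfolding inner_vec_def inner_real_def using int_s by (subst Bochner_Integration.integral_sum) auto
      then show ?thesis by (simp add: e_def inner_vec_def sum_distrib_left mult.assoc)
    qed
    ultimately show ?thesis by (simp add: pairing_def field_simps)
  qed
  ultimately show ?thesis using that by blast
qed

theorem proposition7p13:
  fixes A :: "('m::{t2_space,second_countable_topology}, 'n::finite) chart set"
    and g :: "'m \<Rightarrow> real^'n^'n"
    and P1 :: "'a measure" and P2 :: "'b measure"
    and X1 :: "'a \<Rightarrow> 'm \<Rightarrow> real^'k::finite" and X2 :: "'b \<Rightarrow> 'm \<Rightarrow> real^'k"
    and \<rho>1 \<rho>2 :: "'m \<Rightarrow> real^'k \<Rightarrow> real"
    and \<mu>1 \<mu>2 :: "'m \<Rightarrow> real^'k \<Rightarrow> ('m \<Rightarrow> real^'k) measure"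
  assumes "smooth_atlas A" and "riemannian_metric A g"
    and "z_KROK A g P1 X1 \<rho>1 \<mu>1" and "z_KROK A g P2 X2 \<rho>2 \<mu>2"
    and "\<And>W. W \<subseteq> Collect (C1_submanifold A) \<Longrightarrow>
           {f \<in> (regular_maps A :: ('m \<Rightarrow> real^'k) set). zero_set f \<in> W} \<in> sets (borel_C1 A) \<Longrightarrow>
           measure P1 {\<omega> \<in> space P1. X1 \<omega> \<in> regular_maps A \<and> zero_set (X1 \<omega>) \<in> W} =
           measure P2 {\<omega> \<in> space P2. X2 \<omega> \<in> regular_maps A \<and> zero_set (X2 \<omega>) \<in> W}"
  shows "\<forall>p. centered (zonoid_section A \<rho>1 \<mu>1 p) = centered (zonoid_section A \<rho>2 \<mu>2 p)"
proof
  fix p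
  obtain e1 where e1: "e1 \<in> alt_tensors"
    "\<And>u. \<rho>1 p 0 * (\<integral>f. max 0 (pairing (wedge (differential A f p)) u) \<partial>\<mu>1 p 0)
      = pairing e1 u + (\<rho>1 p 0 * (\<integral>f. \<bar>wedge (differential A f p) \<bullet> u\<bar> \<partial>\<mu>1 p 0)) / (2 * fact CARD('k))"
    using support_expectation[OF assms(1-3)] by blast
  obtain e2 where e2: "e2 \<in> alt_tensors"
    "\<And>u. \<rho>2 p 0 * (\<integral>f. max 0 (pairing (wedge (differential A f p)) u) \<partial>\<mu>2 p 0)
      = pairing e2 u + (\<rho>2 p 0 * (\<integral>f. \<bar>wedge (differential A f p) \<bullet> u\<bar> \<partial>\<mu>2 p 0)) / (2 * fact CARD('k))"
    using support_expectation[OF assms(1,2,4)] by blast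
  show "centered (zonoid_section A \<rho>1 \<mu>1 p) = centered (zonoid_section A \<rho>2 \<mu>2 p)"
    unfolding zonoid_section_def
  proof (rule centered_The_eq)
    \<comment> \<open>The even parts agree by \<open>abs_expectation_eq\<close>, so the support
      functions differ by the pairing with \<open>e1 - e2\<close>, a translation that
      \<open>centered\<close> removes.\<close>
    show "e1 - e2 \<in> alt_tensors" by (rule subspace_diff[OF subspace_alt_tensors e1(1) e2(1)])
    fix u :: "real^('k \<Rightarrow> 'n)"
    show "\<rho>1 p 0 * (\<integral>f. max 0 (pairing (wedge (differential A f p)) u) \<partial>\<mu>1 p 0)
      = pairing (e1 - e2) u + \<rho>2 p 0 * (\<integral>f. max 0 (pairing (wedge (differential A f p)) u) \<partial>\<mu>2 p 0)"
    proof -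
      have "pairing e1 u = pairing (e1 - e2) u + pairing e2 u"
        by (simp add: pairing_def inner_diff_left diff_divide_distrib)
      moreover have "\<rho>1 p 0 * (\<integral>f. \<bar>wedge (differential A f p) \<bullet> u\<bar> \<partial>\<mu>1 p 0)
        = \<rho>2 p 0 * (\<integral>f. \<bar>wedge (differential A f p) \<bullet> u\<bar> \<partial>\<mu>2 p 0)"
        by (rule abs_expectation_eq[OF assms])
      ultimately show ?thesis unfolding e1(2)[of u] e2(2)[of u] by (simp only: add.assoc)
    qed
  qed
qed

end
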